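(* Let $\rho:\mathbb{R}^d\to(0,\infty)$ be a critical radius function, let $u\in A_1^{\rho}$ and $v\in A_\infty^\rho(u)$. Then there exist $\sigma\geq 0$ and $C>0$ such that $$uv\left(\left\{x\in\mathbb{R}^d: \frac{M^{\rho,\sigma}(fv)(x)}{v(x)}>t\right\}\right)\leq \frac{C}{t}\int_{\mathbb{R}^d} |f(x)|\,u(x)v(x)\,dx$$ for every $t>0$ and every bounded function $f$ with compact support.
   Context: A critical radius function is a function $\rho:\mathbb{R}^d\to(0,\infty)$ for which there exist constants $C_0,N_0\geq 1$ such that for all $x,y\in\mathbb{R}^d$ $$C_0^{-1}\rho(x)\left(1+\frac{|x-y|}{\rho(x)}\right)^{-N_0}\leq \rho(y)\leq C_0\,\rho(x)\left(1+\frac{|x-y|}{\rho(x)}\right)^{\frac{N_0}{N_0+1}}.$$ Cubes have sides parallel to the coordinate axes; $Q(x,r)$ denotes the cube with center $x$ and radius $r=\sqrt d\,\ell(Q)/2$, where $\ell(Q)$ is the side length. A weight is a locally integrable function $w$ with $0<w(x)<\infty$ for almost every $x$; $w(E)=\int_E w$, and $uv(E)=\int_E u(x)v(x)\,dx$. Infima of weights are essential. $p'=p/(p-1)$. Let $u$ be a weight and $\theta\geq 0$. For $1<p<\infty$, $w\in A_p^{\rho,\theta}(u)$ means that the weight $w$ satisfies, with a constant $C$ independent of $Q$, $$\left(\frac{1}{u(Q)}\int_Q wu\right)^{1/p}\left(\frac{1}{u(Q)}\int_Q w^{1-p'}u\right)^{1/p'}\leq C\left(1+\frac{r}{\rho(x)}\right)^{\theta}\quad\text{for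 every cube }Q=Q(x,r);$$ $w\in A_1^{\rho,\theta}(u)$ means $\frac{1}{u(Q)}\int_Q wu\leq C\left(1+\frac{r}{\rho(x)}\right)^{\theta}\inf_Q w$ for every cube $Q=Q(x,r)$. Set $A_p^\rho(u)=\bigcup_{\theta\geq0}A_p^{\rho,\theta}(u)$ for $1\leq p<\infty$ and $A_\infty^\rho(u)=\bigcup_{p\geq1}A_p^\rho(u)$. When $u=1$ write $A_p^\rho$. For $\sigma\geq0$ and locally integrable $g$, $$M^{\rho,\sigma}g(x)=\sup_{Q=Q(x_0,r_0)\ni x}\left(1+\frac{r_0}{\rho(x_0)}\right)^{-\sigma}\frac{1}{|Q|}\int_Q|g(y)|\,dy.$$ *)

theory Defs
  imports "HOL-Analysis.Analysis"
begin

text \<open>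
  The space \<open>\<real>\<^sup>d\<close> is an arbitrary \<open>'a :: euclidean_space\<close> with \<open>d = DIM('a)\<close>; the coordinate
  axes are those of \<open>Basis\<close>. Weights are real-valued functions, and all integrals are
  nonnegative Lebesgue integrals with values in \<open>[0, \<infinity>]\<close>, so that an integral that
  diverges has the value \<open>\<infinity>\<close>. A weight may be nonpositive on a null set, which \<open>ennreal\<close>
  truncates to \<open>0\<close> without effect on any integral.
\<close>

definition critical_radius :: "('a::euclidean_space \<Rightarrow> real) \<Rightarrow> bool" where
  "critical_radius \<rho> \<longleftrightarrow>
     (\<forall>x. \<rho> x > 0) \<and>
     (\<exists>C0 N0 :: real. C0 \<ge> 1 \<and> N0 \<ge> 1 \<and>
       (\<forall>x y. inverse C0 * \<rho> x * (1 + norm (x - y) / \<rho> x) powr (- N0) \<le> \<rho> y \<and>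
              \<rho> y \<le> C0 * \<rho> x * (1 + norm (x - y) / \<rho> x) powr (N0 / (N0 + 1))))"

text \<open>The radius \<open>r\<close> of a cube is half its diameter, so half the side length is \<open>r / \<surd>d\<close>.\<close>

definition cube :: "'a::euclidean_space \<Rightarrow> real \<Rightarrow> 'a set" where
  "cube x r = cbox (x - (r / sqrt (real DIM('a))) *\<^sub>R One) (x + (r / sqrt (real DIM('a))) *\<^sub>R One)"

definition weight :: "('a::euclidean_space \<Rightarrow> real) \<Rightarrow> bool" where
  "weight w \<longleftrightarrow>
     w \<in> borel_measurable lebesgue \<and>
     (\<forall>K. compact K \<longrightarrow> set_integrable lebesgue K w) \<and>
     (AE x in lebesgue. 0 < w x)"

definition weight_of :: "('a::euclidean_space \<Rightarrow> real) \<Rightarrow> 'a set \<Rightarrow> ennreal" where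
  "weight_of w E = (\<integral>\<^sup>+x\<in>E. ennreal (w x) \<partial>lebesgue)"

text \<open>Used for exponents \<open>a > 0\<close> only.\<close>

definition ennreal_powr :: "ennreal \<Rightarrow> real \<Rightarrow> ennreal" where
  "ennreal_powr z a = (if z = \<infinity> then \<infinity> else ennreal (enn2real z powr a))"

definition ess_inf_on :: "'a::euclidean_space set \<Rightarrow> ('a \<Rightarrow> real) \<Rightarrow> ennreal" where
  "ess_inf_on E w = Sup {c. AE x in lebesgue. x \<in> E \<longrightarrow> c \<le> ennreal (w x)}"

definition A_one_theta :: "('a::euclidean_space \<Rightarrow> real) \<Rightarrow> real \<Rightarrow> ('a \<Rightarrow> real) \<Rightarrow> ('a \<Rightarrow> real) set" where
  "A_one_theta \<rho> \<theta> u = {w. weight w \<and> (\<exists>C>0. \<forall>x. \<forall>r>0.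
     weight_of (\<lambda>y. w y * u y) (cube x r) / weight_of u (cube x r)
       \<le> ennreal (C * (1 + r / \<rho> x) powr \<theta>) * ess_inf_on (cube x r) w)}"

definition A_p_theta :: "real \<Rightarrow> ('a::euclidean_space \<Rightarrow> real) \<Rightarrow> real \<Rightarrow> ('a \<Rightarrow> real) \<Rightarrow> ('a \<Rightarrow> real) set" where
  "A_p_theta p \<rho> \<theta> u = {w. weight w \<and> (let p' = p / (p - 1) in \<exists>C>0. \<forall>x. \<forall>r>0.
     ennreal_powr (weight_of (\<lambda>y. w y * u y) (cube x r) / weight_of u (cube x r)) (1 / p) *
     ennreal_powr (weight_of (\<lambda>y. w y powr (1 - p') * u y) (cube x r) / weight_of u (cube x r)) (1 / p')
       \<le> ennreal (C * (1 + r / \<rho> x) powr \<theta>))}"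

definition A_p :: "real \<Rightarrow> ('a::euclidean_space \<Rightarrow> real) \<Rightarrow> ('a \<Rightarrow> real) \<Rightarrow> ('a \<Rightarrow> real) set" where
  "A_p p \<rho> u = (\<Union>\<theta>\<in>{0..}. if p = 1 then A_one_theta \<rho> \<theta> u else A_p_theta p \<rho> \<theta> u)"

definition A_infinity :: "('a::euclidean_space \<Rightarrow> real) \<Rightarrow> ('a \<Rightarrow> real) \<Rightarrow> ('a \<Rightarrow> real) set" where
  "A_infinity \<rho> u = (\<Union>p\<in>{1..}. A_p p \<rho> u)"

definition maximal :: "('a::euclidean_space \<Rightarrow> real) \<Rightarrow> real \<Rightarrow> ('a \<Rightarrow> real) \<Rightarrow> 'a \<Rightarrow> ennreal" where
  "maximal \<rho> \<sigma> g x =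
     (SUP (x0, r0) \<in> {(x0, r0). r0 > 0 \<and> x \<in> cube x0 r0}.
        ennreal ((1 + r0 / \<rho> x0) powr (- \<sigma>)) *
        ((\<integral>\<^sup>+y\<in>cube x0 r0. ennreal \<bar>g y\<bar> \<partial>lebesgue) / emeasure lebesgue (cube x0 r0)))"

end

theory Submission
  imports Defs
begin

text \<open>
  Write \<open>g = |f| v / t\<close>, so that the claim reads
  \<open>uv {x. M g x > v x} \<le> C \<integral> g u\<close> with the damped maximal operator \<open>M\<close> whose exponent
  \<open>\<sigma>\<close> is still to be chosen. Fix \<open>x\<close> in the set and a cube \<open>Q \<ni> x\<close> with centre \<open>x0\<close> and radius
  \<open>r\<close> that witnesses \<open>M g x > v x\<close>. The argument splits according to whether \<open>r\<close> is at least
  \<open>\<rho> x0\<close> or smaller.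

  Large cubes. If \<open>\<sigma>\<close> is large, the damped average over \<open>Q\<close> is at most a multiple of the potential
  \<open>T g x = \<integral> \<rho>(y)\<^sup>-\<^sup>d (1 + |x - y| / \<rho>(y))\<^sup>-\<^sup>s g(y) dy\<close> (\<open>large_cube_le_pot\<close>); a comparable
  measurable function takes the place of \<open>\<rho>\<close> in the kernel. On the set where \<open>v \<le> B T g\<close> the measure \<open>uv\<close> is at most \<open>B \<integral> (T g) u\<close>, and
  by Fubini it is enough that the adjoint kernel maps \<open>u\<close> below a multiple of \<open>u\<close>. That is the
  \<open>A_1\<close> condition summed over the dyadic dilates of a cube about \<open>y\<close>, as soon as \<open>s\<close>
  exceeds \<open>d + \<theta>\<close> (\<open>kern_adjoint_bound\<close>, \<open>pot_weighted_bound\<close>).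

  Small cubes. Up to a dimensional constant \<open>Q\<close> may be replaced by a dyadic cell \<open>P\<close> next to \<open>x\<close> of
  comparable size. Let \<open>a = 2\<^sup>d\<^sup>+\<^sup>1\<close> and choose \<open>k\<close> with \<open>v x\<close> comparable to \<open>a\<^sup>k\<close> and the average of
  \<open>g\<close> over \<open>P\<close> above \<open>a\<^sup>k\<close>. Call a cell local if its radius is at most the value of \<open>\<rho>\<close> at its
  centre, and enlarge \<open>P\<close> to a maximal local cell \<open>R\<close> on which the average exceeds \<open>a\<^sup>k\<close>. If the
  parent of \<open>R\<close> is not local (or if \<open>P\<close> itself is not), the cell has size about \<open>\<rho>\<close> and the potential
  above controls \<open>v x\<close> again. Otherwise \<open>R\<close> is a stopping cell: its average lies between \<open>a\<^sup>k\<close> and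
  \<open>2\<^sup>d a\<^sup>k\<close>, and at least half of \<open>R\<close> is not covered by the local cells with averages above \<open>a\<^sup>k\<^sup>+\<^sup>1\<close>.
  These remaining halves are pairwise disjoint over all stopping cells of all generations.

  On local cells all weight constants are uniform, so there the classical theory applies. Let \<open>R*\<close>
  be the fivefold dilate of \<open>R\<close>, which contains \<open>x\<close>, and \<open>m(R)\<close> the mean of \<open>v\<close> over \<open>R*\<close> with
  respect to \<open>u\<close>. Sort the stopping cells into bands \<open>m(R) \<approx> a\<^sup>k\<^sup>+\<^sup>l\<close>, where the band \<open>l = 0\<close> also
  takes all cells with smaller means. Two estimates hold in a band. First, \<open>A_\<infinity>\<close> gives
  \<open>uv (R* \<inter> {v \<lesssim> a\<^sup>k}) \<lesssim> a\<^sup>-\<^sup>l\<^sup>(\<^sup>1\<^sup>+\<^sup>\<epsilon>\<^sup>) uv (R*)\<close> (\<open>nu_level_le\<close>); the exponent exceeds \<open>l\<close>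
  because the bound for \<open>v\<close> and the smallness of the set both contribute. Second, since
  \<open>uv (R*)\<close> is controlled by the \<open>uv\<close>-measure of the disjoint half of \<open>R\<close>, the sum of \<open>uv (R*)\<close> over the
  band is controlled by the union of its cells, hence by its maximal cells; on these
  \<open>uv (R*) \<lesssim> a\<^sup>l a\<^sup>k u (R*) \<lesssim> a\<^sup>l \<integral>\<^sub>R g u\<close> by the stopping rule and \<open>A_1\<close>, and the maximal cells are
  disjoint, so the sum is at most \<open>C a\<^sup>l \<integral> g u\<close> (\<open>packing\<close>). The product \<open>a\<^sup>-\<^sup>l\<^sup>\<epsilon> \<integral> g u\<close> is summable over
  \<open>l\<close> (\<open>local_estimate\<close>).
\<close>

section \<open>Cubes\<close>

lemma mem_cube:
  fixes x y :: "'a::euclidean_space"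
  shows "y \<in> cube x r \<longleftrightarrow> (\<forall>b\<in>Basis. \<bar>y \<bullet> b - x \<bullet> b\<bar> \<le> r / sqrt (real DIM('a)))"
proof -
  have "(x \<bullet> b - e \<le> y \<bullet> b \<and> y \<bullet> b \<le> x \<bullet> b + e) \<longleftrightarrow> \<bar>y \<bullet> b - x \<bullet> b\<bar> \<le> e" for b e
    by linarith
  then show ?thesis
    unfolding cube_def mem_box
    by (simp add: inner_diff_left inner_add_left)
qed

lemma cube_mono:
  assumes "r \<le> s"
  shows "cube x r \<subseteq> cube (x::'a::euclidean_space) s"
proof
  fix y assume "y \<in> cube x r"
  moreover from assms have "r / sqrt (real DIM('a)) \<le> s / sqrt (real DIM('a))"
    by (intro divide_right_mono) auto
  ultimately show "y \<in> cube x s" unfolding mem_cube by force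
qed

lemma cube_measurable [measurable]: "cube x r \<in> sets lebesgue"
  unfolding cube_def by simp

lemma sublevel_measurable:
  fixes v :: "'a::euclidean_space \<Rightarrow> real"
  assumes "v \<in> borel_measurable lebesgue" "A \<in> sets lebesgue"
  shows "{y \<in> A. v y \<le> t} \<in> sets lebesgue"
proof -
  have "v -` {..t} \<inter> space lebesgue \<in> sets lebesgue"
    using assms(1) by (rule measurable_sets) simp
  moreover have "{y \<in> A. v y \<le> t} = A \<inter> (v -` {..t} \<inter> space lebesgue)" by auto
  ultimately show ?thesis using assms(2) by (simp only: sets.Int)
qed

lemma cball_subset_cube: "cball (x::'a::euclidean_space) (r / sqrt (real DIM('a))) \<subseteq> cube x r"
proof
  fix y assume y: "y \<in> cball x (r / sqrt (real DIM('a)))"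
  have "\<bar>y \<bullet> b - x \<bullet> b\<bar> \<le> r / sqrt (real DIM('a))" if "b \<in> Basis" for b
  proof -
    have "\<bar>(y - x) \<bullet> b\<bar> \<le> norm (y - x)" by (rule Basis_le_norm[OF that])
    then show ?thesis using y by (simp add: inner_diff_left dist_norm norm_minus_commute)
  qed
  then show "y \<in> cube x r" by (simp add: mem_cube)
qed

lemma norm_le_of_mem_cube:
  fixes x y :: "'a::euclidean_space"
  assumes "y \<in> cube x r" "0 \<le> r"
  shows "norm (x - y) \<le> r"
proof -
  let ?d = "real DIM('a)"
  have b: "((x - y) \<bullet> b)^2 \<le> r^2 / ?d" if "b \<in> Basis" for b
  proof -
    have "\<bar>(x - y) \<bullet> b\<bar> \<le> r / sqrt ?d"
      using assms(1) that unfolding mem_cube by (auto simp: inner_diff_left abs_minus_commute)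
    then have "\<bar>(x - y) \<bullet> b\<bar>^2 \<le> (r / sqrt ?d)^2" by (intro power_mono) auto
    then show ?thesis by (simp add: power_divide)
  qed
  have "(norm (x - y))^2 = (\<Sum>b\<in>Basis. ((x - y) \<bullet> b)^2)"
    unfolding power2_norm_eq_inner by (subst euclidean_inner) (simp add: power2_eq_square)
  also have "\<dots> \<le> (\<Sum>b\<in>(Basis::'a set). r^2 / ?d)" by (intro sum_mono b)
  also have "\<dots> = r^2" by simp
  finally show ?thesis using assms(2) by (rule power2_le_imp_le)
qed

lemma emeasure_cube:
  fixes x :: "'a::euclidean_space"
  assumes "0 \<le> r"
  shows "emeasure lebesgue (cube x r) = ennreal ((2 * r / sqrt (real DIM('a))) ^ DIM('a))"
proof -
  let ?e = "r / sqrt (real DIM('a))"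
  have e: "0 \<le> ?e" using assms by simp
  have "emeasure lebesgue (cube x r) = emeasure lborel (cube x r)"
    by (simp add: cube_def)
  also have "\<dots> = ennreal (\<Prod>b\<in>Basis. ((x + ?e *\<^sub>R One) - (x - ?e *\<^sub>R One)) \<bullet> b)"
    unfolding cube_def using e by (intro emeasure_lborel_cbox) (auto simp: inner_diff_left inner_add_left)
  also have "(\<Prod>b\<in>Basis. ((x + ?e *\<^sub>R One) - (x - ?e *\<^sub>R One)) \<bullet> b) = (\<Prod>b\<in>(Basis::'a set). 2 * r / sqrt (real DIM('a)))"
    by (intro prod.cong) (auto simp: inner_diff_left inner_add_left)
  finally show ?thesis by simp
qed

section \<open>Dyadic cells\<close>

text \<open>
  The cells of level \<open>n\<close> are the classes of the relation ``the coordinates have the same integer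
  parts in units of \<open>2\<^sup>n\<close>''; higher levels are coarser. A cell is named by the pair of its level and
  its centre, and the set \<open>cells\<close> of these canonical names is countable, whereas \<open>cell n x\<close> makes
  sense for an arbitrary point \<open>x\<close> of the cell.
\<close>

definition centre :: "int \<Rightarrow> 'a::euclidean_space \<Rightarrow> 'a" where
  "centre n x = (\<Sum>b\<in>Basis. ((of_int \<lfloor>(x \<bullet> b) / 2 powi n\<rfloor> + 1/2) * 2 powi n) *\<^sub>R b)"

definition cell :: "int \<Rightarrow> 'a::euclidean_space \<Rightarrow> 'a set" where
  "cell n x = {y. \<forall>b\<in>Basis. \<lfloor>(y \<bullet> b) / 2 powi n\<rfloor> = \<lfloor>(x \<bullet> b) / 2 powi n\<rfloor>}"

definition cells :: "(int \<times> 'a::euclidean_space) set" where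
  "cells = {(n, c). centre n c = c}"

definition rad :: "'a::euclidean_space itself \<Rightarrow> int \<Rightarrow> real" where
  "rad _ n = sqrt (real DIM('a)) * 2 powi n / 2"

lemma rad_pos [simp]: "0 < rad TYPE('a::euclidean_space) n"
  by (simp add: rad_def)

lemma rad_nonneg [simp]: "0 \<le> rad TYPE('a::euclidean_space) n"
  by (simp add: rad_def)

lemma rad_div: "t * rad TYPE('a::euclidean_space) n / sqrt (real DIM('a)) = t * 2 powi n / 2"
  by (simp add: rad_def)

lemma powi_Suc2: "(2::real) powi (n + 1) = 2 * 2 powi n"
  by (simp add: power_int_add)

lemma rad_Suc: "rad TYPE('a::euclidean_space) (n + 1) = 2 * rad TYPE('a) n"
  by (simp add: rad_def powi_Suc2)

lemma centre_inner: "b \<in> Basis \<Longrightarrow> centre n x \<bullet> b = (of_int \<lfloor>(x \<bullet> b) / 2 powi n\<rfloor> + 1/2) * 2 powi n"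
  unfolding centre_def by simp

lemma floor_centre: "b \<in> Basis \<Longrightarrow> \<lfloor>(centre n x \<bullet> b) / 2 powi n\<rfloor> = \<lfloor>(x \<bullet> b) / 2 powi n\<rfloor>"
proof -
  assume "b \<in> Basis"
  then have "(centre n x \<bullet> b) / 2 powi n = of_int \<lfloor>(x \<bullet> b) / 2 powi n\<rfloor> + 1/2"
    by (simp add: centre_inner)
  then show ?thesis by linarith
qed

lemma cell_centre [simp]: "cell n (centre n x) = cell n x"
  unfolding cell_def by (auto simp: floor_centre)

lemma centre_eqI: "(\<And>b. b \<in> Basis \<Longrightarrow> \<lfloor>(x \<bullet> b) / 2 powi n\<rfloor> = \<lfloor>(y \<bullet> b) / 2 powi n\<rfloor>) \<Longrightarrow> centre n x = centre n y"
  unfolding centre_def by (intro sum.cong) auto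

lemma centre_centre [simp]: "centre n (centre n x) = centre n x"
  by (intro centre_eqI floor_centre)

lemma centre_in_cells [simp]: "(n, centre n x) \<in> cells"
  by (simp add: cells_def)

lemma cellsD: "(n, c) \<in> cells \<Longrightarrow> centre n c = c"
  by (simp add: cells_def)

lemma self_in_cell [simp]: "x \<in> cell n x"
  by (simp add: cell_def)

lemma cell_eq: "y \<in> cell n x \<Longrightarrow> cell n y = cell n x"
  unfolding cell_def by auto

lemma centre_eq_of_mem: "y \<in> cell n x \<Longrightarrow> centre n y = centre n x"
  by (intro centre_eqI) (auto simp: cell_def)

text \<open>
  Nestedness of the dyadic grid in one coordinate: the integer part at a coarser scale is the
  integer quotient of the finer one by a power of two.
\<close>

lemma floor_coarser:
  fixes s t :: real
  assumes "\<lfloor>s / 2 powi n\<rfloor> = \<lfloor>t / 2 powi n\<rfloor>" "n \<le> m"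
  shows "\<lfloor>s / 2 powi m\<rfloor> = \<lfloor>t / 2 powi m\<rfloor>"
proof -
  define j where "j = nat (m - n)"
  have j: "m = n + int j" using assms(2) by (simp add: j_def)
  have p: "(2::real) powi m = 2 powi n * of_nat (2 ^ j)" by (simp add: j power_int_add)
  have "\<lfloor>s / 2 powi m\<rfloor> = \<lfloor>s / 2 powi n\<rfloor> div (2 ^ j)" for s :: real
    using floor_divide_real_eq_div[of "2^j" "s / 2 powi n"] unfolding p by (simp add: field_simps)
  then show ?thesis using assms(1) by simp
qed

lemma cell_mono: "n \<le> m \<Longrightarrow> cell n x \<subseteq> cell m x"
  unfolding cell_def using floor_coarser[of _ n _ m] by blast

lemma cell_nested:
  assumes "z \<in> cell n x" "z \<in> cell m y" "n \<le> m"
  shows "cell n x \<subseteq> cell m y"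
  using cell_eq[OF assms(1)] cell_eq[OF assms(2)] cell_mono[OF assms(3), of z] by simp

lemma mem_cell_iff:
  assumes "(n, c) \<in> cells"
  shows "y \<in> cell n c \<longleftrightarrow> (\<forall>b\<in>Basis. c \<bullet> b - 2 powi n / 2 \<le> y \<bullet> b \<and> y \<bullet> b < c \<bullet> b + 2 powi n / 2)"
proof -
  have "(\<lfloor>(y \<bullet> b) / 2 powi n\<rfloor> = \<lfloor>(c \<bullet> b) / 2 powi n\<rfloor>) \<longleftrightarrow>
    c \<bullet> b - 2 powi n / 2 \<le> y \<bullet> b \<and> y \<bullet> b < c \<bullet> b + 2 powi n / 2" if "b \<in> Basis" for b
  proof -
    have c: "c \<bullet> b = (of_int \<lfloor>(c \<bullet> b) / 2 powi n\<rfloor> + 1/2) * 2 powi n"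
      using centre_inner[OF that, of n c] cellsD[OF assms] by simp
    define j where "j = \<lfloor>(c \<bullet> b) / 2 powi n\<rfloor>"
    define e where "e = (2::real) powi n"
    have e: "e > 0" by (simp add: e_def)
    have "\<lfloor>(y \<bullet> b) / e\<rfloor> = j \<longleftrightarrow> of_int j \<le> (y \<bullet> b) / e \<and> (y \<bullet> b) / e < of_int j + 1"
      by linarith
    also have "\<dots> \<longleftrightarrow> of_int j * e \<le> y \<bullet> b \<and> y \<bullet> b < (of_int j + 1) * e"
      using e by (simp add: pos_le_divide_eq pos_divide_less_eq)
    finally have 1: "\<lfloor>(y \<bullet> b) / e\<rfloor> = j \<longleftrightarrow> of_int j * e \<le> y \<bullet> b \<and> y \<bullet> b < (of_int j + 1) * e" .
    have 2: "of_int j * e = c \<bullet> b - e / 2" "(of_int j + 1) * e = c \<bullet> b + e / 2"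
      using c by (simp_all add: j_def e_def algebra_simps)
    show ?thesis using 1 unfolding 2 unfolding j_def e_def .
  qed
  then show ?thesis unfolding cell_def by auto
qed

lemma cell_subset_cube:
  assumes "(n, c) \<in> cells"
  shows "cell n c \<subseteq> cube (c::'a::euclidean_space) (rad TYPE('a) n)"
proof
  fix y assume "y \<in> cell n c"
  then have *: "c \<bullet> b - 2 powi n / 2 \<le> y \<bullet> b \<and> y \<bullet> b < c \<bullet> b + 2 powi n / 2" if "b \<in> Basis" for b
    using that unfolding mem_cell_iff[OF assms] by blast
  have "\<bar>y \<bullet> b - c \<bullet> b\<bar> \<le> 1 * rad TYPE('a) n / sqrt (real DIM('a))" if "b \<in> Basis" for b
    unfolding rad_div using *[OF that] by linarith
  then show "y \<in> cube c (rad TYPE('a) n)" by (simp add: mem_cube)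
qed

lemma box_subset_cell:
  assumes "(n, c) \<in> cells"
  shows "box (c - (2 powi n / 2) *\<^sub>R One) (c + (2 powi n / 2) *\<^sub>R One) \<subseteq> cell n (c::'a::euclidean_space)"
  unfolding subset_eq mem_cell_iff[OF assms]
  by (auto simp: mem_box inner_diff_left inner_add_left intro: less_imp_le)

lemma cell_borel: "cell n (x::'a::euclidean_space) \<in> sets borel"
proof -
  have "cell n x = (\<Inter>b\<in>Basis. {y. \<lfloor>(y \<bullet> b) / 2 powi n\<rfloor> = \<lfloor>(x \<bullet> b) / 2 powi n\<rfloor>})"
    unfolding cell_def by auto
  also have "\<dots> \<in> sets borel" by (intro sets.finite_INT) auto
  finally show ?thesis .
qed

lemma cell_measurable [measurable]: "cell n (x::'a::euclidean_space) \<in> sets lebesgue"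
  using cell_borel by (metis sets_completionI_sets sets_lborel)

lemma emeasure_cell:
  fixes c :: "'a::euclidean_space"
  shows "emeasure lebesgue (cell n c) = ennreal ((2 powi n) ^ DIM('a))"
proof -
  let ?c = "centre n c" and ?e = "(2::real) powi n / 2"
  have c: "(n, ?c) \<in> cells" by simp
  have 1: "emeasure lebesgue (box (?c - ?e *\<^sub>R One) (?c + ?e *\<^sub>R One)) \<le> emeasure lebesgue (cell n ?c)"
    using box_subset_cell[OF c] by (intro emeasure_mono) auto
  have 2: "emeasure lebesgue (cell n ?c) \<le> emeasure lebesgue (cube ?c (rad TYPE('a) n))"
    using cell_subset_cube[OF c] by (intro emeasure_mono) auto
  have "emeasure lebesgue (box (?c - ?e *\<^sub>R One) (?c + ?e *\<^sub>R One)) =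
     emeasure lborel (box (?c - ?e *\<^sub>R One) (?c + ?e *\<^sub>R One))" by simp
  also have "\<dots> = ennreal (\<Prod>b\<in>Basis. ((?c + ?e *\<^sub>R One) - (?c - ?e *\<^sub>R One)) \<bullet> b)"
    by (intro emeasure_lborel_box) (auto simp: inner_diff_left inner_add_left)
  also have "(\<Prod>b\<in>Basis. ((?c + ?e *\<^sub>R One) - (?c - ?e *\<^sub>R One)) \<bullet> b) = (\<Prod>b\<in>(Basis::'a set). 2 powi n)"
    by (intro prod.cong) (auto simp: inner_diff_left inner_add_left)
  finally have 3: "emeasure lebesgue (box (?c - ?e *\<^sub>R One) (?c + ?e *\<^sub>R One)) = ennreal ((2 powi n) ^ DIM('a))"
    by simp
  have "2 * rad TYPE('a) n / sqrt (real DIM('a)) = 2 powi n" by (simp add: rad_div)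
  then have 4: "emeasure lebesgue (cube ?c (rad TYPE('a) n)) = ennreal ((2 powi n) ^ DIM('a))"
    using emeasure_cube[of "rad TYPE('a) n" ?c] by (simp add: less_imp_le)
  show ?thesis using 1 2 unfolding 3 4 by simp
qed

lemma countable_cells: "countable (cells :: (int \<times> 'a::euclidean_space) set)"
proof -
  let ?F = "Basis \<rightarrow>\<^sub>E (UNIV::int set) :: ('a \<Rightarrow> int) set"
  let ?h = "\<lambda>(n::int, z). (n, (\<Sum>b\<in>Basis. ((of_int (z b) + 1/2) * 2 powi n) *\<^sub>R b) :: 'a)"
  have "countable ?F" by (intro countable_PiE) auto
  then have "countable (?h ` (UNIV \<times> ?F))" by auto
  moreover have "cells \<subseteq> ?h ` (UNIV \<times> ?F)"
  proof
    fix p :: "int \<times> 'a" assume "p \<in> cells"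
    then obtain n c where p: "p = (n, c)" "centre n c = c" by (auto simp: cells_def)
    have "p = ?h (n, restrict (\<lambda>b. \<lfloor>(c \<bullet> b) / 2 powi n\<rfloor>) Basis)"
      using p by (simp add: centre_def)
    then show "p \<in> ?h ` (UNIV \<times> ?F)" by (intro image_eqI[where x="(n, restrict (\<lambda>b. \<lfloor>(c \<bullet> b) / 2 powi n\<rfloor>) Basis)"]) auto
  qed
  ultimately show ?thesis by (rule countable_subset[rotated])
qed

lemma floor_diff_le_1:
  fixes s t :: real
  assumes "\<bar>s - t\<bar> \<le> 1"
  shows "\<lfloor>s\<rfloor> - \<lfloor>t\<rfloor> \<in> {-1, 0, 1}"
proof -
  have "\<lfloor>s\<rfloor> - \<lfloor>t\<rfloor> \<le> 1" "\<lfloor>s\<rfloor> - \<lfloor>t\<rfloor> \<ge> -1" using assms by linarith+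
  then have "\<lfloor>s\<rfloor> - \<lfloor>t\<rfloor> = -1 \<or> \<lfloor>s\<rfloor> - \<lfloor>t\<rfloor> = 0 \<or> \<lfloor>s\<rfloor> - \<lfloor>t\<rfloor> = 1" by linarith
  then show ?thesis by blast
qed

text \<open>
  A cube of side at most \<open>2\<^sup>n\<close> through \<open>x\<close> lies in the union of the \<open>3\<^sup>d\<close> cells of level \<open>n\<close> around the
  one of \<open>x\<close>, so one of them carries a fixed share of the integral. This replaces averages over
  arbitrary cubes by averages over a single dyadic grid, at the price that \<open>x\<close> only belongs to a
  dilate of the cell.
\<close>

lemma neighbour_cell:
  fixes G :: "'a::euclidean_space \<Rightarrow> ennreal"
  assumes G: "G \<in> borel_measurable lebesgue"
    and x: "x \<in> cube x0 r0" and n: "2 * r0 / sqrt (real DIM('a)) \<le> 2 powi n"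
  obtains c where "(n, c) \<in> cells"
    "(\<integral>\<^sup>+y\<in>cube x0 r0. G y \<partial>lebesgue) \<le> 3 ^ DIM('a) * (\<integral>\<^sup>+y\<in>cell n c. G y \<partial>lebesgue)"
    "\<And>y b. y \<in> cell n c \<Longrightarrow> b \<in> Basis \<Longrightarrow> \<bar>x \<bullet> b - y \<bullet> b\<bar> \<le> 2 * 2 powi n"
proof -
  define F where "F = ((Basis::'a set) \<rightarrow>\<^sub>E {-1, 0, 1::int})"
  define P where "P e = cell n (x + (\<Sum>b\<in>Basis. (of_int (e b) * 2 powi n) *\<^sub>R b))" for e :: "'a \<Rightarrow> int"
  have fin: "finite F" unfolding F_def by (intro finite_PiE) auto
  have card: "card F = 3 ^ DIM('a)" unfolding F_def by (subst card_PiE) (auto simp: eval_nat_numeral)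
  have P: "P e = {y. \<forall>b\<in>Basis. \<lfloor>(y \<bullet> b) / 2 powi n\<rfloor> = \<lfloor>(x \<bullet> b) / 2 powi n\<rfloor> + e b}" for e
  proof -
    have "\<lfloor>((x + (\<Sum>b\<in>Basis. (of_int (e b) * 2 powi n) *\<^sub>R b)) \<bullet> b) / 2 powi n\<rfloor> = \<lfloor>(x \<bullet> b) / 2 powi n\<rfloor> + e b"
      if "b \<in> Basis" for b
    proof -
      have "((x + (\<Sum>b\<in>Basis. (of_int (e b) * 2 powi n) *\<^sub>R b)) \<bullet> b) / 2 powi n = (x \<bullet> b) / 2 powi n + of_int (e b)"
        using that by (simp add: inner_add_left add_divide_distrib)
      then show ?thesis by simp
    qed
    then show ?thesis unfolding P_def cell_def by auto
  qed
  have Pm: "P e \<in> sets lebesgue" for e unfolding P_def by simp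
  let ?J = "\<lambda>e. \<integral>\<^sup>+y\<in>P e. G y \<partial>lebesgue"
  have cov: "\<exists>e\<in>F. y \<in> P e" if y: "y \<in> cube x0 r0" for y
  proof
    define e where "e = restrict (\<lambda>b. \<lfloor>(y \<bullet> b) / 2 powi n\<rfloor> - \<lfloor>(x \<bullet> b) / 2 powi n\<rfloor>) Basis"
    show "y \<in> P e" unfolding P e_def by auto
    have "\<lfloor>(y \<bullet> b) / 2 powi n\<rfloor> - \<lfloor>(x \<bullet> b) / 2 powi n\<rfloor> \<in> {-1, 0, 1}" if b: "b \<in> Basis" for b
    proof (rule floor_diff_le_1)
      have "\<bar>y \<bullet> b - x0 \<bullet> b\<bar> \<le> r0 / sqrt (real DIM('a))" "\<bar>x \<bullet> b - x0 \<bullet> b\<bar> \<le> r0 / sqrt (real DIM('a))"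
        using x y b by (auto simp: mem_cube)
      then have "\<bar>y \<bullet> b - x \<bullet> b\<bar> \<le> 2 powi n" using n by linarith
      then show "\<bar>(y \<bullet> b) / 2 powi n - (x \<bullet> b) / 2 powi n\<bar> \<le> 1"
        by (simp add: diff_divide_distrib[symmetric])
    qed
    then show "e \<in> F" unfolding F_def e_def by (auto simp: PiE_def Pi_def)
  qed
  have ne: "F \<noteq> {}" using cov[OF x] by auto
  have "Max (?J ` F) \<in> ?J ` F" using fin ne by (intro Max_in) auto
  then obtain e where eM: "Max (?J ` F) = ?J e" and e: "e \<in> F" by (rule imageE)
  have "(\<integral>\<^sup>+y\<in>cube x0 r0. G y \<partial>lebesgue) \<le> (\<integral>\<^sup>+y. (\<Sum>e\<in>F. G y * indicator (P e) y) \<partial>lebesgue)"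
  proof (intro nn_integral_mono)
    fix y
    show "G y * indicator (cube x0 r0) y \<le> (\<Sum>e\<in>F. G y * indicator (P e) y)"
    proof (cases "y \<in> cube x0 r0")
      case True
      then obtain e' where e': "e' \<in> F" "y \<in> P e'" using cov by blast
      have "G y * indicator (P e') y \<le> (\<Sum>e\<in>F. G y * indicator (P e) y)"
        by (rule member_le_sum) (use e' fin in auto)
      then show ?thesis using True e' by simp
    qed simp
  qed
  also have "\<dots> = (\<Sum>e\<in>F. ?J e)"
    using G Pm by (intro nn_integral_sum) auto
  also have "\<dots> \<le> (\<Sum>e'\<in>F. ?J e)" unfolding eM[symmetric] using fin by (intro sum_mono Max_ge) auto
  also have "\<dots> = 3 ^ DIM('a) * ?J e" by (simp add: card)
  finally have le: "(\<integral>\<^sup>+y\<in>cube x0 r0. G y \<partial>lebesgue) \<le> 3 ^ DIM('a) * ?J e" .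
  define c where "c = centre n (x + (\<Sum>b\<in>Basis. (of_int (e b) * 2 powi n) *\<^sub>R b))"
  have cP: "cell n c = P e" by (simp add: c_def P_def)
  show ?thesis
  proof
    show "(n, c) \<in> cells" by (simp add: c_def)
    show "(\<integral>\<^sup>+y\<in>cube x0 r0. G y \<partial>lebesgue) \<le> 3 ^ DIM('a) * (\<integral>\<^sup>+y\<in>cell n c. G y \<partial>lebesgue)"
      using le by (simp add: cP)
    fix y b assume y: "y \<in> cell n c" and b: "b \<in> (Basis::'a set)"
    have "e b \<in> {-1,0,1}" using e b by (auto simp: F_def PiE_def Pi_def)
    then have "\<bar>e b\<bar> \<le> 1" by auto
    moreover have "\<lfloor>(y \<bullet> b) / 2 powi n\<rfloor> = \<lfloor>(x \<bullet> b) / 2 powi n\<rfloor> + e b" using y b unfolding cP P by auto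
    ultimately have "\<bar>(x \<bullet> b) / 2 powi n - (y \<bullet> b) / 2 powi n\<bar> \<le> 2" by linarith
    then have "\<bar>(x \<bullet> b - y \<bullet> b) / 2 powi n\<bar> \<le> 2" by (simp add: diff_divide_distrib)
    then show "\<bar>x \<bullet> b - y \<bullet> b\<bar> \<le> 2 * 2 powi n" by (simp add: pos_divide_le_eq abs_divide)
  qed
qed

lemma mem_cube5:
  fixes x :: "'a::euclidean_space"
  assumes c: "(n, c) \<in> cells" and y: "y \<in> cell n c"
    and xy: "\<And>b. b \<in> Basis \<Longrightarrow> \<bar>x \<bullet> b - y \<bullet> b\<bar> \<le> 2 * 2 powi n"
  shows "x \<in> cube c (5 * rad TYPE('a) n)"
  unfolding mem_cube rad_div
proof
  fix b :: 'a assume b: "b \<in> Basis"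
  have "c \<bullet> b - 2 powi n / 2 \<le> y \<bullet> b \<and> y \<bullet> b < c \<bullet> b + 2 powi n / 2"
    using y b unfolding mem_cell_iff[OF c] by blast
  then show "\<bar>x \<bullet> b - c \<bullet> b\<bar> \<le> 5 * 2 powi n / 2" using xy[OF b] by linarith
qed

abbreviation cell_of :: "int \<times> 'a::euclidean_space \<Rightarrow> 'a set" where
  "cell_of p \<equiv> cell (fst p) (snd p)"

definition tops :: "(int \<times> 'a::euclidean_space) set \<Rightarrow> (int \<times> 'a) set" where
  "tops F = {p \<in> F. \<forall>q\<in>F. cell_of p \<subseteq> cell_of q \<longrightarrow> fst q \<le> fst p}"

lemma tops_subset: "tops F \<subseteq> F" by (auto simp: tops_def)

lemma cells_disjoint_or_nested:
  assumes "p \<in> cells" "q \<in> cells" "cell_of p \<inter> cell_of q \<noteq> {}" "fst p \<le> fst q"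
  shows "cell_of p \<subseteq> cell_of q"
  using assms cell_nested by blast

lemma cells_eqI:
  assumes "p \<in> cells" "q \<in> cells" "cell_of p \<inter> cell_of q \<noteq> {}" "fst p = fst q"
  shows "p = q"
proof -
  obtain z where "z \<in> cell_of p" "z \<in> cell_of q" using assms(3) by blast
  then have "centre (fst p) (snd p) = centre (fst q) (snd q)"
    using centre_eq_of_mem assms(4) by metis
  then show ?thesis using assms cellsD by (metis prod.collapse)
qed

lemma tops_disjoint:
  assumes "F \<subseteq> cells"
  shows "disjoint_family_on cell_of (tops F)"
  unfolding disjoint_family_on_def
proof (intro ballI impI)
  fix p q assume pq: "p \<in> tops F" "q \<in> tops F" "p \<noteq> q"
  then have c: "p \<in> cells" "q \<in> cells" using assms by (auto simp: tops_def)
  show "cell_of p \<inter> cell_of q = {}"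
  proof (rule ccontr)
    assume i: "cell_of p \<inter> cell_of q \<noteq> {}"
    then have i': "cell_of q \<inter> cell_of p \<noteq> {}" by blast
    have "fst p = fst q"
      using cells_disjoint_or_nested[OF c i] cells_disjoint_or_nested[OF c(2,1) i'] pq
      unfolding tops_def by (smt (verit) mem_Collect_eq)
    then show False using cells_eqI[OF c i] pq by blast
  qed
qed

lemma exists_top:
  assumes F: "F \<subseteq> cells" and bdd: "\<And>q. q \<in> F \<Longrightarrow> x \<in> cell_of q \<Longrightarrow> fst q \<le> N"
    and p: "p \<in> F" "x \<in> cell_of p"
  obtains q where "q \<in> tops F" "cell_of p \<subseteq> cell_of q" "fst p \<le> fst q"
proof -
  define L where "L = fst ` {q \<in> F. cell_of p \<subseteq> cell_of q \<and> fst p \<le> fst q}"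
  have sub: "L \<subseteq> {fst p..N}" using bdd p unfolding L_def by auto
  then have fin: "finite L" by (rule finite_subset) simp
  have "fst p \<in> L" using p(1) unfolding L_def by blast
  then have ne: "L \<noteq> {}" by blast
  have "Max L \<in> L" using fin ne by simp
  then obtain q where q: "q \<in> F" "cell_of p \<subseteq> cell_of q" "fst p \<le> fst q" "fst q = Max L"
    by (auto simp: L_def)
  have "q \<in> tops F" unfolding tops_def
  proof (intro CollectI conjI ballI impI q(1))
    fix q' assume q': "q' \<in> F" "cell_of q \<subseteq> cell_of q'"
    show "fst q' \<le> fst q"
    proof (cases "fst p \<le> fst q'")
      case True
      then have "fst q' \<in> L" using q' q by (auto simp: L_def)
      then show ?thesis using fin q by simp
    next
      case False then show ?thesis using q by simp
    qed
  qed
  then show ?thesis using that q by blast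
qed

lemma UN_tops:
  assumes "F \<subseteq> cells" "\<And>x. \<exists>N. \<forall>q\<in>F. x \<in> cell_of q \<longrightarrow> fst q \<le> N"
  shows "(\<Union>p\<in>tops F. cell_of p) = (\<Union>p\<in>F. cell_of p)"
proof
  show "(\<Union>p\<in>tops F. cell_of p) \<subseteq> (\<Union>p\<in>F. cell_of p)" using tops_subset by blast
  show "(\<Union>p\<in>F. cell_of p) \<subseteq> (\<Union>p\<in>tops F. cell_of p)"
  proof
    fix x assume "x \<in> (\<Union>p\<in>F. cell_of p)"
    then obtain p where p: "p \<in> F" "x \<in> cell_of p" by blast
    obtain N where N: "\<And>q. q \<in> F \<Longrightarrow> x \<in> cell_of q \<Longrightarrow> fst q \<le> N" using assms(2) by blast
    obtain q where "q \<in> tops F" "cell_of p \<subseteq> cell_of q"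
      using exists_top[OF assms(1) N p] by blast
    then show "x \<in> (\<Union>p\<in>tops F. cell_of p)" using p by blast
  qed
qed

lemma emeasure_UN_le_nn_integral:
  assumes "countable I" "\<And>i. i \<in> I \<Longrightarrow> A i \<in> sets M"
  shows "emeasure M (\<Union>i\<in>I. A i) \<le> (\<integral>\<^sup>+i. emeasure M (A i) \<partial>count_space I)"
proof -
  have UN: "(\<Union>i\<in>I. A i) \<in> sets M" using assms by (intro sets.countable_UN') auto
  have "emeasure M (\<Union>i\<in>I. A i) = (\<integral>\<^sup>+x. indicator (\<Union>i\<in>I. A i) x \<partial>M)" using UN by simp
  also have "\<dots> \<le> (\<integral>\<^sup>+x. (\<integral>\<^sup>+i. indicator (A i) x \<partial>count_space I) \<partial>M)"
  proof (intro nn_integral_mono)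
    fix x
    show "indicator (\<Union>i\<in>I. A i) x \<le> (\<integral>\<^sup>+i. indicator (A i) x \<partial>count_space I :: ennreal)"
    proof (cases "x \<in> (\<Union>i\<in>I. A i)")
      case True
      then obtain i where i: "i \<in> I" "x \<in> A i" by blast
      show ?thesis using nn_integral_ge_point[OF i(1), of "\<lambda>i. indicator (A i) x"] i True by simp
    qed simp
  qed
  also have "\<dots> = (\<integral>\<^sup>+i. (\<integral>\<^sup>+x. indicator (A i) x \<partial>M) \<partial>count_space I)"
    using assms by (intro nn_integral_count_space_nn_integral) auto
  also have "\<dots> = (\<integral>\<^sup>+i. emeasure M (A i) \<partial>count_space I)"
    using assms by (intro nn_integral_cong) auto
  finally show ?thesis .
qed

lemma sum_nn_integral_disjoint_le:
  fixes A :: "'i \<Rightarrow> 'a::euclidean_space set"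
  assumes "countable I" "\<And>i. i \<in> I \<Longrightarrow> A i \<in> sets lebesgue" "disjoint_family_on A I"
    "f \<in> borel_measurable lebesgue"
    and B: "\<And>i. i \<in> I \<Longrightarrow> A i \<subseteq> B" "B \<in> sets lebesgue"
  shows "(\<integral>\<^sup>+i. (\<integral>\<^sup>+x\<in>A i. f x \<partial>lebesgue) \<partial>count_space I) \<le> (\<integral>\<^sup>+x\<in>B. f x \<partial>lebesgue)"
proof -
  have "(\<integral>\<^sup>+i. (\<integral>\<^sup>+x\<in>A i. f x \<partial>lebesgue) \<partial>count_space I) = (\<integral>\<^sup>+i. emeasure (density lebesgue f) (A i) \<partial>count_space I)"
    using assms by (intro nn_integral_cong) (simp add: emeasure_density)
  also have "\<dots> = emeasure (density lebesgue f) (\<Union>i\<in>I. A i)"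
    using assms by (intro emeasure_UN_countable[symmetric]) auto
  also have "\<dots> \<le> emeasure (density lebesgue f) B" using B by (intro emeasure_mono) auto
  finally show ?thesis using assms by (simp add: emeasure_density)
qed

section \<open>Averages over cells and local weights\<close>

definition vol :: "'a::euclidean_space itself \<Rightarrow> int \<Rightarrow> real" where
  "vol _ n = (2 powi n) ^ DIM('a)"

lemma vol_pos [simp]: "0 < vol TYPE('a::euclidean_space) n"
  by (simp add: vol_def)

lemma vol_nonneg [simp]: "0 \<le> vol TYPE('a::euclidean_space) n"
  by (simp add: vol_def)

lemma emeasure_cell_vol: "emeasure lebesgue (cell n (c::'a::euclidean_space)) = ennreal (vol TYPE('a) n)"
  by (simp add: emeasure_cell vol_def)

lemma vol_Suc: "vol TYPE('a::euclidean_space) (n + 1) = 2 ^ DIM('a) * vol TYPE('a) n"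
  by (simp add: vol_def powi_Suc2 power_mult_distrib)

definition avg :: "('a::euclidean_space \<Rightarrow> ennreal) \<Rightarrow> int \<times> 'a \<Rightarrow> ennreal" where
  "avg G p = ennreal (1 / vol TYPE('a) (fst p)) * (\<integral>\<^sup>+y\<in>cell_of p. G y \<partial>lebesgue)"

lemma ennreal_cancel_left:
  assumes "0 < c"
  shows "ennreal c * (ennreal (1 / c) * x) = x" "ennreal (1 / c) * (ennreal c * x) = x"
  using assms by (simp_all add: mult.assoc[symmetric] ennreal_mult[symmetric])

lemma integral_eq_vol_avg:
  "(\<integral>\<^sup>+y\<in>cell_of p. G y \<partial>lebesgue) = ennreal (vol TYPE('a) (fst p)) * avg G (p :: int \<times> 'a::euclidean_space)"
  unfolding avg_def by (simp add: ennreal_cancel_left)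

definition parent :: "int \<times> 'a::euclidean_space \<Rightarrow> int \<times> 'a" where
  "parent p = (fst p + 1, centre (fst p + 1) (snd p))"

text \<open>
  The factor 5 leaves room for the points that are only within two side lengths of the cell, which is
  what the choice of a neighbouring cell provides.
\<close>

definition big :: "int \<times> 'a::euclidean_space \<Rightarrow> 'a set" where
  "big p = cube (snd p) (5 * rad TYPE('a) (fst p))"

lemma big_measurable [measurable]: "big p \<in> sets lebesgue"
  unfolding big_def by (rule cube_measurable)

lemma cell_subset_big:
  assumes "p \<in> cells" shows "cell_of p \<subseteq> big (p :: int \<times> 'a::euclidean_space)"
proof -
  have "(fst p, snd p) \<in> cells" using assms by simp
  from cell_subset_cube[OF this] show ?thesis
    unfolding big_def using cube_mono[of "rad TYPE('a) (fst p)" "5 * rad TYPE('a) (fst p)" "snd p"] rad_pos[where 'a='a, of "fst p"]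
    by (auto simp del: rad_pos)
qed

lemma cell_subset_parent: "cell_of p \<subseteq> cell_of (parent p)"
  unfolding parent_def by (simp add: cell_mono)

lemma avg_le_parent: "avg G p \<le> 2 ^ DIM('a) * avg G (parent (p :: int \<times> 'a::euclidean_space))"
proof -
  let ?v = "vol TYPE('a) (fst p)"
  have v: "ennreal (vol TYPE('a) (fst p + 1)) = 2 ^ DIM('a) * ennreal ?v"
    by (simp add: vol_Suc ennreal_mult ennreal_power[symmetric])
  have "(\<integral>\<^sup>+y\<in>cell_of p. G y \<partial>lebesgue) \<le> (\<integral>\<^sup>+y\<in>cell_of (parent p). G y \<partial>lebesgue)"
    using cell_subset_parent[of p] by (intro nn_integral_mono) (auto split: split_indicator)
  then have "avg G p \<le> ennreal (1 / ?v) * (ennreal (vol TYPE('a) (fst p + 1)) * avg G (parent p))"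
    unfolding avg_def[where p=p] using integral_eq_vol_avg[where p="parent p" and G=G]
    by (simp add: mult_left_mono parent_def)
  also have "\<dots> = ennreal (1 / ?v) * (ennreal ?v * (2 ^ DIM('a) * avg G (parent p)))"
    unfolding v by (simp only: ac_simps)
  finally show ?thesis by (simp add: ennreal_cancel_left)
qed

text \<open>
  What the argument for small cubes uses of the weights, with constants that are uniform over the
  cells whose radius is at most the critical radius at their centre: the \<open>A_1\<close> condition for
  \<open>u\<close> (as the function \<open>U\<close> with values in \<open>[0, \<infinity>]\<close>) and, for \<open>v\<close>, the polynomial smallness of the sets
  where \<open>v\<close> is far below its mean with respect to \<open>u\<close>, which is a form of the \<open>A_\<infinity>(u)\<close>
  condition. The assumption \<open>levels\<close> says that no point lies in arbitrarily large local cells, so that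
  maximal cells exist.
\<close>

locale local_weights =
  fixes \<rho> :: "'a::euclidean_space \<Rightarrow> real" and U :: "'a \<Rightarrow> ennreal" and v :: "'a \<Rightarrow> real"
    and K1 K2 ep :: real
  assumes U_meas [measurable]: "U \<in> borel_measurable lebesgue"
    and v_meas [measurable]: "v \<in> borel_measurable lebesgue"
    and constants_pos: "0 < K1" "0 < K2" "0 < ep"
    and levels: "\<exists>N. \<forall>n c. (n, c) \<in> cells \<and> x \<in> cell n c \<and> rad TYPE('a) n \<le> \<rho> c \<longrightarrow> n \<le> N"
    and A1: "(n, c) \<in> cells \<Longrightarrow> rad TYPE('a) n \<le> \<rho> c \<Longrightarrow>
       AE y in lebesgue. y \<in> cube c (5 * rad TYPE('a) n) \<longrightarrow>
         emeasure (density lebesgue U) (cube c (5 * rad TYPE('a) n)) \<le> ennreal (K1 * vol TYPE('a) n) * U y"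
    and U_fin: "(n, c) \<in> cells \<Longrightarrow> rad TYPE('a) n \<le> \<rho> c \<Longrightarrow>
       emeasure (density lebesgue U) (cube c (5 * rad TYPE('a) n)) \<in> {0<..<\<infinity>}"
    and UV_fin: "(n, c) \<in> cells \<Longrightarrow> rad TYPE('a) n \<le> \<rho> c \<Longrightarrow>
       emeasure (density lebesgue (\<lambda>y. U y * ennreal (v y))) (cube c (5 * rad TYPE('a) n)) \<in> {0<..<\<infinity>}"
    and Ainf: "(n, c) \<in> cells \<Longrightarrow> rad TYPE('a) n \<le> \<rho> c \<Longrightarrow> 0 < lam \<Longrightarrow>
       emeasure (density lebesgue U) {y \<in> cube c (5 * rad TYPE('a) n).
          v y \<le> lam * (enn2real (emeasure (density lebesgue (\<lambda>y. U y * ennreal (v y))) (cube c (5 * rad TYPE('a) n)))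
                       / enn2real (emeasure (density lebesgue U) (cube c (5 * rad TYPE('a) n))))}
        \<le> ennreal (K2 * lam powr ep) * emeasure (density lebesgue U) (cube c (5 * rad TYPE('a) n))"
begin

definition mu :: "'a measure" where "mu = density lebesgue U"
definition nu :: "'a measure" where "nu = density lebesgue (\<lambda>y. U y * ennreal (v y))"

lemma sets_mu [simp, measurable_cong]: "sets mu = sets lebesgue" by (simp add: mu_def)
lemma sets_nu [simp, measurable_cong]: "sets nu = sets lebesgue" by (simp add: nu_def)

lemma emeasure_mu: "A \<in> sets lebesgue \<Longrightarrow> emeasure mu A = (\<integral>\<^sup>+y\<in>A. U y \<partial>lebesgue)"
  unfolding mu_def by (rule emeasure_density) auto

lemma emeasure_nu: "A \<in> sets lebesgue \<Longrightarrow> emeasure nu A = (\<integral>\<^sup>+y\<in>A. U y * ennreal (v y) \<partial>lebesgue)"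
  unfolding nu_def by (rule emeasure_density) auto

definition loc :: "int \<times> 'a \<Rightarrow> bool" where
  "loc p \<longleftrightarrow> p \<in> cells \<and> rad TYPE('a) (fst p) \<le> \<rho> (snd p)"

text \<open>
  The mean of \<open>v\<close> over the dilated cell with respect to the measure \<open>u\<close>.
\<close>

definition mass :: "int \<times> 'a \<Rightarrow> real" where
  "mass p = enn2real (emeasure nu (big p)) / enn2real (emeasure mu (big p))"

lemma loc_cells: "loc p \<Longrightarrow> p \<in> cells" by (simp add: loc_def)

lemma loc_A1: "loc p \<Longrightarrow> AE y in lebesgue. y \<in> big p \<longrightarrow> emeasure mu (big p) \<le> ennreal (K1 * vol TYPE('a) (fst p)) * U y"
  unfolding loc_def big_def mu_def using A1[of "fst p" "snd p"] by simp

lemma loc_levels: "\<exists>N. \<forall>p. loc p \<and> x \<in> cell_of p \<longrightarrow> fst p \<le> N"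
  using levels[of x] unfolding loc_def by force

lemma loc_fin:
  assumes "loc p"
  obtains m n where "0 < m" "0 < n" "emeasure mu (big p) = ennreal m" "emeasure nu (big p) = ennreal n" "mass p = n / m"
proof -
  have 1: "emeasure mu (big p) \<in> {0<..<\<infinity>}" "emeasure nu (big p) \<in> {0<..<\<infinity>}"
    using assms U_fin[of "fst p" "snd p"] UV_fin[of "fst p" "snd p"] unfolding loc_def big_def mu_def nu_def by auto
  let ?m = "enn2real (emeasure mu (big p))" and ?n = "enn2real (emeasure nu (big p))"
  have "0 < ?m" "0 < ?n" using 1 by (auto simp: enn2real_positive_iff)
  moreover have "emeasure mu (big p) = ennreal ?m" "emeasure nu (big p) = ennreal ?n" using 1 by auto
  ultimately show ?thesis using that[of ?m ?n] by (simp add: mass_def)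
qed

lemma mass_pos: "loc p \<Longrightarrow> 0 < mass p"
  by (elim loc_fin) simp

lemma loc_Ainf:
  assumes "loc p" "0 < lam"
  shows "emeasure mu {y \<in> big p. v y \<le> lam * mass p} \<le> ennreal (K2 * lam powr ep) * emeasure mu (big p)"
  using assms Ainf[of "fst p" "snd p" lam] unfolding loc_def big_def mu_def nu_def mass_def by simp

lemma level_set_measurable [measurable]: "{y \<in> big p. v y \<le> t} \<in> sets lebesgue"
  by (intro sublevel_measurable v_meas big_measurable)

text \<open>
  The level \<open>lam0\<close> is chosen so that the part of the dilated cell where \<open>v\<close> is below \<open>lam0\<close> times its
  mean has at most half of the \<open>u\<close>-measure that the \<open>A_1\<close> condition guarantees for half of the cell.
\<close>

definition lam0 :: real where "lam0 = (1 / (4 * K1 * K2)) powr (1 / ep)"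
definition K3 :: real where "K3 = 4 * K1 / lam0"

lemma lam0: "0 < lam0" "K2 * lam0 powr ep = 1 / (4 * K1)"
  using constants_pos by (simp_all add: lam0_def powr_powr)

lemma K3_pos: "0 < K3" using lam0 constants_pos by (simp add: K3_def)

text \<open>
  By \<open>A_1\<close> the set \<open>A\<close> has a fixed share of the \<open>u\<close>-measure of the dilated cell. Deleting the points
  where \<open>v\<close> is below \<open>lam0\<close> times its mean costs at most half of this share, and on the remaining points
  \<open>v\<close> is bounded below.
\<close>

lemma nu_big_le:
  assumes p: "loc p" and A: "A \<in> sets lebesgue" "A \<subseteq> big p"
    and half: "ennreal (vol TYPE('a) (fst p) / 2) \<le> emeasure lebesgue A"
  shows "emeasure nu (big p) \<le> ennreal K3 * emeasure nu A"
proof -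
  obtain m n where mn: "0 < m" "0 < n" "emeasure mu (big p) = ennreal m" "emeasure nu (big p) = ennreal n" "mass p = n / m"
    using loc_fin[OF p] .
  define V where "V = vol TYPE('a) (fst p)"
  have V: "0 < V" by (simp add: V_def)
  have K1V: "0 < K1 * V" using constants_pos V by simp
  define bad where "bad = {y \<in> big p. v y \<le> lam0 * mass p}"
  have bad_meas [measurable]: "bad \<in> sets lebesgue" unfolding bad_def by measurable
  have lower: "AE y in lebesgue. y \<in> A \<longrightarrow> ennreal (m / (K1 * V)) \<le> U y"
    using loc_A1[OF p]
  proof eventually_elim
    case (elim y)
    show ?case
    proof
      assume "y \<in> A"
      then have "ennreal m \<le> ennreal (K1 * V) * U y" using elim A mn by (auto simp: V_def)
      then have "ennreal (1 / (K1 * V)) * ennreal m \<le> ennreal (1 / (K1 * V)) * (ennreal (K1 * V) * U y)"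
        by (rule mult_left_mono) simp
      then show "ennreal (m / (K1 * V)) \<le> U y"
        using K1V mn by (simp add: ennreal_cancel_left ennreal_mult[symmetric])
    qed
  qed
  have "ennreal (m / (2 * K1)) = ennreal (m / (K1 * V)) * ennreal (V / 2)"
    using mn V K1V by (simp add: ennreal_mult[symmetric] field_simps)
  also have "\<dots> \<le> ennreal (m / (K1 * V)) * emeasure lebesgue A"
    using half by (intro mult_left_mono) (auto simp: V_def)
  also have "\<dots> = (\<integral>\<^sup>+y\<in>A. ennreal (m / (K1 * V)) \<partial>lebesgue)"
    using A by (simp add: nn_integral_cmult_indicator)
  also have "\<dots> \<le> (\<integral>\<^sup>+y\<in>A. U y \<partial>lebesgue)"
    using lower by (intro nn_integral_mono_AE) (auto split: split_indicator)
  also have "\<dots> = emeasure mu A" using A by (simp add: emeasure_mu)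
  finally have muA: "ennreal (m / (2 * K1)) \<le> emeasure mu A" .
  have mubad: "emeasure mu bad \<le> ennreal (m / (4 * K1))"
    using loc_Ainf[OF p lam0(1)] mn constants_pos unfolding bad_def lam0(2) by (simp add: ennreal_mult[symmetric])
  have "emeasure mu A \<le> emeasure mu ((A - bad) \<union> bad)"
    using A bad_meas by (intro emeasure_mono) auto
  also have "\<dots> \<le> emeasure mu (A - bad) + emeasure mu bad"
    using A bad_meas by (intro emeasure_subadditive) auto
  finally have "ennreal (m / (2 * K1)) \<le> emeasure mu (A - bad) + ennreal (m / (4 * K1))"
    using muA mubad by (meson add_left_mono order_trans)
  moreover have "ennreal (m / (2 * K1)) = ennreal (m / (4 * K1)) + ennreal (m / (4 * K1))"
    using mn constants_pos by (simp add: ennreal_plus[symmetric] del: ennreal_plus)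
  ultimately have good: "ennreal (m / (4 * K1)) \<le> emeasure mu (A - bad)"
    by (simp add: ennreal_add_left_cancel_le add.commute)
  have lm: "0 < lam0 * mass p" using lam0 mn by simp
  have "ennreal (lam0 * mass p) * emeasure mu (A - bad) = (\<integral>\<^sup>+y\<in>A - bad. ennreal (lam0 * mass p) * U y \<partial>lebesgue)"
    using A bad_meas by (subst emeasure_mu) (auto simp: nn_integral_cmult[symmetric] mult.assoc)
  also have "\<dots> \<le> (\<integral>\<^sup>+y\<in>A. U y * ennreal (v y) \<partial>lebesgue)"
  proof (intro nn_integral_mono)
    fix y
    show "ennreal (lam0 * mass p) * U y * indicator (A - bad) y \<le> U y * ennreal (v y) * indicator A y"
    proof (cases "y \<in> A - bad")
      case True
      then have "lam0 * mass p \<le> v y" using A by (auto simp: bad_def)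
      then show ?thesis using True by (simp add: mult.commute[of _ "U y"] mult_left_mono ennreal_leI)
    qed simp
  qed
  also have "\<dots> = emeasure nu A" using A by (simp add: emeasure_nu)
  finally have "ennreal (lam0 * mass p) * ennreal (m / (4 * K1)) \<le> emeasure nu A"
    using good by (meson mult_left_mono order_trans zero_le)
  then have "ennreal K3 * (ennreal (lam0 * mass p) * ennreal (m / (4 * K1))) \<le> ennreal K3 * emeasure nu A"
    by (rule mult_left_mono) simp
  moreover have "ennreal K3 * (ennreal (lam0 * mass p) * ennreal (m / (4 * K1))) = ennreal n"
    using K3_pos lm mn constants_pos lam0 by (simp add: ennreal_mult[symmetric] K3_def)
  ultimately show ?thesis using mn by simp
qed

text \<open>
  The \<open>A_1\<close> condition in the form in which it turns averages of \<open>G\<close> into integrals against \<open>u\<close>.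
\<close>

lemma avg_mu_big_le:
  assumes p: "loc p" and G [measurable]: "G \<in> borel_measurable lebesgue"
  shows "avg G p * emeasure mu (big p) \<le> ennreal K1 * (\<integral>\<^sup>+y\<in>cell_of p. G y * U y \<partial>lebesgue)"
proof -
  define V where "V = vol TYPE('a) (fst p)"
  have V: "0 < V" by (simp add: V_def)
  have "(\<integral>\<^sup>+y\<in>cell_of p. G y \<partial>lebesgue) * emeasure mu (big p) = (\<integral>\<^sup>+y. G y * indicator (cell_of p) y * emeasure mu (big p) \<partial>lebesgue)"
    by (intro nn_integral_multc[symmetric]) auto
  also have "\<dots> \<le> (\<integral>\<^sup>+y. ennreal (K1 * V) * (G y * U y * indicator (cell_of p) y) \<partial>lebesgue)"
  proof (intro nn_integral_mono_AE)
    show "AE y in lebesgue. G y * indicator (cell_of p) y * emeasure mu (big p) \<le> ennreal (K1 * V) * (G y * U y * indicator (cell_of p) y)"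
      using loc_A1[OF p]
    proof eventually_elim
      case (elim y)
      show ?case
      proof (cases "y \<in> cell_of p")
        case True
        then have "emeasure mu (big p) \<le> ennreal (K1 * V) * U y"
          using elim cell_subset_big[OF loc_cells[OF p]] by (auto simp: V_def)
        then have "G y * emeasure mu (big p) \<le> G y * (ennreal (K1 * V) * U y)" by (rule mult_left_mono) simp
        then show ?thesis using True by (simp add: ac_simps)
      qed simp
    qed
  qed
  also have "\<dots> = ennreal (K1 * V) * (\<integral>\<^sup>+y\<in>cell_of p. G y * U y \<partial>lebesgue)"
    by (intro nn_integral_cmult) auto
  finally have "ennreal (1 / V) * ((\<integral>\<^sup>+y\<in>cell_of p. G y \<partial>lebesgue) * emeasure mu (big p)) \<le>
     ennreal (1 / V) * (ennreal V * (ennreal K1 * (\<integral>\<^sup>+y\<in>cell_of p. G y * U y \<partial>lebesgue)))"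
    using V constants_pos by (intro mult_left_mono) (auto simp: ennreal_mult ac_simps)
  then show ?thesis using V by (simp only: ennreal_cancel_left) (simp add: avg_def V_def mult.assoc)
qed

section \<open>Stopping cells and their packing\<close>

text \<open>
  The ratio of consecutive levels has to exceed the loss \<open>2\<^sup>d\<close> from a cell to its parent by a factor
  of 2, so that the next generation covers at most half of a stopping cell.
\<close>

definition base :: real where "base = 2 ^ (DIM('a) + 1)"

lemma base_gt_1: "1 < base"
  unfolding base_def by (rule one_less_power) auto

lemma base_powi_pos [simp]: "0 < base powi k"
  using base_gt_1 by simp

lemma base_powi_nonneg [simp]: "0 \<le> base powi k"
  using base_gt_1 by simp

lemma base_powi_Suc: "base powi (k + 1) = base * base powi k"
  using base_gt_1 by (simp add: power_int_add)

definition good :: "('a \<Rightarrow> ennreal) \<Rightarrow> int \<Rightarrow> (int \<times> 'a) set" where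
  "good G k = {p. loc p \<and> ennreal (base powi k) < avg G p}"

text \<open>
  Requiring the parent to be local excludes the maximal cells that stop only because they reach the
  critical scale; for those no upper bound for the average is available.
\<close>

definition stopping :: "('a \<Rightarrow> ennreal) \<Rightarrow> int \<Rightarrow> (int \<times> 'a) set" where
  "stopping G k = {p \<in> tops (good G k). loc (parent p)}"

definition above :: "('a \<Rightarrow> ennreal) \<Rightarrow> int \<Rightarrow> 'a set" where
  "above G k = (\<Union>p\<in>good G k. cell_of p)"

definition stops :: "('a \<Rightarrow> ennreal) \<Rightarrow> (int \<times> (int \<times> 'a)) set" where
  "stops G = {(k, p). p \<in> stopping G k}"

lemma good_cells: "good G k \<subseteq> cells"
  by (auto simp: good_def loc_def)

lemma good_levels:
  assumes "F \<subseteq> {p. loc p}"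
  shows "\<exists>N. \<forall>q\<in>F. x \<in> cell_of q \<longrightarrow> fst q \<le> N"
  using loc_levels[of x] assms by blast

lemma good_mono: "k \<le> j \<Longrightarrow> good G j \<subseteq> good G k"
proof -
  assume "k \<le> j"
  then have "ennreal (base powi k) \<le> ennreal (base powi j)"
    using base_gt_1 by (intro ennreal_leI power_int_increasing) auto
  then show ?thesis unfolding good_def using order.strict_trans1 by blast
qed

lemma above_mono: "k \<le> j \<Longrightarrow> above G j \<subseteq> above G k"
  unfolding above_def using good_mono by blast

lemma countable_subset_cells: "F \<subseteq> cells \<Longrightarrow> countable F"
  using countable_cells countable_subset by blast

lemma above_measurable [measurable]: "above G k \<in> sets lebesgue"
  unfolding above_def by (intro sets.countable_UN' countable_subset_cells good_cells) auto

lemma stopping_loc: "p \<in> stopping G k \<Longrightarrow> loc p"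
  unfolding stopping_def tops_def good_def by auto

lemma stopping_gt: "p \<in> stopping G k \<Longrightarrow> ennreal (base powi k) < avg G p"
  unfolding stopping_def tops_def good_def by auto

text \<open>
  The parent is local and larger, hence its average does not exceed the threshold; passing to the
  child multiplies the average by at most \<open>2\<^sup>d\<close>.
\<close>

lemma stopping_le:
  assumes "p \<in> stopping G k"
  shows "avg G p \<le> ennreal (2 ^ DIM('a) * base powi k)"
proof -
  have "parent p \<notin> good G k"
  proof
    assume "parent p \<in> good G k"
    then have "fst (parent p) \<le> fst p"
      using assms cell_subset_parent unfolding stopping_def tops_def by blast
    then show False by (simp add: parent_def)
  qed
  then have "avg G (parent p) \<le> ennreal (base powi k)"
    using assms unfolding good_def stopping_def by auto
  then have "2 ^ DIM('a) * avg G (parent p) \<le> 2 ^ DIM('a) * ennreal (base powi k)"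
    by (rule mult_left_mono) simp
  also have "\<dots> = ennreal (2 ^ DIM('a) * base powi k)"
    by (simp add: ennreal_mult ennreal_power[symmetric])
  finally show ?thesis using avg_le_parent[of G p] by simp
qed

text \<open>
  By maximality every cell of the next level that meets \<open>p\<close> lies inside \<open>p\<close>. The maximal ones among
  these are disjoint, and Chebyshev's inequality bounds their total volume by the integral of \<open>G\<close>
  over \<open>p\<close>, which \<open>stopping_le\<close> controls.
\<close>

lemma cell_above_next_le:
  assumes p: "p \<in> stopping G k" and G [measurable]: "G \<in> borel_measurable lebesgue"
  shows "emeasure lebesgue (cell_of p \<inter> above G (k + 1)) \<le> ennreal (vol TYPE('a) (fst p) / 2)"
proof -
  define F where "F = {q \<in> good G (k + 1). cell_of q \<subseteq> cell_of p}"
  have F: "F \<subseteq> cells" using good_cells by (auto simp: F_def)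
  have Fl: "F \<subseteq> {q. loc q}" by (auto simp: F_def good_def)
  have cp: "p \<in> cells" using stopping_loc[OF p] loc_cells by blast
  have "cell_of p \<inter> above G (k + 1) \<subseteq> (\<Union>q\<in>F. cell_of q)"
  proof
    fix z assume z: "z \<in> cell_of p \<inter> above G (k + 1)"
    then obtain q where q: "q \<in> good G (k + 1)" "z \<in> cell_of q" unfolding above_def by blast
    have cq: "q \<in> cells" using q good_cells by blast
    have "fst q \<le> fst p"
    proof (rule ccontr)
      assume n: "\<not> fst q \<le> fst p"
      have "cell_of p \<subseteq> cell_of q"
        using cells_disjoint_or_nested[OF cp cq] z q n by auto
      moreover have "q \<in> good G k" using q good_mono[of k "k + 1"] by auto
      ultimately show False using p n unfolding stopping_def tops_def by blast
    qed
    then have "cell_of q \<subseteq> cell_of p"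
      using cells_disjoint_or_nested[OF cq cp] z q by auto
    then show "z \<in> (\<Union>q\<in>F. cell_of q)" using q unfolding F_def by blast
  qed
  also have "\<dots> = (\<Union>q\<in>tops F. cell_of q)" using UN_tops[OF F good_levels[OF Fl]] by simp
  finally have sub: "cell_of p \<inter> above G (k + 1) \<subseteq> (\<Union>q\<in>tops F. cell_of q)" .
  have cF: "countable (tops F)" using F tops_subset by (intro countable_subset_cells) blast
  let ?b = "base powi (k + 1)"
  have one: "emeasure lebesgue (cell_of q) \<le> (\<integral>\<^sup>+y\<in>cell_of q. ennreal (1 / ?b) * G y \<partial>lebesgue)" if q: "q \<in> tops F" for q
  proof -
    let ?V = "vol TYPE('a) (fst q)"
    have "ennreal ?b \<le> avg G q" using q by (auto simp: tops_def F_def good_def)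
    then have "ennreal ?V * ennreal ?b \<le> ennreal ?V * avg G q" by (rule mult_left_mono) simp
    then have "ennreal (1 / ?b) * (ennreal ?b * ennreal ?V) \<le> ennreal (1 / ?b) * (\<integral>\<^sup>+y\<in>cell_of q. G y \<partial>lebesgue)"
      unfolding integral_eq_vol_avg[where p=q and G=G] by (intro mult_left_mono) (auto simp: mult.commute)
    then have "ennreal ?V \<le> ennreal (1 / ?b) * (\<integral>\<^sup>+y\<in>cell_of q. G y \<partial>lebesgue)"
      by (simp add: ennreal_cancel_left)
    then show ?thesis by (simp add: emeasure_cell_vol nn_integral_cmult[symmetric] mult.assoc)
  qed
  have "emeasure lebesgue (cell_of p \<inter> above G (k + 1)) \<le> emeasure lebesgue (\<Union>q\<in>tops F. cell_of q)"
    using sub cF by (intro emeasure_mono sets.countable_UN') auto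
  also have "\<dots> \<le> (\<integral>\<^sup>+q. emeasure lebesgue (cell_of q) \<partial>count_space (tops F))"
    using cF by (intro emeasure_UN_le_nn_integral) auto
  also have "\<dots> \<le> (\<integral>\<^sup>+q. (\<integral>\<^sup>+y\<in>cell_of q. ennreal (1 / ?b) * G y \<partial>lebesgue) \<partial>count_space (tops F))"
    by (intro nn_integral_mono) (use one in auto)
  also have "\<dots> \<le> (\<integral>\<^sup>+y\<in>cell_of p. ennreal (1 / ?b) * G y \<partial>lebesgue)"
    using cF tops_disjoint[OF F] by (intro sum_nn_integral_disjoint_le) (auto simp: tops_def F_def)
  also have "\<dots> = ennreal (1 / ?b) * (ennreal (vol TYPE('a) (fst p)) * avg G p)"
    unfolding integral_eq_vol_avg[symmetric] by (simp add: nn_integral_cmult[symmetric] mult.assoc)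
  also have "\<dots> \<le> ennreal (1 / ?b) * (ennreal (vol TYPE('a) (fst p)) * ennreal (2 ^ DIM('a) * base powi k))"
    using stopping_le[OF p] by (intro mult_left_mono) auto
  also have "\<dots> = ennreal (1 / ?b * (vol TYPE('a) (fst p) * (2 ^ DIM('a) * base powi k)))"
    by (simp only: ennreal_mult[symmetric] base_powi_nonneg vol_nonneg zero_le_mult_iff zero_le_power zero_le_numeral
        divide_nonneg_nonneg zero_le_one simp_thms)
  also have "1 / ?b * (vol TYPE('a) (fst p) * (2 ^ DIM('a) * base powi k)) = vol TYPE('a) (fst p) / 2"
    using base_powi_pos[of k] unfolding base_powi_Suc by (simp add: base_def divide_simps)
  finally show ?thesis .
qed

definition own :: "('a \<Rightarrow> ennreal) \<Rightarrow> int \<times> (int \<times> 'a) \<Rightarrow> 'a set" where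
  "own G i = cell_of (snd i) - above G (fst i + 1)"

lemma own_measurable [measurable]: "own G i \<in> sets lebesgue"
  unfolding own_def by simp

lemma own_half:
  assumes p: "p \<in> stopping G k" and G: "G \<in> borel_measurable lebesgue"
  shows "ennreal (vol TYPE('a) (fst p) / 2) \<le> emeasure lebesgue (own G (k, p))"
proof -
  let ?V = "vol TYPE('a) (fst p)"
  have "cell_of p = (cell_of p \<inter> above G (k + 1)) \<union> own G (k, p)" by (auto simp: own_def)
  then have "ennreal ?V = emeasure lebesgue ((cell_of p \<inter> above G (k + 1)) \<union> own G (k, p))"
    using emeasure_cell_vol[of "fst p" "snd p"] by simp
  also have "\<dots> \<le> emeasure lebesgue (cell_of p \<inter> above G (k + 1)) + emeasure lebesgue (own G (k, p))"
    by (intro emeasure_subadditive) auto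
  also have "\<dots> \<le> ennreal (?V / 2) + emeasure lebesgue (own G (k, p))"
    using cell_above_next_le[OF p G] by (intro add_right_mono)
  finally have "ennreal (?V / 2) + ennreal (?V / 2) \<le> ennreal (?V / 2) + emeasure lebesgue (own G (k, p))"
    by (simp add: ennreal_plus[symmetric] del: ennreal_plus)
  then show ?thesis by (simp add: ennreal_add_left_cancel_le)
qed

lemma own_disjoint: "disjoint_family_on (own G) (stops G)"
  unfolding disjoint_family_on_def
proof (intro ballI impI)
  have lt: "own G (k, p) \<inter> own G (j, q) = {}" if "q \<in> stopping G j" "k < j" for k p j q
  proof -
    have "cell_of q \<subseteq> above G j" using that unfolding above_def stopping_def tops_def by blast
    also have "\<dots> \<subseteq> above G (k + 1)" using that by (intro above_mono) simp
    finally show ?thesis unfolding own_def by auto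
  qed
  fix i i' assume i: "i \<in> stops G" "i' \<in> stops G" "i \<noteq> i'"
  obtain k p j q where e: "i = (k, p)" "i' = (j, q)" by (cases i, cases i')
  have s: "p \<in> stopping G k" "q \<in> stopping G j" using i e by (auto simp: stops_def)
  consider "k < j" | "j < k" | "k = j" by linarith
  then show "own G i \<inter> own G i' = {}"
  proof cases
    case 1 then show ?thesis using lt[of q j k p] s e by simp
  next
    case 2 then show ?thesis using lt[of p k j q] s e by blast
  next
    case 3
    then have "p \<noteq> q" using i e by auto
    then have "cell_of p \<inter> cell_of q = {}"
      using tops_disjoint[OF good_cells, of G k] s 3 unfolding disjoint_family_on_def stopping_def by blast
    then show ?thesis unfolding own_def e by auto
  qed
qed

lemma countable_stops: "F \<subseteq> stops G \<Longrightarrow> countable F"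
proof (rule countable_subset)
  show "F \<subseteq> stops G \<Longrightarrow> F \<subseteq> UNIV \<times> cells"
    by (auto simp: stops_def stopping_def tops_def good_def loc_def)
  show "countable ((UNIV :: int set) \<times> (cells :: (int \<times> 'a) set))" using countable_cells by auto
qed

text \<open>
  A Carleson packing estimate. The parts owned by the cells are disjoint and carry a fixed share of
  the measure \<open>uv\<close>, so the sum over all cells is bounded by the measure of their union, that is, of
  the maximal cells of the family. For a maximal cell the hypothesis, the lower bound for the average
  of \<open>G\<close> and the \<open>A_1\<close> condition lead to the integral of \<open>G u\<close> over the cell.
\<close>

lemma packing:
  assumes G [measurable]: "G \<in> borel_measurable lebesgue" and B: "0 \<le> B" and F: "F \<subseteq> stops G"
    and le: "\<And>k p. (k, p) \<in> F \<Longrightarrow> emeasure nu (big p) \<le> ennreal (B * base powi k) * emeasure mu (big p)"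
  shows "(\<integral>\<^sup>+i. emeasure nu (big (snd i)) \<partial>count_space F) \<le> ennreal (K3 * B * K1) * (\<integral>\<^sup>+y. G y * U y \<partial>lebesgue)"
proof -
  have cF: "countable F" using F by (rule countable_stops)
  have locF: "loc (snd i)" if "i \<in> F" for i
    using that F stopping_loc by (auto simp: stops_def)
  define P where "P = snd ` F"
  have P: "P \<subseteq> cells" "P \<subseteq> {p. loc p}" using locF loc_cells by (auto simp: P_def)
  have cP: "countable (tops P)" using P tops_subset by (intro countable_subset_cells) blast
  have own_le: "emeasure nu (big (snd i)) \<le> ennreal K3 * emeasure nu (own G i)" if i: "i \<in> F" for i
  proof (rule nu_big_le[OF locF[OF i]])
    show "own G i \<in> sets lebesgue" by simp
    show "own G i \<subseteq> big (snd i)" using cell_subset_big[OF loc_cells[OF locF[OF i]]] by (auto simp: own_def)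
    show "ennreal (vol TYPE('a) (fst (snd i)) / 2) \<le> emeasure lebesgue (own G i)"
      using own_half[OF _ G, of "snd i" "fst i"] i F by (auto simp: stops_def)
  qed
  have top_le: "emeasure nu (cell_of p) \<le> (\<integral>\<^sup>+y\<in>cell_of p. ennreal (B * K1) * (G y * U y) \<partial>lebesgue)" if p: "p \<in> tops P" for p
  proof -
    obtain k where k: "(k, p) \<in> F" using p by (auto simp: tops_def P_def)
    have "loc p" using locF[OF k] by simp
    have "emeasure nu (cell_of p) \<le> emeasure nu (big p)"
      using cell_subset_big[OF loc_cells[OF \<open>loc p\<close>]] by (intro emeasure_mono) auto
    also have "\<dots> \<le> ennreal (B * base powi k) * emeasure mu (big p)" by (rule le[OF k])
    also have "\<dots> = ennreal B * (ennreal (base powi k) * emeasure mu (big p))"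
      using B by (simp add: ennreal_mult mult.assoc)
    also have "\<dots> \<le> ennreal B * (avg G p * emeasure mu (big p))"
      using stopping_gt[of p G k] k F by (intro mult_left_mono mult_right_mono) (auto simp: stops_def)
    also have "\<dots> \<le> ennreal B * (ennreal K1 * (\<integral>\<^sup>+y\<in>cell_of p. G y * U y \<partial>lebesgue))"
      by (intro mult_left_mono avg_mu_big_le \<open>loc p\<close> G) simp
    also have "\<dots> = (\<integral>\<^sup>+y\<in>cell_of p. ennreal (B * K1) * (G y * U y) \<partial>lebesgue)"
      using B constants_pos by (subst mult.assoc[symmetric], subst ennreal_mult[symmetric])
        (auto simp: nn_integral_cmult[symmetric] mult.assoc)
    finally show ?thesis .
  qed
  have "(\<integral>\<^sup>+i. emeasure nu (big (snd i)) \<partial>count_space F) \<le> (\<integral>\<^sup>+i. ennreal K3 * emeasure nu (own G i) \<partial>count_space F)"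
    by (intro nn_integral_mono) (use own_le in auto)
  also have "\<dots> = ennreal K3 * (\<integral>\<^sup>+i. emeasure nu (own G i) \<partial>count_space F)"
    by (intro nn_integral_cmult) auto
  also have "(\<integral>\<^sup>+i. emeasure nu (own G i) \<partial>count_space F) = emeasure nu (\<Union>i\<in>F. own G i)"
    using cF disjoint_family_on_mono[OF F own_disjoint] by (intro emeasure_UN_countable[symmetric]) auto
  also have "\<dots> \<le> emeasure nu (\<Union>p\<in>P. cell_of p)"
    using countable_subset_cells[OF P(1)] by (intro emeasure_mono sets.countable_UN'') (auto simp: own_def P_def)
  also have "(\<Union>p\<in>P. cell_of p) = (\<Union>p\<in>tops P. cell_of p)"
    using UN_tops[OF P(1) good_levels[OF P(2)]] by simp
  also have "emeasure nu (\<Union>p\<in>tops P. cell_of p) \<le> (\<integral>\<^sup>+p. emeasure nu (cell_of p) \<partial>count_space (tops P))"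
    using cP by (intro emeasure_UN_le_nn_integral) auto
  also have "\<dots> \<le> (\<integral>\<^sup>+p. (\<integral>\<^sup>+y\<in>cell_of p. ennreal (B * K1) * (G y * U y) \<partial>lebesgue) \<partial>count_space (tops P))"
    by (intro nn_integral_mono) (use top_le in auto)
  also have "\<dots> \<le> (\<integral>\<^sup>+y\<in>UNIV. ennreal (B * K1) * (G y * U y) \<partial>lebesgue)"
    using cP tops_disjoint[OF P(1)] by (intro sum_nn_integral_disjoint_le) auto
  also have "\<dots> = ennreal (B * K1) * (\<integral>\<^sup>+y. G y * U y \<partial>lebesgue)"
    by (simp add: nn_integral_cmult)
  finally show ?thesis
    using B constants_pos K3_pos by (simp add: ennreal_mult mult_left_mono mult.assoc less_imp_le)
qed

text \<open>
  One factor \<open>s / mass p\<close> comes from the bound for \<open>v\<close> on the set, the power with exponent \<open>ep\<close> from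
  the \<open>u\<close>-measure of the set. Only the total exponent above 1 makes the sum over the bands converge.
\<close>

lemma nu_level_le:
  assumes p: "loc p" and s: "0 < s"
  shows "emeasure nu {y \<in> big p. v y \<le> s} \<le> ennreal (K2 * (s / mass p) powr (1 + ep)) * emeasure nu (big p)"
proof -
  obtain m n where mn: "0 < m" "0 < n" "emeasure mu (big p) = ennreal m" "emeasure nu (big p) = ennreal n" "mass p = n / m"
    using loc_fin[OF p] .
  have ms: "0 < mass p" using mn by simp
  define lam where "lam = s / mass p"
  have lam: "0 < lam" "s = lam * mass p" using s ms by (auto simp: lam_def)
  have "emeasure nu {y \<in> big p. v y \<le> s} \<le> (\<integral>\<^sup>+y. ennreal s * (U y * indicator {y \<in> big p. v y \<le> s} y) \<partial>lebesgue)"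
    by (subst emeasure_nu, simp, intro nn_integral_mono)
      (auto split: split_indicator simp: mult.commute[of "U _"] intro!: mult_right_mono ennreal_leI)
  also have "\<dots> = ennreal s * emeasure mu {y \<in> big p. v y \<le> s}"
    by (subst emeasure_mu, simp, intro nn_integral_cmult) auto
  also have "\<dots> \<le> ennreal s * (ennreal (K2 * lam powr ep) * emeasure mu (big p))"
    using loc_Ainf[OF p lam(1)] unfolding lam(2) by (intro mult_left_mono) auto
  also have "\<dots> = ennreal (K2 * lam powr (1 + ep)) * emeasure nu (big p)"
    using mn lam constants_pos s by (simp add: ennreal_mult[symmetric] powr_add)
  finally show ?thesis by (simp add: lam_def)
qed

text \<open>
  The band 0 takes all cells with \<open>mass p \<le> base powi k\<close>: there the trivial bound of the level set by
  the whole dilated cell suffices.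
\<close>

definition band :: "('a \<Rightarrow> ennreal) \<Rightarrow> nat \<Rightarrow> (int \<times> (int \<times> 'a)) set" where
  "band G l = {(k, p) \<in> stops G. mass p \<le> base ^ l * base powi k \<and> (l = 0 \<or> base ^ (l - 1) * base powi k < mass p)}"

lemma UN_band: "stops G = (\<Union>l. band G l)"
proof
  show "stops G \<subseteq> (\<Union>l. band G l)"
  proof
    fix i assume i: "i \<in> stops G"
    obtain k p where e: "i = (k, p)" by (cases i)
    define Q where "Q l \<longleftrightarrow> mass p \<le> base ^ l * base powi k" for l
    obtain n where "mass p / base powi k < base ^ n" using real_arch_pow[OF base_gt_1] by blast
    then have "Q n" unfolding Q_def by (simp add: pos_divide_less_eq less_imp_le)
    then have 1: "Q (LEAST l. Q l)" by (rule LeastI)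
    have 2: "(LEAST l. Q l) = 0 \<or> \<not> Q ((LEAST l. Q l) - 1)"
      using not_less_Least[of "(LEAST l. Q l) - 1" Q] by auto
    have "i \<in> band G (LEAST l. Q l)" using 1 2 i unfolding band_def e Q_def by auto
    then show "i \<in> (\<Union>l. band G l)" by blast
  qed
qed (auto simp: band_def)

text \<open>
  In the band \<open>l\<close> the packing estimate loses \<open>base ^ l\<close> and the level set gains
  \<open>base powr (- l * (1 + ep))\<close>, so that the bands contribute a geometric series.
\<close>

lemma local_estimate:
  assumes L: "0 < L"
  shows "\<exists>C>0. \<forall>G. G \<in> borel_measurable lebesgue \<longrightarrow>
    emeasure nu (\<Union>(k, p)\<in>stops G. {y \<in> big p. v y \<le> L * base powi k}) \<le> ennreal C * (\<integral>\<^sup>+y. G y * U y \<partial>lebesgue)"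
proof -
  define c where "c = 1 + K2 * (L * base) powr (1 + ep)"
  have c: "0 < c" "1 \<le> c" using constants_pos by (auto simp: c_def add_pos_nonneg)
  define r where "r = base powr (- ep)"
  have r: "0 < r" "r < 1" using base_gt_1 constants_pos by (auto simp: r_def powr_less_one)
  define C where "C = c * K3 * K1 / (1 - r)"
  have "0 < C" using c r K3_pos constants_pos by (simp add: C_def)
  moreover have "emeasure nu (\<Union>(k, p)\<in>stops G. {y \<in> big p. v y \<le> L * base powi k}) \<le> ennreal C * (\<integral>\<^sup>+y. G y * U y \<partial>lebesgue)"
    if G [measurable]: "G \<in> borel_measurable lebesgue" for G
  proof -
    let ?I = "\<integral>\<^sup>+y. G y * U y \<partial>lebesgue"
    define X where "X i = {y \<in> big (snd i). v y \<le> L * base powi (fst i)}" for i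
    have X [measurable]: "X i \<in> sets lebesgue" for i unfolding X_def by measurable
    have cb: "countable (band G l)" for l by (rule countable_stops[of _ G]) (auto simp: band_def)
    \<comment> \<open>The ratio \<open>r / base\<close> is \<open>base powr (- (1 + ep))\<close>; the factor \<open>1 / base\<close> will cancel the loss in the packing estimate.\<close>
    have one: "emeasure nu (X i) \<le> ennreal (c * (r / base) ^ l) * emeasure nu (big (snd i))" if i: "i \<in> band G l" for i l
    proof -
      obtain k p where e: "i = (k, p)" by (cases i)
      have p: "loc p" using i by (intro stopping_loc[of p G k]) (auto simp: e band_def stops_def)
      have s: "0 < L * base powi k" using L by simp
      show ?thesis
      proof (cases "l = 0")
        case True
        have "emeasure nu (X i) \<le> 1 * emeasure nu (big p)" by (simp, intro emeasure_mono) (auto simp: X_def e)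
        also have "\<dots> \<le> ennreal c * emeasure nu (big p)" using c by (intro mult_right_mono) auto
        finally show ?thesis using True e by simp
      next
        case False
        then have m: "base ^ (l - 1) * base powi k < mass p" using i by (auto simp: band_def e)
        have bl: "base ^ l = base * base ^ (l - 1)" using False by (cases l) auto
        have "L * base powi k / mass p \<le> L * base powi k / (base ^ (l - 1) * base powi k)"
          using m s base_gt_1 mass_pos[OF p] by (intro divide_left_mono) auto
        also have "\<dots> = L * base / base ^ l"
          using base_gt_1 base_powi_pos[of k] by (simp add: bl)
        finally have "(L * base powi k / mass p) powr (1 + ep) \<le> (L * base / base ^ l) powr (1 + ep)"
          using constants_pos L mass_pos[OF p] by (intro powr_mono2) auto
        also have "\<dots> = (L * base) powr (1 + ep) / (base ^ l) powr (1 + ep)"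
          using base_gt_1 L by (simp add: powr_divide)
        also have "\<dots> = (L * base) powr (1 + ep) * (r / base) ^ l"
        proof -
          have "r / base = base powr (- (1 + ep))"
            using base_gt_1 by (simp add: r_def powr_diff powr_minus divide_simps)
          moreover have "(base powr (- (1 + ep))) ^ l = 1 / (base ^ l) powr (1 + ep)"
          proof -
            have "real l * (- 1 - ep) = - (real l * (1 + ep))" by (simp add: algebra_simps)
            then show ?thesis
              using base_gt_1 by (simp add: powr_power powr_minus[symmetric] powr_realpow[symmetric] powr_powr divide_inverse ac_simps del: powr_minus)
          qed
          ultimately show ?thesis by simp
        qed
        finally have "K2 * (L * base powi k / mass p) powr (1 + ep) \<le> K2 * ((L * base) powr (1 + ep) * (r / base) ^ l)"
          using constants_pos by simp
        also have "\<dots> \<le> c * (r / base) ^ l"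
          using r base_gt_1 unfolding c_def by (simp add: algebra_simps)
        finally have "ennreal (K2 * (L * base powi k / mass p) powr (1 + ep)) \<le> ennreal (c * (r / base) ^ l)"
          by (rule ennreal_leI)
        then have "ennreal (K2 * (L * base powi k / mass p) powr (1 + ep)) * emeasure nu (big p) \<le> ennreal (c * (r / base) ^ l) * emeasure nu (big p)"
          by (rule mult_right_mono) simp
        then show ?thesis using nu_level_le[OF p s] unfolding X_def e by simp
      qed
    qed
    have lev: "emeasure nu (\<Union>i\<in>band G l. X i) \<le> ennreal (c * K3 * K1 * r ^ l) * ?I" for l
    proof -
      have "emeasure nu (\<Union>i\<in>band G l. X i) \<le> (\<integral>\<^sup>+i. emeasure nu (X i) \<partial>count_space (band G l))"
        using cb by (intro emeasure_UN_le_nn_integral) auto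
      also have "\<dots> \<le> (\<integral>\<^sup>+i. ennreal (c * (r / base) ^ l) * emeasure nu (big (snd i)) \<partial>count_space (band G l))"
        by (intro nn_integral_mono) (use one in auto)
      also have "\<dots> = ennreal (c * (r / base) ^ l) * (\<integral>\<^sup>+i. emeasure nu (big (snd i)) \<partial>count_space (band G l))"
        by (intro nn_integral_cmult) auto
      also have "\<dots> \<le> ennreal (c * (r / base) ^ l) * (ennreal (K3 * base ^ l * K1) * ?I)"
      proof (intro mult_left_mono packing G)
        show "0 \<le> base ^ l" using base_gt_1 by simp
        show "band G l \<subseteq> stops G" by (auto simp: band_def)
        fix k p assume kp: "(k, p) \<in> band G l"
        then have p: "loc p" by (intro stopping_loc[of p G k]) (auto simp: band_def stops_def)
        obtain m n where mn: "0 < m" "0 < n" "emeasure mu (big p) = ennreal m" "emeasure nu (big p) = ennreal n" "mass p = n / m"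
          using loc_fin[OF p] .
        have "n / m \<le> base ^ l * base powi k" using kp mn by (auto simp: band_def)
        then have "n \<le> base ^ l * base powi k * m" using mn by (simp add: pos_divide_le_eq)
        then show "emeasure nu (big p) \<le> ennreal (base ^ l * base powi k) * emeasure mu (big p)"
          using mn base_gt_1 by (simp add: ennreal_mult[symmetric] ennreal_leI)
      qed simp
      also have "\<dots> = ennreal (c * (r / base) ^ l * (K3 * base ^ l * K1)) * ?I"
        using c r base_gt_1 K3_pos constants_pos by (simp add: ennreal_mult mult.assoc)
      also have "c * (r / base) ^ l * (K3 * base ^ l * K1) = c * K3 * K1 * r ^ l"
        using base_gt_1 by (simp add: power_divide)
      finally show ?thesis .
    qed
    have sums: "(\<lambda>l. c * K3 * K1 * r ^ l) sums C"
      using sums_mult[OF geometric_sums[of r], of "c * K3 * K1"] r by (simp add: C_def)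
    have "(\<Union>(k, p)\<in>stops G. {y \<in> big p. v y \<le> L * base powi k}) = (\<Union>l. \<Union>i\<in>band G l. X i)"
      unfolding UN_band X_def by (auto simp: case_prod_beta)
    then have "emeasure nu (\<Union>(k, p)\<in>stops G. {y \<in> big p. v y \<le> L * base powi k}) \<le> (\<Sum>l. emeasure nu (\<Union>i\<in>band G l. X i))"
      using cb by (simp only:) (intro emeasure_subadditive_countably, auto intro!: sets.countable_UN')
    also have "\<dots> \<le> (\<Sum>l. ennreal (c * K3 * K1 * r ^ l) * ?I)"
      by (intro suminf_le lev) auto
    also have "\<dots> = (\<Sum>l. ennreal (c * K3 * K1 * r ^ l)) * ?I" by simp
    also have "(\<Sum>l. ennreal (c * K3 * K1 * r ^ l)) = ennreal C"
      using c r K3_pos constants_pos by (intro suminf_ennreal_eq sums) auto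
    finally show ?thesis .
  qed
  ultimately show ?thesis by blast
qed

end

section \<open>Critical radius functions\<close>

locale critical =
  fixes \<rho> :: "'a::euclidean_space \<Rightarrow> real" and C N :: real
  assumes pos: "0 < \<rho> x" and C: "1 \<le> C" and N: "1 \<le> N"
    and lower: "inverse C * \<rho> x * (1 + norm (x - y) / \<rho> x) powr (- N) \<le> \<rho> y"
    and upper: "\<rho> y \<le> C * \<rho> x * (1 + norm (x - y) / \<rho> x) powr (N / (N + 1))"
begin

definition D :: real where "D = (2 * C) powr (N + 1)"

lemma D_ge_1: "1 \<le> D"
  unfolding D_def using C N by (intro ge_one_powr_ge_zero) auto

text \<open>
  A radius that is bounded by the growth of \<open>\<rho>\<close> over that same radius is at most a multiple
  of \<open>\<rho> x\<close>. This is where it matters that the exponent \<open>N / (N + 1)\<close> is less than 1.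
\<close>

lemma self_bound:
  assumes s: "0 \<le> s" and le: "s \<le> C * \<rho> x * (1 + s / \<rho> x) powr (N / (N + 1))"
  shows "s \<le> D * \<rho> x"
proof -
  define t where "t = 1 + s / \<rho> x"
  have t: "1 \<le> t" using s pos[of x] by (simp add: t_def)
  have st: "s / \<rho> x \<le> C * t powr (N / (N + 1))"
    using le pos[of x] unfolding t_def by (simp add: pos_divide_le_eq ac_simps)
  have "1 \<le> C * t powr (N / (N + 1))"
    using C t N ge_one_powr_ge_zero[of t "N / (N + 1)"] mult_mono[of 1 C 1 "t powr (N / (N + 1))"] by simp
  then have "t \<le> 2 * C * t powr (N / (N + 1))" using st by (simp add: t_def)
  moreover have "t = t powr (1 / (N + 1)) * t powr (N / (N + 1))"
    using t N by (simp add: powr_add[symmetric] add_divide_distrib[symmetric] add.commute)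
  moreover have "0 < t powr (N / (N + 1))" using t by simp
  ultimately have "t powr (1 / (N + 1)) \<le> 2 * C"
    by (metis mult_le_cancel_right_pos)
  then have "(t powr (1 / (N + 1))) powr (N + 1) \<le> (2 * C) powr (N + 1)"
    using N by (intro powr_mono2) auto
  then have "t \<le> D" using t N by (simp add: powr_powr D_def)
  then have "s / \<rho> x \<le> D" by (simp add: t_def)
  then show ?thesis using pos[of x] by (simp add: pos_divide_le_eq)
qed

lemma exponent_le: "t powr (N / (N + 1)) \<le> t" if "1 \<le> t"
  using that N powr_mono[of "N / (N + 1)" 1 t] by simp

lemma upper_linear: "\<rho> y \<le> C * (\<rho> x + norm (x - y))"
proof -
  have "1 \<le> 1 + norm (x - y) / \<rho> x" using pos[of x] by simp
  from exponent_le[OF this]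
  have "C * \<rho> x * (1 + norm (x - y) / \<rho> x) powr (N / (N + 1)) \<le> C * \<rho> x * (1 + norm (x - y) / \<rho> x)"
    using C pos[of x] by (intro mult_left_mono) auto
  also have "\<dots> = C * (\<rho> x + norm (x - y))" using pos[of x] by (simp add: field_simps)
  finally show ?thesis using upper[of y x] by simp
qed

lemma lower_powr:
  assumes "1 + norm (x - y) / \<rho> x \<le> t"
  shows "\<rho> x \<le> C * t powr N * \<rho> y"
proof -
  define s where "s = 1 + norm (x - y) / \<rho> x"
  have s: "1 \<le> s" using pos[of x] by (simp add: s_def)
  have "\<rho> x / (C * s powr N) \<le> \<rho> y"
    using lower[of x y] unfolding s_def[symmetric] by (simp add: powr_minus divide_inverse ac_simps)
  moreover have "0 < C * s powr N" using s C by simp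
  ultimately have "\<rho> x \<le> \<rho> y * (C * s powr N)" by (simp only: pos_divide_le_eq)
  also have "\<dots> \<le> \<rho> y * (C * t powr N)"
    using s assms C N pos[of y] by (intro mult_left_mono powr_mono2) (auto simp: s_def)
  finally show ?thesis by (simp add: ac_simps)
qed

text \<open>
  The radius of a local cell through \<open>x\<close> satisfies the hypothesis of \<open>self_bound\<close>.
\<close>

lemma local_levels_bounded:
  "\<exists>M. \<forall>n c. (n, c) \<in> cells \<and> x \<in> cell n c \<and> rad TYPE('a) n \<le> \<rho> c \<longrightarrow> n \<le> M"
proof (intro exI allI impI)
  fix n and c :: 'a
  assume a: "(n, c) \<in> cells \<and> x \<in> cell n c \<and> rad TYPE('a) n \<le> \<rho> c"
  let ?r = "rad TYPE('a) n"
  have r0: "0 \<le> ?r" using rad_pos[where 'a='a, of n] by linarith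
  have "x \<in> cube c ?r" using a cell_subset_cube by blast
  then have "norm (x - c) \<le> ?r" using norm_le_of_mem_cube[of x c ?r] r0 by (simp add: norm_minus_commute)
  then have "1 + norm (x - c) / \<rho> x \<le> 1 + ?r / \<rho> x" using pos[of x] by (simp add: divide_right_mono)
  then have "(1 + norm (x - c) / \<rho> x) powr (N / (N + 1)) \<le> (1 + ?r / \<rho> x) powr (N / (N + 1))"
    using N pos[of x] by (intro powr_mono2) (auto simp: add_nonneg_nonneg)
  then have "C * \<rho> x * (1 + norm (x - c) / \<rho> x) powr (N / (N + 1)) \<le> C * \<rho> x * (1 + ?r / \<rho> x) powr (N / (N + 1))"
    using C pos[of x] by (intro mult_left_mono) auto
  then have "?r \<le> C * \<rho> x * (1 + ?r / \<rho> x) powr (N / (N + 1))"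
    using a upper[of c x] by linarith
  from self_bound[OF r0 this] have "?r \<le> D * \<rho> x" .
  moreover have "2 powi n / 2 \<le> ?r"
    unfolding rad_def using mult_right_mono[of 1 "sqrt (real DIM('a))" "2 powi n"] by simp
  ultimately have "2 powi n \<le> 2 * (D * \<rho> x)" by linarith
  then have "2 powr real_of_int n \<le> 2 * (D * \<rho> x)" by (simp add: powr_real_of_int')
  then have "real_of_int n \<le> log 2 (2 * (D * \<rho> x))"
    using D_ge_1 pos[of x] by (subst le_log_iff) auto
  then show "n \<le> \<lfloor>log 2 (2 * (D * \<rho> x))\<rfloor>" by (simp add: le_floor_iff)
qed

text \<open>
  A critical radius function need not be measurable. This comparable function is lower semicontinuous,
  because its superlevel sets are unions of balls; it takes the place of \<open>\<rho>\<close> in the kernel below so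
  that Fubini's theorem applies.
\<close>

definition smooth :: "'a \<Rightarrow> real" where
  "smooth y = Sup {\<rho> z |z. norm (y - z) < \<rho> z}"

lemma radius_near_le:
  assumes "norm (y - z) < \<rho> z"
  shows "\<rho> z \<le> D * \<rho> y"
proof (rule self_bound)
  have "(1 + norm (y - z) / \<rho> y) powr (N / (N + 1)) \<le> (1 + \<rho> z / \<rho> y) powr (N / (N + 1))"
    using N pos[of y] assms by (intro powr_mono2) (auto simp: add_nonneg_nonneg divide_right_mono)
  then have "C * \<rho> y * (1 + norm (y - z) / \<rho> y) powr (N / (N + 1)) \<le> C * \<rho> y * (1 + \<rho> z / \<rho> y) powr (N / (N + 1))"
    using C pos[of y] by (intro mult_left_mono) auto
  then show "\<rho> z \<le> C * \<rho> y * (1 + \<rho> z / \<rho> y) powr (N / (N + 1))"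
    using upper[of z y] by linarith
qed (use pos[of z] in simp)

lemma smooth_bdd: "bdd_above {\<rho> z |z. norm (y - z) < \<rho> z}"
  using radius_near_le by (intro bdd_aboveI[of _ "D * \<rho> y"]) auto

lemma smooth_ge: "\<rho> y \<le> smooth y"
  unfolding smooth_def using pos[of y] by (intro cSup_upper smooth_bdd) auto

lemma smooth_le: "smooth y \<le> D * \<rho> y"
proof -
  have "\<rho> y \<in> {\<rho> z |z. norm (y - z) < \<rho> z}" using pos[of y] by auto
  then show ?thesis unfolding smooth_def using radius_near_le by (intro cSup_least) auto
qed

lemma smooth_pos: "0 < smooth y"
  using smooth_ge[of y] pos[of y] by linarith

lemma smooth_measurable [measurable]: "smooth \<in> borel_measurable borel"
proof (rule borel_measurableI_greater)
  fix t
  have ne: "{\<rho> z |z. norm (y - z) < \<rho> z} \<noteq> {}" for y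
    using pos[of y] by (auto intro!: exI[of _ y])
  have "{y. t < smooth y} = (\<Union>z\<in>{z. t < \<rho> z}. ball z (\<rho> z))"
  proof (intro set_eqI iffI)
    fix y assume "y \<in> {y. t < smooth y}"
    then have "\<exists>s\<in>{\<rho> z |z. norm (y - z) < \<rho> z}. t < s"
      unfolding smooth_def by (simp add: less_cSup_iff[OF ne smooth_bdd])
    then show "y \<in> (\<Union>z\<in>{z. t < \<rho> z}. ball z (\<rho> z))" by (auto simp: dist_norm norm_minus_commute)
  next
    fix y assume "y \<in> (\<Union>z\<in>{z. t < \<rho> z}. ball z (\<rho> z))"
    then obtain z where "t < \<rho> z" "norm (y - z) < \<rho> z" by (auto simp: dist_norm norm_minus_commute)
    then have "t < smooth y" unfolding smooth_def less_cSup_iff[OF ne smooth_bdd] by blast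
    then show "y \<in> {y. t < smooth y}" by simp
  qed
  then have "open {y. t < smooth y}" by auto
  then show "{y \<in> space borel. t < smooth y} \<in> sets borel" by simp
qed

section \<open>A potential that controls the large cubes\<close>

text \<open>
  The critical radius is taken at the variable \<open>y\<close> of integration. Then the adjoint operator integrates
  over cubes about a fixed point \<open>y\<close> with a fixed scale, which suits the \<open>A_1\<close> condition.
\<close>

definition kern :: "real \<Rightarrow> 'a \<Rightarrow> 'a \<Rightarrow> real" where
  "kern s x y = (1 / smooth y) ^ DIM('a) * (1 + norm (x - y) / smooth y) powr (- s)"

definition pot :: "real \<Rightarrow> ('a \<Rightarrow> ennreal) \<Rightarrow> 'a \<Rightarrow> ennreal" where
  "pot s G x = (\<integral>\<^sup>+y. ennreal (kern s x y) * G y \<partial>lebesgue)"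

lemma kern_nonneg: "0 \<le> kern s x y"
  using smooth_pos[of y] by (simp add: kern_def)

lemma id_lebesgue_borel: "(\<lambda>x::'a. x) \<in> measurable lebesgue borel"
  using id_borel_measurable_lebesgue by (simp add: id_def)

lemma kern_measurable [measurable]:
  "(\<lambda>(x, y). kern s x y) \<in> borel_measurable (lebesgue \<Otimes>\<^sub>M lebesgue)"
proof -
  have "(\<lambda>(x, y). kern s x y) \<in> borel_measurable (borel \<Otimes>\<^sub>M borel)"
    unfolding kern_def by measurable
  moreover have "(\<lambda>p :: 'a \<times> 'a. p) \<in> measurable (lebesgue \<Otimes>\<^sub>M lebesgue) (borel \<Otimes>\<^sub>M borel)"
  proof -
    have "(\<lambda>p :: 'a \<times> 'a. (fst p, snd p)) \<in> measurable (lebesgue \<Otimes>\<^sub>M lebesgue) (borel \<Otimes>\<^sub>M borel)"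
      by (intro measurable_Pair measurable_compose[OF measurable_fst id_lebesgue_borel] measurable_compose[OF measurable_snd id_lebesgue_borel])
    then show ?thesis by simp
  qed
  ultimately show ?thesis using measurable_compose by blast
qed

lemma kern_measurable_snd [measurable]: "(\<lambda>y. kern s x y) \<in> borel_measurable lebesgue"
proof -
  have "(\<lambda>y. (x, y)) \<in> measurable lebesgue (lebesgue \<Otimes>\<^sub>M lebesgue)" by (rule measurable_Pair1') simp
  from measurable_compose[OF this kern_measurable] show ?thesis by simp
qed

text \<open>
  The damping exponent at which every large cube is dominated by the kernel of order \<open>s\<close>: one power of
  the relative radius for each dimension, and \<open>N + 1\<close> powers for each order of decay of the kernel.
\<close>

definition decay :: "real \<Rightarrow> real" where "decay s = real DIM('a) + s * (N + 1)"

text \<open>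
  Both arguments lie within \<open>6 r\<close> of each other. With \<open>t = 1 + r / \<rho> x0\<close> the growth of \<open>\<rho>\<close> gives
  \<open>smooth y \<lesssim> t r\<close>, and its slow decay gives \<open>r / smooth y \<lesssim> t powr (N + 1)\<close>.
\<close>

lemma kern_lower:
  assumes eta: "0 < \<eta>" "\<eta> * \<rho> x0 \<le> r" and r: "0 < r" and s: "0 \<le> s"
    and y: "y \<in> cube x0 r" and x: "x \<in> cube x0 (5 * r)"
  shows "(\<eta> / (D * C)) ^ DIM('a) * (7 * C) powr (- s) * ((1 + r / \<rho> x0) powr (- decay s) * (1 / r) ^ DIM('a)) \<le> kern s x y"
proof -
  define t where "t = 1 + r / \<rho> x0"
  have t: "1 \<le> t" using r pos[of x0] by (simp add: t_def less_imp_le)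
  have DC: "0 < D * C" using D_ge_1 C by simp
  have ny: "norm (x0 - y) \<le> r" using norm_le_of_mem_cube[OF y] r by simp
  have nx: "norm (x0 - x) \<le> 5 * r" using norm_le_of_mem_cube[OF x] r by simp
  have "norm (x - y) = norm ((x0 - y) - (x0 - x))" by simp
  also have "\<dots> \<le> norm (x0 - y) + norm (x0 - x)" by (rule norm_triangle_ineq4)
  finally have nxy: "norm (x - y) \<le> 6 * r" using ny nx by simp
  have tr: "t * \<rho> x0 = \<rho> x0 + r" using pos[of x0] by (simp add: t_def field_simps)
  have "smooth y \<le> D * (C * (\<rho> x0 + norm (x0 - y)))"
    using smooth_le[of y] upper_linear[of y x0] D_ge_1 mult_left_mono[of "\<rho> y" "C * (\<rho> x0 + norm (x0 - y))" D] by linarith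
  also have "\<dots> \<le> D * (C * (t * \<rho> x0))" using ny D_ge_1 C unfolding tr by (intro mult_left_mono) auto
  also have "\<dots> \<le> D * (C * (t * (r / \<eta>)))"
    using eta D_ge_1 C t by (intro mult_left_mono) (auto simp: pos_le_divide_eq ac_simps)
  finally have up: "smooth y \<le> D * C * t * r / \<eta>" by (simp add: ac_simps)
  have "\<eta> / (D * C) * (1 / t) * (1 / r) = 1 / (D * C * t * r / \<eta>)" using eta by simp
  also have "\<dots> \<le> 1 / smooth y" using up smooth_pos[of y] by (intro divide_left_mono mult_pos_pos) auto
  finally have "(\<eta> / (D * C) * (1 / t) * (1 / r)) ^ DIM('a) \<le> (1 / smooth y) ^ DIM('a)"
    using eta DC t r by (intro power_mono) auto
  then have A: "(\<eta> / (D * C)) ^ DIM('a) * (t powr (- real DIM('a)) * (1 / r) ^ DIM('a)) \<le> (1 / smooth y) ^ DIM('a)"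
    using t by (simp add: power_mult_distrib powr_minus powr_realpow power_divide divide_inverse power_inverse ac_simps)
  have "1 + norm (x0 - y) / \<rho> x0 \<le> t" using ny pos[of x0] by (simp add: t_def divide_right_mono)
  from lower_powr[OF this] have "\<rho> x0 \<le> C * t powr N * smooth y"
    using mult_left_mono[OF smooth_ge[of y], of "C * t powr N"] C by (simp add: order.trans)
  then have "1 / smooth y \<le> C * t powr N / \<rho> x0"
    using smooth_pos[of y] pos[of x0] by (simp add: field_simps)
  then have "norm (x - y) * (1 / smooth y) \<le> 6 * r * (C * t powr N / \<rho> x0)"
    using nxy smooth_pos[of y] r by (intro mult_mono) auto
  also have "\<dots> = 6 * C * t powr N * (r / \<rho> x0)" by simp
  also have "\<dots> \<le> 6 * C * t powr N * t" using C t by (intro mult_left_mono) (auto simp: t_def)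
  also have "\<dots> = 6 * C * t powr (N + 1)" using t by (simp add: powr_add)
  finally have "norm (x - y) / smooth y \<le> 6 * C * t powr (N + 1)" by simp
  moreover have "1 \<le> C * t powr (N + 1)"
    using C t N ge_one_powr_ge_zero[of t "N + 1"] mult_mono[of 1 C 1 "t powr (N + 1)"] by simp
  ultimately have "1 + norm (x - y) / smooth y \<le> 7 * C * t powr (N + 1)" by linarith
  then have "(7 * C * t powr (N + 1)) powr (- s) \<le> (1 + norm (x - y) / smooth y) powr (- s)"
    using s smooth_pos[of y] by (intro powr_mono2') (auto simp: add_pos_nonneg)
  then have B: "(7 * C) powr (- s) * t powr (- s * (N + 1)) \<le> (1 + norm (x - y) / smooth y) powr (- s)"
    using C t by (simp add: powr_mult powr_powr ac_simps)
  have "(\<eta> / (D * C)) ^ DIM('a) * (t powr (- real DIM('a)) * (1 / r) ^ DIM('a)) * ((7 * C) powr (- s) * t powr (- s * (N + 1))) \<le> kern s x y"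
    unfolding kern_def using eta DC r smooth_pos[of y] by (intro mult_mono A B) auto
  moreover have "t powr (- decay s) = t powr (- real DIM('a)) * t powr (- s * (N + 1))"
    by (simp add: decay_def powr_add[symmetric])
  ultimately show ?thesis unfolding t_def[symmetric] by (simp add: ac_simps)
qed

lemma large_cube_le_pot:
  assumes eta: "0 < \<eta>" and s: "0 \<le> s"
  shows "\<exists>B>0. \<forall>G x0 r x. G \<in> borel_measurable lebesgue \<longrightarrow> 0 < r \<longrightarrow> \<eta> * \<rho> x0 \<le> r \<longrightarrow> x \<in> cube x0 (5 * r) \<longrightarrow>
    ennreal ((1 + r / \<rho> x0) powr (- decay s)) * ((\<integral>\<^sup>+y\<in>cube x0 r. G y \<partial>lebesgue) / emeasure lebesgue (cube x0 r))
      \<le> ennreal B * pot s G x"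
proof -
  define c where "c = (\<eta> / (D * C)) ^ DIM('a) * (7 * C) powr (- s)"
  have c: "0 < c" using eta D_ge_1 C by (simp add: c_def)
  define B where "B = (sqrt (real DIM('a)) / 2) ^ DIM('a) / c"
  have B: "0 < B" using c by (simp add: B_def)
  have "ennreal ((1 + r / \<rho> x0) powr (- decay s)) * ((\<integral>\<^sup>+y\<in>cube x0 r. G y \<partial>lebesgue) / emeasure lebesgue (cube x0 r))
      \<le> ennreal B * pot s G x"
    if G [measurable]: "G \<in> borel_measurable lebesgue" and r: "0 < r" "\<eta> * \<rho> x0 \<le> r" and x: "x \<in> cube x0 (5 * r)" for G x0 r x
  proof -
    let ?t = "(1 + r / \<rho> x0) powr (- decay s)" and ?V = "(2 * r / sqrt (real DIM('a))) ^ DIM('a)"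
    have V: "0 < ?V" using r by simp
    have e: "?t / ?V = B * (c * (?t * (1 / r) ^ DIM('a)))"
      using c r by (simp add: B_def power_divide power_mult_distrib)
    have "ennreal ?t * ((\<integral>\<^sup>+y\<in>cube x0 r. G y \<partial>lebesgue) / emeasure lebesgue (cube x0 r)) = ennreal (?t / ?V) * (\<integral>\<^sup>+y\<in>cube x0 r. G y \<partial>lebesgue)"
    proof -
      have "ennreal (?t / ?V) = ennreal ?t / ennreal ?V" using V by (simp add: divide_ennreal)
      then show ?thesis
        using emeasure_cube[of r x0] r by (simp only: less_imp_le ennreal_times_divide ennreal_divide_times)
    qed
    also have "\<dots> = (\<integral>\<^sup>+y. ennreal (?t / ?V) * (G y * indicator (cube x0 r) y) \<partial>lebesgue)"
      by (intro nn_integral_cmult[symmetric]) measurable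
    also have "\<dots> \<le> (\<integral>\<^sup>+y. ennreal B * (ennreal (kern s x y) * G y) \<partial>lebesgue)"
    proof (intro nn_integral_mono)
      fix y
      show "ennreal (?t / ?V) * (G y * indicator (cube x0 r) y) \<le> ennreal B * (ennreal (kern s x y) * G y)"
      proof (cases "y \<in> cube x0 r")
        case True
        have "c * (?t * (1 / r) ^ DIM('a)) \<le> kern s x y"
          unfolding c_def by (rule kern_lower[OF eta r(2,1) s True x])
        then have "?t / ?V \<le> B * kern s x y" unfolding e using B by (intro mult_left_mono) auto
        then have "ennreal (?t / ?V) * G y \<le> ennreal (B * kern s x y) * G y"
          by (intro mult_right_mono ennreal_leI) auto
        then show ?thesis using True B kern_nonneg by (simp add: ennreal_mult mult.assoc)
      qed simp
    qed
    also have "\<dots> = ennreal B * pot s G x"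
      unfolding pot_def by (intro nn_integral_cmult) measurable
    finally show ?thesis .
  qed
  then show ?thesis using B by blast
qed

text \<open>
  The exceptional null set in the \<open>A_1\<close> condition depends on the cube. The countably many cubes with
  rational radii and centres in a countable dense set have a common null set, and every cube is
  contained in such a cube of at most twice the radius whose centre is so close that the critical radii
  are comparable.
\<close>

lemma A1_uniform:
  assumes K: "0 < K" and th: "0 \<le> \<theta>" and sets: "sets \<mu> = sets lebesgue"
    and le: "\<And>x r. 0 < r \<Longrightarrow> AE y in lebesgue. y \<in> cube x r \<longrightarrow>
      emeasure \<mu> (cube x r) \<le> ennreal (K * (1 + r / \<rho> x) powr \<theta> * r ^ DIM('a)) * U y"
  shows "\<exists>K'>0. AE y in lebesgue. \<forall>x r. 0 < r \<longrightarrow> y \<in> cube x r \<longrightarrow>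
      emeasure \<mu> (cube x r) \<le> ennreal (K' * (1 + r / \<rho> x) powr \<theta> * r ^ DIM('a)) * U y"
proof -
  obtain Q :: "'a set" where Q: "countable Q" "\<And>X. open X \<Longrightarrow> X \<noteq> {} \<Longrightarrow> \<exists>q\<in>Q. q \<in> X"
    using countable_dense_exists by (metis (no_types))
  define E where "E = 2 * (C * 2 powr N)"
  have E: "2 \<le> E"
  proof -
    have "1 * 1 \<le> C * 2 powr N" using C N by (intro mult_mono ge_one_powr_ge_zero) auto
    then show ?thesis by (simp add: E_def)
  qed
  define K' where "K' = K * E powr \<theta> * 2 ^ DIM('a)"
  have "0 < K'" using K E by (simp add: K'_def)
  moreover have "AE y in lebesgue. \<forall>x r. 0 < r \<longrightarrow> y \<in> cube x r \<longrightarrow>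
      emeasure \<mu> (cube x r) \<le> ennreal (K' * (1 + r / \<rho> x) powr \<theta> * r ^ DIM('a)) * U y"
  proof -
    have "AE y in lebesgue. \<forall>q\<in>Q. \<forall>s\<in>\<rat>. 0 < s \<longrightarrow> y \<in> cube q s \<longrightarrow>
      emeasure \<mu> (cube q s) \<le> ennreal (K * (1 + s / \<rho> q) powr \<theta> * s ^ DIM('a)) * U y"
    proof (intro AE_ball_countable[THEN iffD2] ballI Q(1) countable_rat)
      fix q and s :: real
      show "AE y in lebesgue. 0 < s \<longrightarrow> y \<in> cube q s \<longrightarrow>
        emeasure \<mu> (cube q s) \<le> ennreal (K * (1 + s / \<rho> q) powr \<theta> * s ^ DIM('a)) * U y"
        by (cases "0 < s") (use le[of s q] in auto)
    qed
    then show ?thesis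
    proof (eventually_elim, intro allI impI)
      fix y x and r :: real
      assume ae: "\<forall>q\<in>Q. \<forall>s\<in>\<rat>. 0 < s \<longrightarrow> y \<in> cube q s \<longrightarrow>
          emeasure \<mu> (cube q s) \<le> ennreal (K * (1 + s / \<rho> q) powr \<theta> * s ^ DIM('a)) * U y"
        and r: "0 < r" and y: "y \<in> cube x r"
      let ?sd = "sqrt (real DIM('a))"
      obtain s where s: "s \<in> \<rat>" "3 / 2 * r < s" "s < 2 * r"
        using Rats_dense_in_real[of "3 / 2 * r" "2 * r"] r by auto
      have "0 < min (r / (2 * ?sd)) (\<rho> x)" using r pos[of x] by simp
      then obtain q where q: "q \<in> Q" "q \<in> ball x (min (r / (2 * ?sd)) (\<rho> x))"
        using Q(2)[OF open_ball, of x "min (r / (2 * ?sd)) (\<rho> x)"] by (metis centre_in_ball emptyE)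
      then have nq: "norm (x - q) < r / (2 * ?sd)" "norm (x - q) < \<rho> x" by (auto simp: dist_norm)
      have sub: "cube x r \<subseteq> cube q s"
      proof
        fix z assume z: "z \<in> cube x r"
        have "\<bar>z \<bullet> b - q \<bullet> b\<bar> \<le> s / ?sd" if b: "b \<in> Basis" for b
        proof -
          have "\<bar>z \<bullet> b - x \<bullet> b\<bar> \<le> r / ?sd" using z b by (auto simp: mem_cube)
          moreover have "\<bar>(x - q) \<bullet> b\<bar> \<le> norm (x - q)" by (rule Basis_le_norm[OF b])
          ultimately have "\<bar>z \<bullet> b - q \<bullet> b\<bar> \<le> r / ?sd + r / (2 * ?sd)" using nq by (simp add: inner_diff_left)
          also have "\<dots> = (3 / 2 * r) / ?sd" by (simp add: field_simps)
          also have "\<dots> \<le> s / ?sd" using s by (intro divide_right_mono) auto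
          finally show ?thesis .
        qed
        then show "z \<in> cube q s" by (simp add: mem_cube)
      qed
      have "1 + norm (x - q) / \<rho> x \<le> 2" using nq pos[of x] by simp
      from lower_powr[OF this] have "\<rho> x \<le> C * 2 powr N * \<rho> q" .
      then have "\<rho> x * 2 \<le> E * \<rho> q" by (simp add: E_def)
      then have "2 / \<rho> q \<le> E / \<rho> x" using pos[of x] pos[of q] by (simp add: field_simps)
      then have "r * (2 / \<rho> q) \<le> r * (E / \<rho> x)" using r by (intro mult_left_mono) auto
      moreover have "s / \<rho> q \<le> r * (2 / \<rho> q)" using s pos[of q] by (simp add: divide_right_mono)
      ultimately have "1 + s / \<rho> q \<le> E * (1 + r / \<rho> x)" using E by (simp add: algebra_simps)
      then have "(1 + s / \<rho> q) powr \<theta> \<le> (E * (1 + r / \<rho> x)) powr \<theta>"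
        using th s r pos[of q] by (intro powr_mono2) (auto simp: add_nonneg_nonneg)
      also have "\<dots> = E powr \<theta> * (1 + r / \<rho> x) powr \<theta>"
        by (rule powr_mult)
      finally have 1: "(1 + s / \<rho> q) powr \<theta> \<le> E powr \<theta> * (1 + r / \<rho> x) powr \<theta>" .
      have 2: "s ^ DIM('a) \<le> 2 ^ DIM('a) * r ^ DIM('a)"
        using s r power_mono[of s "2 * r" "DIM('a)"] by (simp add: power_mult_distrib)
      have "K * (1 + s / \<rho> q) powr \<theta> * s ^ DIM('a) \<le> K * (E powr \<theta> * (1 + r / \<rho> x) powr \<theta>) * (2 ^ DIM('a) * r ^ DIM('a))"
        using K s r by (intro mult_mono 1 2) auto
      also have "\<dots> = K' * (1 + r / \<rho> x) powr \<theta> * r ^ DIM('a)" by (simp add: K'_def)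
      finally have KK: "K * (1 + s / \<rho> q) powr \<theta> * s ^ DIM('a) \<le> K' * (1 + r / \<rho> x) powr \<theta> * r ^ DIM('a)" .
      have "emeasure \<mu> (cube x r) \<le> emeasure \<mu> (cube q s)" using sub sets by (intro emeasure_mono) auto
      also have "\<dots> \<le> ennreal (K * (1 + s / \<rho> q) powr \<theta> * s ^ DIM('a)) * U y"
        using ae q s r y sub by auto
      also have "\<dots> \<le> ennreal (K' * (1 + r / \<rho> x) powr \<theta> * r ^ DIM('a)) * U y"
        using KK by (intro mult_right_mono ennreal_leI) auto
      finally show "emeasure \<mu> (cube x r) \<le> ennreal (K' * (1 + r / \<rho> x) powr \<theta> * r ^ DIM('a)) * U y" .
    qed
  qed
  ultimately show ?thesis by blast
qed

lemma term_le_suminf: "f i \<le> (\<Sum>i. f i)" for f :: "nat \<Rightarrow> ennreal"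
  using sum_le_suminf[of f "{i}"] by simp

text \<open>
  The kernel is dominated by a superposition of cubes about \<open>y\<close> with half side \<open>2 ^ i * smooth y\<close>: a point at
  distance about \<open>2 ^ i * smooth y\<close> is only charged the value of the kernel there.
\<close>

lemma kern_annuli:
  assumes s: "0 < s"
  shows "ennreal (kern s x y) \<le> (\<Sum>i. ennreal ((1 / smooth y) ^ DIM('a) * (2 powr s * (2 powr (- s)) ^ i))
     * indicator (cube y (sqrt (real DIM('a)) * (2 ^ i * smooth y))) x)"
    (is "_ \<le> (\<Sum>i. ?f i)")
proof -
  let ?P = "\<lambda>i::nat. norm (x - y) \<le> 2 ^ i * smooth y"
  obtain n where "norm (x - y) / smooth y < 2 ^ n" using real_arch_pow[of 2] by auto
  then have ex: "?P n" using smooth_pos[of y] by (simp add: pos_divide_less_eq less_imp_le)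
  define i where "i = (LEAST i. ?P i)"
  have Pi: "?P i" unfolding i_def using ex by (rule LeastI)
  have mem: "x \<in> cube y (sqrt (real DIM('a)) * (2 ^ i * smooth y))"
    using Pi cball_subset_cube[of y "sqrt (real DIM('a)) * (2 ^ i * smooth y)"] by (auto simp: dist_norm norm_minus_commute)
  have "(1 + norm (x - y) / smooth y) powr (- s) \<le> 2 powr s * (2 powr (- s)) ^ i"
  proof (cases i)
    case 0
    have "(1 + norm (x - y) / smooth y) powr (- s) \<le> 1 powr (- s)"
      using s smooth_pos[of y] by (intro powr_mono2') auto
    also have "\<dots> \<le> 2 powr s" using s by (simp add: ge_one_powr_ge_zero)
    finally show ?thesis using 0 by simp
  next
    case (Suc j)
    then have "\<not> ?P j" using not_less_Least[of j ?P] by (simp add: i_def)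
    then have "2 ^ j \<le> norm (x - y) / smooth y" using smooth_pos[of y] by (simp add: pos_le_divide_eq)
    then have "2 ^ j \<le> 1 + norm (x - y) / smooth y" by simp
    then have "(1 + norm (x - y) / smooth y) powr (- s) \<le> (2 ^ j) powr (- s)"
      using s by (intro powr_mono2') auto
    also have "\<dots> = (2 powr (- s)) ^ j" by (simp add: powr_realpow[symmetric] powr_powr powr_power ac_simps)
    also have "\<dots> = 2 powr s * (2 powr (- s)) ^ i" by (simp add: Suc powr_add[symmetric] mult.assoc[symmetric])
    finally show ?thesis .
  qed
  then have "kern s x y \<le> (1 / smooth y) ^ DIM('a) * (2 powr s * (2 powr (- s)) ^ i)"
    unfolding kern_def using smooth_pos[of y] by (intro mult_left_mono) auto
  then have "ennreal (kern s x y) \<le> ?f i" using mem by (simp add: ennreal_leI)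
  also have "\<dots> \<le> (\<Sum>i. ?f i)" by (rule term_le_suminf)
  finally show ?thesis .
qed

text \<open>
  Each cube in \<open>kern_annuli\<close> is estimated by the \<open>A_1\<close> condition, at the cost of \<open>2\<^sup>i\<^sup>d\<close> for
  the volume and \<open>2\<^sup>i\<^sup>\<theta>\<close> for the size relative to \<open>\<rho> y\<close>. The order \<open>s\<close> exceeds \<open>d + \<theta>\<close> by one, which
  leaves the factor \<open>2\<^sup>-\<^sup>i\<close>.
\<close>

lemma kern_adjoint_bound:
  assumes U [measurable]: "U \<in> borel_measurable lebesgue" and K: "0 < K" and th: "0 \<le> \<theta>"
    and A1: "AE y in lebesgue. \<forall>x r. 0 < r \<longrightarrow> y \<in> cube x r \<longrightarrow>
      emeasure (density lebesgue U) (cube x r) \<le> ennreal (K * (1 + r / \<rho> x) powr \<theta> * r ^ DIM('a)) * U y"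
    and s: "s = real DIM('a) + \<theta> + 1"
  shows "\<exists>B>0. AE y in lebesgue. (\<integral>\<^sup>+x. ennreal (kern s x y) * U x \<partial>lebesgue) \<le> ennreal B * U y"
proof -
  let ?sd = "sqrt (real DIM('a))"
  have sd: "1 \<le> ?sd" by (simp add: Suc_leI)
  have s0: "0 < s" using s th by simp
  define A where "A = K * 2 powr s * (2 * (?sd * D)) powr \<theta> * ?sd ^ DIM('a)"
  have A: "0 < A" using K D_ge_1 sd by (simp add: A_def)
  have "AE y in lebesgue. (\<integral>\<^sup>+x. ennreal (kern s x y) * U x \<partial>lebesgue) \<le> ennreal (A * 2) * U y"
    using A1
  proof eventually_elim
    case (elim y)
    define R where "R = smooth y"
    have R: "0 < R" using smooth_pos by (simp add: R_def)
    define Q where "Q i = cube y (?sd * (2 ^ i * R))" for i :: nat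
    have Qm [measurable]: "Q i \<in> sets lebesgue" for i unfolding Q_def by (rule cube_measurable)
    let ?c = "\<lambda>i. (1 / R) ^ DIM('a) * (2 powr s * (2 powr (- s)) ^ i)"
    have one: "ennreal (?c i) * emeasure (density lebesgue U) (Q i) \<le> ennreal (A * (1 / 2) ^ i) * U y" for i
    proof -
      let ?r = "?sd * (2 ^ i * R)"
      have r: "0 < ?r" using R sd by simp
      have yQ: "y \<in> cube y ?r" using R by (simp add: mem_cube)
      have "?sd * 2 ^ i * (R / \<rho> y) \<le> ?sd * 2 ^ i * D"
        using smooth_le[of y] pos[of y] by (intro mult_left_mono) (auto simp: R_def pos_divide_le_eq)
      moreover have "1 \<le> ?sd * 2 ^ i * D"
      proof -
        have "1 * 1 * 1 \<le> ?sd * 2 ^ i * D" using sd D_ge_1 by (intro mult_mono) auto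
        then show ?thesis by simp
      qed
      ultimately have "1 + ?r / \<rho> y \<le> 2 * (?sd * D) * 2 ^ i" by (simp add: ac_simps)
      then have "(1 + ?r / \<rho> y) powr \<theta> \<le> (2 * (?sd * D) * 2 ^ i) powr \<theta>"
        using th r pos[of y] by (intro powr_mono2) (auto simp: add_nonneg_nonneg)
      also have "\<dots> = (2 * (?sd * D)) powr \<theta> * (2 powr \<theta>) ^ i"
        using sd D_ge_1 by (subst powr_mult) (auto simp: powr_realpow[symmetric] powr_powr powr_power ac_simps)
      finally have th_le: "(1 + ?r / \<rho> y) powr \<theta> \<le> (2 * (?sd * D)) powr \<theta> * (2 powr \<theta>) ^ i" .
      have "?c i * (K * (1 + ?r / \<rho> y) powr \<theta> * ?r ^ DIM('a)) \<le> ?c i * (K * ((2 * (?sd * D)) powr \<theta> * (2 powr \<theta>) ^ i) * ?r ^ DIM('a))"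
        using K R r by (intro mult_left_mono mult_right_mono th_le) auto
      also have "\<dots> = A * ((2 powr (- s)) ^ i * (2 powr \<theta>) ^ i * (2 ^ i) ^ DIM('a))"
        using R by (simp add: A_def power_mult_distrib power_divide)
      also have "(2 powr (- s)) ^ i * (2 powr \<theta>) ^ i * (2 ^ i) ^ DIM('a) = (2 powr (- s) * 2 powr \<theta> * 2 powr (real DIM('a))) ^ i"
        by (simp add: power_mult_distrib powr_realpow power_mult[symmetric] mult.commute)
      also have "2 powr (- s) * 2 powr \<theta> * 2 powr (real DIM('a)) = 2 powr (-1)"
        unfolding powr_add[symmetric] s by simp
      also have "\<dots> = 1 / (2::real)" by (simp add: powr_minus_divide)
      finally have le: "?c i * (K * (1 + ?r / \<rho> y) powr \<theta> * ?r ^ DIM('a)) \<le> A * (1 / 2) ^ i" .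
      have "ennreal (?c i) * emeasure (density lebesgue U) (Q i) \<le> ennreal (?c i) * (ennreal (K * (1 + ?r / \<rho> y) powr \<theta> * ?r ^ DIM('a)) * U y)"
        unfolding Q_def using elim r yQ by (intro mult_left_mono) auto
      also have "\<dots> = ennreal (?c i * (K * (1 + ?r / \<rho> y) powr \<theta> * ?r ^ DIM('a))) * U y"
        using R by (subst ennreal_mult') (auto simp: mult.assoc)
      also have "\<dots> \<le> ennreal (A * (1 / 2) ^ i) * U y" by (intro mult_right_mono ennreal_leI le) simp
      finally show ?thesis .
    qed
    have "(\<integral>\<^sup>+x. ennreal (kern s x y) * U x \<partial>lebesgue) \<le> (\<integral>\<^sup>+x. (\<Sum>i. ennreal (?c i) * (U x * indicator (Q i) x)) \<partial>lebesgue)"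
    proof (intro nn_integral_mono)
      fix x
      have "ennreal (kern s x y) * U x \<le> (\<Sum>i. ennreal (?c i) * indicator (Q i) x) * U x"
        unfolding Q_def R_def by (intro mult_right_mono kern_annuli s0) simp
      also have "\<dots> = (\<Sum>i. ennreal (?c i) * (U x * indicator (Q i) x))"
        by (subst ennreal_suminf_multc[symmetric]) (simp add: ac_simps)
      finally show "ennreal (kern s x y) * U x \<le> (\<Sum>i. ennreal (?c i) * (U x * indicator (Q i) x))" .
    qed
    also have "\<dots> = (\<Sum>i. \<integral>\<^sup>+x. ennreal (?c i) * (U x * indicator (Q i) x) \<partial>lebesgue)"
      by (intro nn_integral_suminf) measurable
    also have "\<dots> = (\<Sum>i. ennreal (?c i) * emeasure (density lebesgue U) (Q i))"
      by (intro suminf_cong) (subst nn_integral_cmult, auto simp: emeasure_density)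
    also have "\<dots> \<le> (\<Sum>i. ennreal (A * (1 / 2) ^ i) * U y)" by (intro suminf_le one) auto
    also have "\<dots> = (\<Sum>i. ennreal (A * (1 / 2) ^ i)) * U y" by simp
    also have "(\<Sum>i. ennreal (A * (1 / 2) ^ i)) = ennreal (A * 2)"
      using A sums_mult[OF geometric_sums[of "1/2::real"], of A] by (intro suminf_ennreal_eq) auto
    finally show ?case .
  qed
  then show ?thesis using A by (intro exI[of _ "A * 2"]) auto
qed

lemma sigma_finite_lebesgue: "sigma_finite_measure (lebesgue :: 'a measure)"
proof
  obtain A :: "'a set set" where A: "countable A" "A \<subseteq> sets lborel" "\<Union>A = space lborel" "\<forall>a\<in>A. emeasure lborel a \<noteq> \<infinity>"
    using lborel.sigma_finite_countable by blast
  have "A \<subseteq> sets lebesgue" using A(2) by auto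
  moreover have "\<forall>a\<in>A. emeasure lebesgue a \<noteq> \<infinity>" using A by (auto simp: emeasure_completion)
  ultimately show "\<exists>A. countable A \<and> A \<subseteq> sets (lebesgue :: 'a measure) \<and> \<Union>A = space lebesgue \<and> (\<forall>a\<in>A. emeasure lebesgue a \<noteq> \<infinity>)"
    using A by (intro exI[of _ A]) simp
qed

lemma pot_measurable [measurable]:
  assumes [measurable]: "G \<in> borel_measurable lebesgue"
  shows "pot s G \<in> borel_measurable lebesgue"
proof -
  interpret sigma_finite_measure "lebesgue :: 'a measure" by (rule sigma_finite_lebesgue)
  show ?thesis unfolding pot_def by measurable
qed

lemma pot_weighted_bound:
  assumes U [measurable]: "U \<in> borel_measurable lebesgue" and G [measurable]: "G \<in> borel_measurable lebesgue"
    and B: "AE y in lebesgue. (\<integral>\<^sup>+x. ennreal (kern s x y) * U x \<partial>lebesgue) \<le> ennreal B * U y"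
  shows "(\<integral>\<^sup>+x. pot s G x * U x \<partial>lebesgue) \<le> ennreal B * (\<integral>\<^sup>+y. G y * U y \<partial>lebesgue)"
proof -
  interpret L: sigma_finite_measure "lebesgue :: 'a measure" by (rule sigma_finite_lebesgue)
  interpret P: pair_sigma_finite "lebesgue :: 'a measure" "lebesgue :: 'a measure" ..
  have "(\<integral>\<^sup>+x. pot s G x * U x \<partial>lebesgue) = (\<integral>\<^sup>+x. (\<integral>\<^sup>+y. ennreal (kern s x y) * G y * U x \<partial>lebesgue) \<partial>lebesgue)"
    unfolding pot_def by (intro nn_integral_cong nn_integral_multc[symmetric]) measurable
  also have "\<dots> = (\<integral>\<^sup>+y. (\<integral>\<^sup>+x. ennreal (kern s x y) * G y * U x \<partial>lebesgue) \<partial>lebesgue)"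
    by (rule P.Fubini'[symmetric]) measurable
  also have "\<dots> = (\<integral>\<^sup>+y. G y * (\<integral>\<^sup>+x. ennreal (kern s x y) * U x \<partial>lebesgue) \<partial>lebesgue)"
    by (intro nn_integral_cong, subst nn_integral_cmult[symmetric]) (auto simp: ac_simps)
  also have "\<dots> \<le> (\<integral>\<^sup>+y. ennreal B * (G y * U y) \<partial>lebesgue)"
  proof (intro nn_integral_mono_AE)
    show "AE y in lebesgue. G y * (\<integral>\<^sup>+x. ennreal (kern s x y) * U x \<partial>lebesgue) \<le> ennreal B * (G y * U y)"
      using B
    proof eventually_elim
      case (elim y)
      then have "G y * (\<integral>\<^sup>+x. ennreal (kern s x y) * U x \<partial>lebesgue) \<le> G y * (ennreal B * U y)"
        by (rule mult_left_mono) simp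
      then show ?case by (simp add: ac_simps)
    qed
  qed
  also have "\<dots> = ennreal B * (\<integral>\<^sup>+y. G y * U y \<partial>lebesgue)" by (intro nn_integral_cmult) measurable
  finally show ?thesis .
qed

end

section \<open>Extracting the local conditions from the weight classes\<close>

text \<open>
  The supremum that defines the essential infimum is attained, since it is the supremum of a sequence and
  countably many null sets have a null union.
\<close>

lemma ess_inf_on_AE:
  fixes w :: "'a::euclidean_space \<Rightarrow> real"
  shows "AE x in lebesgue. x \<in> E \<longrightarrow> ess_inf_on E w \<le> ennreal (w x)"
proof -
  let ?S = "{c. AE x in lebesgue. x \<in> E \<longrightarrow> c \<le> ennreal (w x)}"
  have "0 \<in> ?S" by simp
  then obtain h :: "nat \<Rightarrow> ennreal" where h: "range h \<subseteq> ?S" "Sup ?S = Sup (range h)"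
    using ennreal_Sup_countable_SUP[of ?S] by blast
  have "AE x in lebesgue. \<forall>n. x \<in> E \<longrightarrow> h n \<le> ennreal (w x)"
    unfolding AE_all_countable using h by blast
  then show ?thesis
    unfolding ess_inf_on_def h(2) by eventually_elim (auto intro: SUP_least)
qed

lemma cube_not_null:
  assumes "0 < r" shows "0 < emeasure lebesgue (cube (x::'a::euclidean_space) r)"
  using assms by (subst emeasure_cube) auto

lemma AE_cube_imp_ex:
  assumes "0 < r" "AE y in lebesgue. y \<in> cube (x::'a::euclidean_space) r \<longrightarrow> P y"
  shows "\<exists>y\<in>cube x r. P y"
proof (rule ccontr)
  assume none: "\<not> ?thesis"
  have "AE y in lebesgue. y \<notin> cube x r"
    by (rule eventually_mono[OF assms(2)]) (use none in blast)
  then have "cube x r \<in> null_sets lebesgue" using AE_iff_null_sets[of "cube x r" lebesgue] by simp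
  then show False using cube_not_null[OF assms(1), of x] by auto
qed

lemma integral_cube_pos:
  assumes "0 < r" "f \<in> borel_measurable lebesgue" "AE y in lebesgue. 0 < f y"
  shows "(\<integral>\<^sup>+y\<in>cube (x::'a::euclidean_space) r. f y \<partial>lebesgue) \<noteq> 0"
proof
  assume "(\<integral>\<^sup>+y\<in>cube x r. f y \<partial>lebesgue) = 0"
  then have "AE y in lebesgue. f y * indicator (cube x r) y = 0"
    using assms(2) by (subst nn_integral_0_iff_AE[symmetric]) auto
  with assms(3) have "AE y in lebesgue. y \<in> cube x r \<longrightarrow> False"
    by eventually_elim (auto split: split_indicator_asm)
  from AE_cube_imp_ex[OF assms(1) this] show False by blast
qed

lemma weight_measurable: "weight w \<Longrightarrow> w \<in> borel_measurable lebesgue"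
  by (simp add: weight_def)

lemma weight_pos: "weight w \<Longrightarrow> AE x in lebesgue. 0 < w x"
  by (simp add: weight_def)

lemma weight_of_cube:
  fixes w :: "'a::euclidean_space \<Rightarrow> real"
  assumes w: "weight w" and r: "0 < r"
  obtains m where "0 < m" "weight_of w (cube x r) = ennreal m"
proof -
  have [measurable]: "w \<in> borel_measurable lebesgue" by (rule weight_measurable[OF w])
  have "set_integrable lebesgue (cube x r) w"
    using w compact_cbox unfolding weight_def cube_def by blast
  then have "(\<integral>\<^sup>+y. ennreal (norm (indicator (cube x r) y *\<^sub>R w y)) \<partial>lebesgue) < \<infinity>"
    unfolding set_integrable_def integrable_iff_bounded by blast
  moreover have "weight_of w (cube x r) \<le> (\<integral>\<^sup>+y. ennreal (norm (indicator (cube x r) y *\<^sub>R w y)) \<partial>lebesgue)"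
    unfolding weight_of_def by (intro nn_integral_mono) (auto split: split_indicator intro: ennreal_leI)
  ultimately have fin: "weight_of w (cube x r) < \<infinity>" by simp
  have "weight_of w (cube x r) \<noteq> 0"
    unfolding weight_of_def using weight_pos[OF w] by (intro integral_cube_pos r) auto
  then have "0 < enn2real (weight_of w (cube x r))" using fin by (simp add: enn2real_positive_iff zero_less_iff_neq_zero)
  moreover have "weight_of w (cube x r) = ennreal (enn2real (weight_of w (cube x r)))" using fin by simp
  ultimately show ?thesis using that by blast
qed

lemma weight_of_density:
  assumes "w \<in> borel_measurable lebesgue" "E \<in> sets lebesgue"
  shows "weight_of w E = emeasure (density lebesgue (\<lambda>x. ennreal (w x))) E"
  using assms unfolding weight_of_def by (simp add: emeasure_density)

lemma weight_of_prod:
  assumes "weight u" "weight v" "E \<in> sets lebesgue"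
  shows "weight_of (\<lambda>y. v y * u y) E = emeasure (density lebesgue (\<lambda>y. ennreal (u y) * ennreal (v y))) E"
proof -
  have [measurable]: "u \<in> borel_measurable lebesgue" "v \<in> borel_measurable lebesgue"
    using assms by (auto intro: weight_measurable)
  have "weight_of (\<lambda>y. v y * u y) E = (\<integral>\<^sup>+y\<in>E. ennreal (u y) * ennreal (v y) \<partial>lebesgue)"
    unfolding weight_of_def
  proof (intro nn_integral_cong_AE)
    show "AE y in lebesgue. ennreal (v y * u y) * indicator E y = ennreal (u y) * ennreal (v y) * indicator E y"
      using weight_pos[OF assms(1)] weight_pos[OF assms(2)]
      by eventually_elim (simp add: ennreal_mult mult.commute)
  qed
  also have "\<dots> = emeasure (density lebesgue (\<lambda>y. ennreal (u y) * ennreal (v y))) E"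
    using assms(3) by (subst emeasure_density) auto
  finally show ?thesis .
qed

lemma ennreal_le_mult_of_divide_le:
  assumes "X / ennreal c \<le> Z" "0 < c"
  shows "X \<le> ennreal c * Z"
proof -
  have "X = ennreal c * (X / ennreal c)"
    using assms(2) by (simp add: ennreal_times_divide ennreal_mult_divide_eq mult.commute[of "ennreal c"])
  also have "\<dots> \<le> ennreal c * Z" using assms(1) by (rule mult_left_mono) simp
  finally show ?thesis .
qed

lemma A_one_pointwise:
  fixes u :: "'a::euclidean_space \<Rightarrow> real"
  assumes "u \<in> A_p 1 \<rho> (\<lambda>_. 1)"
  shows "weight u \<and> (\<exists>\<theta>\<ge>0. \<exists>K>0. \<forall>x r. 0 < r \<longrightarrow> (AE y in lebesgue. y \<in> cube x r \<longrightarrow>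
      emeasure (density lebesgue (\<lambda>y. ennreal (u y))) (cube x r)
        \<le> ennreal (K * (1 + r / \<rho> x) powr \<theta> * r ^ DIM('a)) * ennreal (u y)))"
proof -
  obtain \<theta> where th: "0 \<le> \<theta>" "u \<in> A_one_theta \<rho> \<theta> (\<lambda>_. 1)" using assms by (auto simp: A_p_def)
  then have w: "weight u" by (simp add: A_one_theta_def)
  obtain K where K: "0 < K" "\<And>x r. 0 < r \<Longrightarrow> weight_of (\<lambda>y. u y * 1) (cube x r) / weight_of (\<lambda>_. 1) (cube x r)
       \<le> ennreal (K * (1 + r / \<rho> x) powr \<theta>) * ess_inf_on (cube x r) u"
    using th unfolding A_one_theta_def by blast
  let ?k = "(2 / sqrt (real DIM('a))) ^ DIM('a)"
  have "AE y in lebesgue. y \<in> cube x r \<longrightarrow> emeasure (density lebesgue (\<lambda>y. ennreal (u y))) (cube x r)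
        \<le> ennreal (K * ?k * (1 + r / \<rho> x) powr \<theta> * r ^ DIM('a)) * ennreal (u y)" if r: "0 < r" for x r
    using ess_inf_on_AE[of "cube x r" u]
  proof eventually_elim
    case (elim y)
    show ?case
    proof
      assume "y \<in> cube x r"
      then have inf: "ess_inf_on (cube x r) u \<le> ennreal (u y)" using elim by blast
      let ?V = "(2 * r / sqrt (real DIM('a))) ^ DIM('a)"
      have V: "0 < ?V" using r by simp
      have "weight_of (\<lambda>_. 1) (cube x r) = ennreal ?V"
        using emeasure_cube[of r x] r by (simp add: weight_of_def)
      then have "weight_of u (cube x r) / ennreal ?V \<le> ennreal (K * (1 + r / \<rho> x) powr \<theta>) * ess_inf_on (cube x r) u"
        using K(2)[OF r, of x] by simp
      also have "\<dots> \<le> ennreal (K * (1 + r / \<rho> x) powr \<theta>) * ennreal (u y)"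
        using inf by (rule mult_left_mono) simp
      finally have "weight_of u (cube x r) \<le> ennreal ?V * (ennreal (K * (1 + r / \<rho> x) powr \<theta>) * ennreal (u y))"
        using V by (rule ennreal_le_mult_of_divide_le)
      also have "\<dots> = ennreal (?V * (K * (1 + r / \<rho> x) powr \<theta>)) * ennreal (u y)"
        using V K by (simp add: ennreal_mult mult.assoc)
      also have "?V * (K * (1 + r / \<rho> x) powr \<theta>) = K * ?k * (1 + r / \<rho> x) powr \<theta> * r ^ DIM('a)"
        by (simp add: power_mult_distrib power_divide)
      finally show "emeasure (density lebesgue (\<lambda>y. ennreal (u y))) (cube x r)
          \<le> ennreal (K * ?k * (1 + r / \<rho> x) powr \<theta> * r ^ DIM('a)) * ennreal (u y)"
        by (subst weight_of_density[symmetric]) (auto intro: weight_measurable[OF w])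
    qed
  qed
  moreover have "0 < K * ?k" using K by simp
  ultimately show ?thesis using w th(1) by blast
qed

lemma ennreal_powr_eq_0: "ennreal_powr z a = 0 \<longleftrightarrow> z = 0"
  unfolding ennreal_powr_def by (cases z) (auto simp: ennreal_eq_0_iff)

lemma ennreal_powr_ennreal: "0 \<le> x \<Longrightarrow> ennreal_powr (ennreal x) a = ennreal (x powr a)"
  unfolding ennreal_powr_def by simp

text \<open>
  Chebyshev's inequality for \<open>v powr (1 - q)\<close>, which is large where \<open>v\<close> is small. The \<open>A_p\<close>
  condition bounds its mean by the corresponding power of the mean of \<open>v\<close>. It also shows that both means
  are finite, because their product is finite and neither vanishes.
\<close>

lemma A_p_level_sets:
  fixes u v :: "'a::euclidean_space \<Rightarrow> real"
  assumes u: "weight u" and p: "1 < p" and v: "v \<in> A_p_theta p \<rho> \<theta> u" and pos: "\<And>x. 0 < \<rho> x"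
  shows "\<exists>K>0. \<forall>x r. 0 < r \<longrightarrow>
      weight_of (\<lambda>y. v y * u y) (cube x r) < \<infinity> \<and>
      (\<forall>lam>0. weight_of u {y \<in> cube x r. v y \<le> lam * (enn2real (weight_of (\<lambda>y. v y * u y) (cube x r)) / enn2real (weight_of u (cube x r)))}
        \<le> ennreal (K * (1 + r / \<rho> x) powr (\<theta> * (p / (p - 1))) * lam powr (1 / (p - 1))) * weight_of u (cube x r))"
proof -
  define q where "q = p / (p - 1)"
  have q: "1 < q" "1 - q = - (1 / (p - 1))" "q * (1 / p) = 1 / (p - 1)" using p by (auto simp: q_def field_simps)
  have wv: "weight v" using v by (simp add: A_p_theta_def)
  have [measurable]: "u \<in> borel_measurable lebesgue" "v \<in> borel_measurable lebesgue"
    using u wv by (auto intro: weight_measurable)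
  have upos: "AE x in lebesgue. 0 < u x" and vpos: "AE x in lebesgue. 0 < v x"
    using u wv by (auto intro: weight_pos)
  obtain K where K: "0 < K" "\<And>x r. 0 < r \<Longrightarrow>
     ennreal_powr (weight_of (\<lambda>y. v y * u y) (cube x r) / weight_of u (cube x r)) (1 / p) *
     ennreal_powr (weight_of (\<lambda>y. v y powr (1 - q) * u y) (cube x r) / weight_of u (cube x r)) (1 / q)
       \<le> ennreal (K * (1 + r / \<rho> x) powr \<theta>)"
    using v unfolding A_p_theta_def Let_def q_def by blast
  have main: "weight_of (\<lambda>y. v y * u y) (cube x r) < \<infinity> \<and>
      weight_of u {y \<in> cube x r. v y \<le> lam * (enn2real (weight_of (\<lambda>y. v y * u y) (cube x r)) / enn2real (weight_of u (cube x r)))}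
        \<le> ennreal (K powr q * (1 + r / \<rho> x) powr (\<theta> * q) * lam powr (1 / (p - 1))) * weight_of u (cube x r)"
    if r: "0 < r" and lam: "0 < lam" for x r lam
  proof -
    let ?Q = "cube x r"
    let ?n = "weight_of (\<lambda>y. v y * u y) ?Q" and ?z = "weight_of (\<lambda>y. v y powr (1 - q) * u y) ?Q"
    obtain m where m: "0 < m" "weight_of u ?Q = ennreal m" using weight_of_cube[OF u r] .
    have n0: "?n \<noteq> 0"
      unfolding weight_of_def
    proof (intro integral_cube_pos r)
      show "AE y in lebesgue. 0 < ennreal (v y * u y)" using upos vpos by eventually_elim simp
    qed measurable
    have z0: "?z \<noteq> 0"
      unfolding weight_of_def
    proof (intro integral_cube_pos r)
      show "AE y in lebesgue. 0 < ennreal (v y powr (1 - q) * u y)" using upos vpos by eventually_elim simp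
    qed measurable
    define X where "X = ?n / ennreal m"
    define Y where "Y = ?z / ennreal m"
    have XY0: "X \<noteq> 0" "Y \<noteq> 0" using n0 z0 m by (auto simp: X_def Y_def ennreal_divide_eq_0_iff)
    have le: "ennreal_powr X (1 / p) * ennreal_powr Y (1 / q) \<le> ennreal (K * (1 + r / \<rho> x) powr \<theta>)"
      using K(2)[OF r, of x] unfolding X_def Y_def m(2) .
    then have fin: "ennreal_powr X (1 / p) * ennreal_powr Y (1 / q) \<noteq> \<infinity>"
      by (auto simp: top_unique)
    have pow0: "ennreal_powr X (1 / p) \<noteq> 0" "ennreal_powr Y (1 / q) \<noteq> 0"
      using XY0 by (simp_all add: ennreal_powr_eq_0)
    have "ennreal_powr X (1 / p) \<noteq> \<infinity>" using fin pow0 by (auto simp: ennreal_mult_eq_top_iff)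
    then have "X \<noteq> \<infinity>" by (auto simp: ennreal_powr_def)
    then obtain a where a: "0 < a" "X = ennreal a" using XY0 by (cases X) (auto simp: less_le)
    have "ennreal_powr Y (1 / q) \<noteq> \<infinity>" using fin pow0 by (auto simp: ennreal_mult_eq_top_iff)
    then have "Y \<noteq> \<infinity>" by (auto simp: ennreal_powr_def)
    then obtain b where b: "0 < b" "Y = ennreal b" using XY0 by (cases Y) (auto simp: less_le)
    have n: "?n = ennreal (a * m)" and z: "?z = ennreal (b * m)"
    proof -
      have "?n = X * ennreal m" "?z = Y * ennreal m"
        unfolding X_def Y_def using m by (simp_all add: ennreal_divide_times ennreal_mult_divide_eq)
      then show "?n = ennreal (a * m)" "?z = ennreal (b * m)" using a b m by (simp_all add: ennreal_mult)
    qed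
    have quot: "enn2real ?n / enn2real (weight_of u ?Q) = a" using a m by (simp add: n)
    have ab: "a powr (1 / p) * b powr (1 / q) \<le> K * (1 + r / \<rho> x) powr \<theta>"
      using le a b K by (simp add: ennreal_powr_ennreal ennreal_mult[symmetric])
    have "(a powr (1 / p) * b powr (1 / q)) powr q \<le> (K * (1 + r / \<rho> x) powr \<theta>) powr q"
      using q ab a b by (intro powr_mono2) auto
    also have "(a powr (1 / p) * b powr (1 / q)) powr q = a powr (1 / (p - 1)) * b"
      using a b q by (simp add: powr_mult powr_powr mult.commute)
    also have "(K * (1 + r / \<rho> x) powr \<theta>) powr q = K powr q * (1 + r / \<rho> x) powr (\<theta> * q)"
      by (simp add: powr_mult powr_powr)
    finally have ab': "a powr (1 / (p - 1)) * b \<le> K powr q * (1 + r / \<rho> x) powr (\<theta> * q)" .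
    define T where "T = {y \<in> ?Q. v y \<le> lam * a}"
    have T [measurable]: "T \<in> sets lebesgue"
      unfolding T_def by (intro sublevel_measurable cube_measurable weight_measurable[OF wv])
    let ?e = "(lam * a) powr (1 - q)"
    have la: "0 < lam * a" using lam a by simp
    have "ennreal ?e * weight_of u T = (\<integral>\<^sup>+y. ennreal ?e * (ennreal (u y) * indicator T y) \<partial>lebesgue)"
      unfolding weight_of_def by (intro nn_integral_cmult[symmetric]) measurable
    also have "\<dots> \<le> ?z"
      unfolding weight_of_def
    proof (intro nn_integral_mono_AE)
      show "AE y in lebesgue. ennreal ?e * (ennreal (u y) * indicator T y) \<le> ennreal (v y powr (1 - q) * u y) * indicator ?Q y"
        using upos vpos
      proof eventually_elim
        case (elim y)
        show ?case
        proof (cases "y \<in> T")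
          case True
          then have "?e \<le> v y powr (1 - q)" using elim q(1) by (intro powr_mono2') (auto simp: T_def)
          then have "ennreal ?e * ennreal (u y) \<le> ennreal (v y powr (1 - q)) * ennreal (u y)"
            by (intro mult_right_mono ennreal_leI) auto
          then show ?thesis using True elim by (simp add: T_def ennreal_mult)
        qed simp
      qed
    qed
    finally have "ennreal ?e * weight_of u T \<le> ennreal (b * m)" unfolding z .
    then have "ennreal (1 / ?e) * (ennreal ?e * weight_of u T) \<le> ennreal (1 / ?e) * ennreal (b * m)"
      by (rule mult_left_mono) simp
    then have "weight_of u T \<le> ennreal (1 / ?e * (b * m))"
      using lam a(1) b m by (simp add: ennreal_cancel_left ennreal_mult[symmetric])
    also have "1 / ?e = lam powr (1 / (p - 1)) * a powr (1 / (p - 1))"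
      using lam a q by (simp add: powr_minus_divide powr_mult)
    also have "ennreal (lam powr (1 / (p - 1)) * a powr (1 / (p - 1)) * (b * m)) \<le>
        ennreal (K powr q * (1 + r / \<rho> x) powr (\<theta> * q) * lam powr (1 / (p - 1)) * m)"
    proof (rule ennreal_leI)
      have "lam powr (1 / (p - 1)) * (a powr (1 / (p - 1)) * b) * m \<le> lam powr (1 / (p - 1)) * (K powr q * (1 + r / \<rho> x) powr (\<theta> * q)) * m"
        using m by (intro mult_right_mono mult_left_mono ab') auto
      then show "lam powr (1 / (p - 1)) * a powr (1 / (p - 1)) * (b * m) \<le> K powr q * (1 + r / \<rho> x) powr (\<theta> * q) * lam powr (1 / (p - 1)) * m"
        by (simp add: ac_simps)
    qed
    also have "\<dots> = ennreal (K powr q * (1 + r / \<rho> x) powr (\<theta> * q) * lam powr (1 / (p - 1))) * weight_of u ?Q"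
      using m by (simp add: ennreal_mult'')
    finally show ?thesis unfolding quot T_def[symmetric] using n by simp
  qed
  show ?thesis
    unfolding q_def[symmetric]
  proof (intro exI[of _ "K powr q"] conjI allI impI)
    show "0 < K powr q" using K(1) by simp
    show "weight_of (\<lambda>y. v y * u y) (cube x r) < \<infinity>" if "0 < r" for x r
      using main[OF that zero_less_one] by blast
  qed (rule main[THEN conjunct2])
qed

text \<open>
  For \<open>p = 1\<close> the weight \<open>v\<close> is bounded below almost everywhere by a multiple of its mean, so the
  level set is null for small \<open>lam\<close>; for the other \<open>lam\<close> the right-hand side is at least the
  measure of the whole cube.
\<close>

lemma A_one_level_sets:
  fixes u v :: "'a::euclidean_space \<Rightarrow> real"
  assumes u: "weight u" and v: "v \<in> A_one_theta \<rho> \<theta> u" and pos: "\<And>x. 0 < \<rho> x"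
  shows "\<exists>K>0. \<forall>x r. 0 < r \<longrightarrow>
      weight_of (\<lambda>y. v y * u y) (cube x r) < \<infinity> \<and>
      (\<forall>lam>0. weight_of u {y \<in> cube x r. v y \<le> lam * (enn2real (weight_of (\<lambda>y. v y * u y) (cube x r)) / enn2real (weight_of u (cube x r)))}
        \<le> ennreal (K * (1 + r / \<rho> x) powr \<theta> * lam powr 1) * weight_of u (cube x r))"
proof -
  have wv: "weight v" using v by (simp add: A_one_theta_def)
  obtain K where K: "0 < K" "\<And>x r. 0 < r \<Longrightarrow> weight_of (\<lambda>y. v y * u y) (cube x r) / weight_of u (cube x r)
       \<le> ennreal (K * (1 + r / \<rho> x) powr \<theta>) * ess_inf_on (cube x r) v"
    using v unfolding A_one_theta_def by blast
  have main: "weight_of (\<lambda>y. v y * u y) (cube x r) < \<infinity> \<and>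
      weight_of u {y \<in> cube x r. v y \<le> lam * (enn2real (weight_of (\<lambda>y. v y * u y) (cube x r)) / enn2real (weight_of u (cube x r)))}
        \<le> ennreal (K * (1 + r / \<rho> x) powr \<theta> * lam powr 1) * weight_of u (cube x r)"
    if r: "0 < r" and lam: "0 < lam" for x r lam
  proof -
    let ?Q = "cube x r" and ?k = "K * (1 + r / \<rho> x) powr \<theta>"
    let ?n = "weight_of (\<lambda>y. v y * u y) ?Q"
    have k: "0 < ?k" using K r pos[of x] add_pos_pos[of 1 "r / \<rho> x"] by simp
    obtain m where m: "0 < m" "weight_of u ?Q = ennreal m" using weight_of_cube[OF u r] .
    have ae: "AE y in lebesgue. y \<in> ?Q \<longrightarrow> ?n / ennreal m \<le> ennreal (?k * v y)"
      using ess_inf_on_AE[of ?Q v]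
    proof eventually_elim
      case (elim y)
      show ?case
      proof
        assume "y \<in> ?Q"
        then have "ess_inf_on ?Q v \<le> ennreal (v y)" using elim by blast
        then have "ennreal ?k * ess_inf_on ?Q v \<le> ennreal ?k * ennreal (v y)" by (rule mult_left_mono) simp
        then have "?n / ennreal m \<le> ennreal ?k * ennreal (v y)"
          using K(2)[OF r, of x] unfolding m(2) by (rule order_trans[rotated])
        then show "?n / ennreal m \<le> ennreal (?k * v y)" using k by (simp add: ennreal_mult')
      qed
    qed
    obtain y where "?n / ennreal m \<le> ennreal (?k * v y)" using AE_cube_imp_ex[OF r ae] by blast
    then have "?n \<le> ennreal m * ennreal (?k * v y)" using m by (intro ennreal_le_mult_of_divide_le)
    also have "\<dots> < \<infinity>" by (simp add: ennreal_mult_less_top)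
    finally have fin: "?n < \<infinity>" .
    then obtain n where n: "0 \<le> n" "?n = ennreal n" by (cases ?n) auto
    have quot: "enn2real ?n / enn2real (weight_of u ?Q) = n / m" using n m by simp
    define T where "T = {y \<in> ?Q. v y \<le> lam * (n / m)}"
    have "weight_of u T \<le> ennreal (?k * lam) * weight_of u ?Q"
    proof (cases "?k * lam < 1")
      case True
      have "weight_of u T \<le> (\<integral>\<^sup>+y. 0 \<partial>(lebesgue :: 'a measure))"
        unfolding weight_of_def
      proof (intro nn_integral_mono_AE)
        show "AE y in lebesgue. ennreal (u y) * indicator T y \<le> 0"
          using ae weight_pos[OF wv]
        proof eventually_elim
          case (elim y)
          have "y \<notin> T"
          proof
            assume T: "y \<in> T"
            then have "ennreal (n / m) \<le> ennreal (?k * v y)" using elim n m by (simp add: T_def divide_ennreal)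
            then have "n / m \<le> ?k * v y" using elim k by (simp add: ennreal_le_iff)
            then have "lam * (n / m) \<le> lam * (?k * v y)" using lam by (intro mult_left_mono) auto
            then have "v y \<le> (?k * lam) * v y" using T by (simp add: T_def ac_simps)
            then show False using True elim mult_strict_right_mono[OF True, of "v y"] by simp
          qed
          then show ?case by simp
        qed
      qed
      then show ?thesis by simp
    next
      case False
      have "weight_of u T \<le> 1 * weight_of u ?Q"
        unfolding weight_of_def by (simp, intro nn_integral_mono) (auto simp: T_def split: split_indicator)
      also have "\<dots> \<le> ennreal (?k * lam) * weight_of u ?Q" using False by (intro mult_right_mono) auto
      finally show ?thesis .
    qed
    then show ?thesis unfolding quot T_def[symmetric] using fin lam by simp
  qed
  show ?thesis
  proof (intro exI[of _ K] conjI allI impI)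
    show "weight_of (\<lambda>y. v y * u y) (cube x r) < \<infinity>" if "0 < r" for x r
      using main[OF that zero_less_one] by blast
  qed (rule K(1), rule main[THEN conjunct2])
qed

lemma A_infinity_level_sets:
  fixes u v :: "'a::euclidean_space \<Rightarrow> real"
  assumes u: "weight u" and v: "v \<in> A_infinity \<rho> u" and pos: "\<And>x. 0 < \<rho> x"
  obtains K th ep where "weight v" "0 < K" "0 \<le> th" "0 < ep"
    "\<And>x r. 0 < r \<Longrightarrow> weight_of (\<lambda>y. v y * u y) (cube x r) < \<infinity>"
    "\<And>x r lam. 0 < r \<Longrightarrow> 0 < lam \<Longrightarrow>
       weight_of u {y \<in> cube x r. v y \<le> lam * (enn2real (weight_of (\<lambda>y. v y * u y) (cube x r)) / enn2real (weight_of u (cube x r)))}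
        \<le> ennreal (K * (1 + r / \<rho> x) powr th * lam powr ep) * weight_of u (cube x r)"
proof -
  obtain p where p: "1 \<le> p" "v \<in> A_p p \<rho> u" using v by (auto simp: A_infinity_def)
  then obtain \<theta> where th: "0 \<le> \<theta>" "v \<in> (if p = 1 then A_one_theta \<rho> \<theta> u else A_p_theta p \<rho> \<theta> u)"
    unfolding A_p_def by blast
  show ?thesis
  proof (cases "p = 1")
    case True
    then have v1: "v \<in> A_one_theta \<rho> \<theta> u" using th by simp
    then have "weight v" by (simp add: A_one_theta_def)
    then show ?thesis using A_one_level_sets[OF u v1 pos] th(1) that[of _ \<theta> 1] by auto
  next
    case False
    then have v1: "v \<in> A_p_theta p \<rho> \<theta> u" "1 < p" using th p by auto
    then have "weight v" by (simp add: A_p_theta_def)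
    moreover have "0 \<le> \<theta> * (p / (p - 1))" "0 < 1 / (p - 1)" using th v1 by auto
    ultimately show ?thesis
      using A_p_level_sets[OF u v1(2,1) pos] that[of _ "\<theta> * (p / (p - 1))" "1 / (p - 1)"] by blast
  qed
qed

section \<open>The mixed weak-type inequality\<close>

lemma exists_power_bracket:
  fixes a y :: real
  assumes "1 < a" "0 < y"
  obtains k :: int where "a powi k < y" "y \<le> a powi (k + 1)"
proof -
  define k where "k = \<lceil>log a y\<rceil> - 1"
  have "real_of_int k < log a y" "log a y \<le> real_of_int (k + 1)"
    unfolding k_def by linarith+
  then have "a powr real_of_int k < y" "y \<le> a powr real_of_int (k + 1)"
    using assms by (simp_all only: less_log_iff log_le_iff)
  then show ?thesis using that[of k] assms by (simp add: powr_real_of_int' del: of_int_add)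
qed

lemma exists_level:
  assumes "0 < r"
  obtains n where "2 * r / sqrt (real DIM('a::euclidean_space)) \<le> 2 powi n" "rad TYPE('a) n \<le> 2 * r"
proof -
  let ?l = "2 * r / sqrt (real DIM('a))"
  have "0 < ?l" using assms by simp
  then obtain k :: int where k: "2 powi k < ?l" "?l \<le> 2 powi (k + 1)"
    using exists_power_bracket[of 2 ?l] by auto
  have "sqrt (real DIM('a)) * 2 powi k \<le> sqrt (real DIM('a)) * ?l" using k by (intro mult_left_mono) auto
  then have "rad TYPE('a) (k + 1) \<le> 2 * r" by (simp add: rad_def powi_Suc2)
  then show ?thesis using that k by blast
qed

context critical
begin

text \<open>
  Cells whose radius is comparable to the critical radius at their centre need no damping.
\<close>

lemma avg_le_pot:
  assumes eta: "0 < \<eta>" and M: "1 \<le> M" and s: "0 \<le> s"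
  shows "\<exists>B>0. \<forall>G p x. G \<in> borel_measurable lebesgue \<longrightarrow> p \<in> cells \<longrightarrow>
    \<eta> * \<rho> (snd p) \<le> rad TYPE('a) (fst p) \<longrightarrow> rad TYPE('a) (fst p) \<le> M * \<rho> (snd p) \<longrightarrow> x \<in> big p \<longrightarrow>
    avg G p \<le> ennreal B * pot s G x"
proof -
  obtain B where B: "0 < B" "\<And>G x0 r x. G \<in> borel_measurable lebesgue \<Longrightarrow> 0 < r \<Longrightarrow> \<eta> * \<rho> x0 \<le> r \<Longrightarrow> x \<in> cube x0 (5 * r) \<Longrightarrow>
    ennreal ((1 + r / \<rho> x0) powr (- decay s)) * ((\<integral>\<^sup>+y\<in>cube x0 r. G y \<partial>lebesgue) / emeasure lebesgue (cube x0 r))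
      \<le> ennreal B * pot s G x"
    using large_cube_le_pot[OF eta s] by blast
  have dec: "0 \<le> decay s" using s N by (simp add: decay_def)
  define m where "m = (1 + M) powr (- decay s)"
  have m: "0 < m" using M by (simp add: m_def)
  have "avg G p \<le> ennreal (1 / m * B) * pot s G x"
    if G: "G \<in> borel_measurable lebesgue" and p: "p \<in> cells"
      and r: "\<eta> * \<rho> (snd p) \<le> rad TYPE('a) (fst p)" "rad TYPE('a) (fst p) \<le> M * \<rho> (snd p)" and x: "x \<in> big p" for G p x
  proof -
    let ?r = "rad TYPE('a) (fst p)" and ?c = "snd p"
    let ?I = "\<integral>\<^sup>+y\<in>cube ?c ?r. G y \<partial>lebesgue"
    have V: "emeasure lebesgue (cube ?c ?r) = ennreal (vol TYPE('a) (fst p))"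
      using emeasure_cube[of ?r ?c] rad_pos[where 'a='a, of "fst p"] rad_div[where 'a='a, of 2 "fst p"] by (simp add: vol_def less_imp_le)
    have "cell_of p \<subseteq> cube ?c ?r" using cell_subset_cube[of "fst p" ?c] p by simp
    then have "(\<integral>\<^sup>+y\<in>cell_of p. G y \<partial>lebesgue) \<le> ?I"
      by (intro nn_integral_mono) (auto split: split_indicator)
    then have "avg G p \<le> ennreal (1 / vol TYPE('a) (fst p)) * ?I"
      unfolding avg_def by (rule mult_left_mono) simp
    also have "ennreal (1 / vol TYPE('a) (fst p)) = 1 / ennreal (vol TYPE('a) (fst p))"
      by (simp add: divide_ennreal[symmetric])
    finally have "avg G p \<le> ?I / emeasure lebesgue (cube ?c ?r)"
      unfolding V by (simp add: ennreal_divide_times)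
    moreover have "m \<le> (1 + ?r / \<rho> ?c) powr (- decay s)"
      unfolding m_def using r(2) pos[of ?c] dec rad_pos[where 'a='a, of "fst p"]
      by (intro powr_mono2' add_pos_nonneg divide_nonneg_pos) (auto simp: pos_divide_le_eq)
    ultimately have "ennreal m * avg G p \<le> ennreal ((1 + ?r / \<rho> ?c) powr (- decay s)) * (?I / emeasure lebesgue (cube ?c ?r))"
      by (intro mult_mono ennreal_leI) auto
    also have "\<dots> \<le> ennreal B * pot s G x"
      by (rule B(2)[OF G _ r(1)]) (use x in \<open>auto simp: big_def\<close>)
    finally have "ennreal (1 / m) * (ennreal m * avg G p) \<le> ennreal (1 / m) * (ennreal B * pot s G x)"
      by (rule mult_left_mono) simp
    moreover have "ennreal (1 / m * B) = ennreal (1 / m) * ennreal B"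
      using m B(1) by (intro ennreal_mult) auto
    ultimately show ?thesis using m by (simp only: ennreal_cancel_left mult.assoc)
  qed
  moreover have "0 < 1 / m * B" using m B(1) by simp
  ultimately show ?thesis by blast
qed

end

locale local_critical = critical + local_weights
begin

text \<open>
  The factor \<open>6 ^ d\<close> is lost between a cube and a neighbouring cell, namely \<open>3 ^ d\<close> for the number of
  cells and \<open>2 ^ d\<close> for the ratio of volumes; the factor \<open>base\<close> comes from rounding \<open>v x\<close> to a power of
  \<open>base\<close>.
\<close>

definition cover_const :: real where "cover_const = 6 ^ DIM('a) * base"

lemma cover_const_pos: "0 < cover_const"
  using base_gt_1 by (simp add: cover_const_def)

lemma norm_centre_parent_le:
  fixes p :: "int \<times> 'a"
  assumes "p \<in> cells"
  shows "norm (snd p - snd (parent p)) \<le> 2 * rad TYPE('a) (fst p)"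
proof -
  have c: "(fst p + 1, snd (parent p)) \<in> cells" by (simp add: parent_def)
  have "snd p \<in> cell_of (parent p)" using cell_subset_parent[of p] self_in_cell by blast
  then have "snd p \<in> cube (snd (parent p)) (rad TYPE('a) (fst p + 1))"
    using cell_subset_cube[OF c] by (auto simp: parent_def)
  from norm_le_of_mem_cube[OF this] show ?thesis
    using rad_pos[where 'a='a, of "fst p"] by (simp add: rad_Suc norm_minus_commute)
qed

text \<open>
  The reduction of a small cube to the dyadic grid. A neighbouring cell \<open>p\<close> has average above
  \<open>base powi k\<close>, where \<open>v x\<close> is about \<open>base powi k\<close>. Either \<open>p\<close> is not local, or the maximal local
  cell \<open>q\<close> over it has a parent that is not local: then the cell is of critical size and the potential
  takes over. In the remaining case \<open>q\<close> is a stopping cell whose dilate contains \<open>x\<close>.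
\<close>

lemma small_cube_cases:
  assumes s: "0 \<le> s"
  shows "\<exists>B>0. \<forall>G x x0 r. G \<in> borel_measurable lebesgue \<longrightarrow> 0 < r \<longrightarrow> r < \<rho> x0 \<longrightarrow> x \<in> cube x0 r \<longrightarrow> 0 < v x \<longrightarrow>
     ennreal (v x) \<le> (\<integral>\<^sup>+y\<in>cube x0 r. G y \<partial>lebesgue) / emeasure lebesgue (cube x0 r) \<longrightarrow>
     x \<in> (\<Union>(k, p)\<in>stops G. {y \<in> big p. v y \<le> cover_const * base powi k}) \<or> ennreal (v x) \<le> ennreal B * pot s G x"
proof -
  \<comment> \<open>The numbers 12 and 3 are bounds for \<open>1 + norm (x - y) / \<rho> x\<close> in the two comparisons of critical radii below.\<close>
  define M where "M = 2 * (C * 12 powr N)"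
  have "1 * 1 \<le> C * 12 powr N" using C N by (intro mult_mono ge_one_powr_ge_zero) auto
  then have M: "1 \<le> M" by (simp add: M_def)
  define \<eta> where "\<eta> = 1 / (2 * (C * 3 powr N))"
  have "1 * 1 \<le> C * 3 powr N" using C N by (intro mult_mono ge_one_powr_ge_zero) auto
  then have eta: "0 < \<eta>" "\<eta> \<le> 1" by (auto simp: \<eta>_def)
  obtain B where B: "0 < B" "\<And>G p x. G \<in> borel_measurable lebesgue \<Longrightarrow> p \<in> cells \<Longrightarrow>
    \<eta> * \<rho> (snd p) \<le> rad TYPE('a) (fst p) \<Longrightarrow> rad TYPE('a) (fst p) \<le> M * \<rho> (snd p) \<Longrightarrow> x \<in> big p \<Longrightarrow>
    avg G p \<le> ennreal B * pot s G x"
    using avg_le_pot[OF eta(1) M s] by blast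
  have "x \<in> (\<Union>(k, p)\<in>stops G. {y \<in> big p. v y \<le> cover_const * base powi k}) \<or> ennreal (v x) \<le> ennreal (cover_const * B) * pot s G x"
    if G: "G \<in> borel_measurable lebesgue" and r: "0 < r" "r < \<rho> x0" and x: "x \<in> cube x0 r" and vx: "0 < v x"
      and le: "ennreal (v x) \<le> (\<integral>\<^sup>+y\<in>cube x0 r. G y \<partial>lebesgue) / emeasure lebesgue (cube x0 r)" for G x x0 r
  proof -
    obtain n where n: "2 * r / sqrt (real DIM('a)) \<le> 2 powi n" "rad TYPE('a) n \<le> 2 * r"
      using exists_level[where 'a='a, OF r(1)] by blast
    obtain c where c: "(n, c) \<in> cells"
      "(\<integral>\<^sup>+y\<in>cube x0 r. G y \<partial>lebesgue) \<le> 3 ^ DIM('a) * (\<integral>\<^sup>+y\<in>cell n c. G y \<partial>lebesgue)"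
      "\<And>y b. y \<in> cell n c \<Longrightarrow> b \<in> Basis \<Longrightarrow> \<bar>x \<bullet> b - y \<bullet> b\<bar> \<le> 2 * 2 powi n"
      using neighbour_cell[OF G x n(1)] by blast
    define p where "p = (n, c)"
    have p: "p \<in> cells" using c by (simp add: p_def)
    have xp: "x \<in> big p" using mem_cube5[OF c(1) self_in_cell c(3)[OF self_in_cell]] by (simp add: big_def p_def)
    have avg: "ennreal (v x) \<le> ennreal (6 ^ DIM('a)) * avg G p"
    proof -
      let ?V = "(2 * r / sqrt (real DIM('a))) ^ DIM('a)"
      have V: "0 < ?V" using r by simp
      have Vn: "vol TYPE('a) n \<le> 2 ^ DIM('a) * ?V"
      proof -
        have "2 powi n \<le> 2 * (2 * r / sqrt (real DIM('a)))"
          using n(2) unfolding rad_def by (simp add: pos_le_divide_eq mult.commute)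
        then have "(2 powi n) ^ DIM('a) \<le> (2 * (2 * r / sqrt (real DIM('a)))) ^ DIM('a)" by (intro power_mono) auto
        then show ?thesis by (simp only: vol_def power_mult_distrib)
      qed
      have "(\<integral>\<^sup>+y\<in>cube x0 r. G y \<partial>lebesgue) / emeasure lebesgue (cube x0 r) = ennreal (1 / ?V) * (\<integral>\<^sup>+y\<in>cube x0 r. G y \<partial>lebesgue)"
      proof -
        have "ennreal (1 / ?V) = 1 / ennreal ?V" using divide_ennreal[of 1 ?V] V by simp
        then show ?thesis using emeasure_cube[of r x0] r by (simp only: less_imp_le ennreal_divide_times mult_1_left)
      qed
      also have "\<dots> \<le> ennreal (1 / ?V) * (3 ^ DIM('a) * (\<integral>\<^sup>+y\<in>cell n c. G y \<partial>lebesgue))"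
        using c(2) by (rule mult_left_mono) simp
      also have "\<dots> = ennreal (1 / ?V) * (ennreal (3 ^ DIM('a)) * (ennreal (vol TYPE('a) n) * avg G p))"
        using integral_eq_vol_avg[where p=p and G=G] by (simp add: p_def ennreal_power[symmetric])
      also have "\<dots> = ennreal (1 / ?V * (3 ^ DIM('a) * vol TYPE('a) n)) * avg G p"
        using V by (simp only: ennreal_mult' ennreal_mult'' zero_le_power zero_le_numeral vol_nonneg divide_nonneg_pos zero_le_one mult.assoc)
      also have "\<dots> \<le> ennreal (6 ^ DIM('a)) * avg G p"
      proof (intro mult_right_mono ennreal_leI)
        have gen: "1 / W * (a * (b * W)) = a * b" if "0 < W" for a b W :: real using that by simp
        have "1 / ?V * (3 ^ DIM('a) * vol TYPE('a) n) \<le> 1 / ?V * (3 ^ DIM('a) * (2 ^ DIM('a) * ?V))"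
          using V Vn by (intro mult_left_mono) auto
        also have "\<dots> = 3 ^ DIM('a) * 2 ^ DIM('a)" by (rule gen[OF V])
        also have "\<dots> = (6 :: real) ^ DIM('a)" by (simp add: power_mult_distrib[symmetric])
        finally show "1 / ?V * (3 ^ DIM('a) * vol TYPE('a) n) \<le> 6 ^ DIM('a)" .
      qed simp
      finally show ?thesis using le by (rule order_trans[rotated])
    qed
    define h where "h = v x / 6 ^ DIM('a)"
    have h: "0 < h" "v x = 6 ^ DIM('a) * h" using vx by (auto simp: h_def)
    obtain k where k: "base powi k < h" "h \<le> base powi (k + 1)"
      using exists_power_bracket[OF base_gt_1 h(1)] .
    have vk: "v x \<le> cover_const * base powi k"
      using k(2) unfolding h(2) cover_const_def base_powi_Suc by simp
    have "ennreal (1 / 6 ^ DIM('a)) * ennreal (v x) \<le> ennreal (1 / 6 ^ DIM('a)) * (ennreal (6 ^ DIM('a)) * avg G p)"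
      using avg by (rule mult_left_mono) simp
    then have hp: "ennreal h \<le> avg G p"
      using vx by (simp add: ennreal_cancel_left h_def ennreal_mult[symmetric])
    have pk: "ennreal (base powi k) < avg G p"
      using k(1) hp by (meson ennreal_lessI h(1) order.strict_trans2)
    \<comment> \<open>A cell with average above the threshold yields the second alternative as soon as the potential dominates its average.\<close>
    have from_avg: "ennreal (v x) \<le> ennreal (cover_const * B) * pot s G x"
      if "ennreal (base powi k) \<le> avg G q" "avg G q \<le> ennreal B * pot s G x" for q
    proof -
      have "ennreal (v x) \<le> ennreal cover_const * ennreal (base powi k)"
        using vk cover_const_pos by (simp add: ennreal_mult[symmetric] ennreal_leI less_imp_le)
      also have "\<dots> \<le> ennreal cover_const * (ennreal B * pot s G x)"
        using that by (intro mult_left_mono) auto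
      finally show ?thesis using cover_const_pos B(1) by (simp add: ennreal_mult mult.assoc less_imp_le)
    qed
    show ?thesis
    proof (cases "loc p")
      case False
      then have big: "\<rho> c < rad TYPE('a) n" using p by (auto simp: loc_def p_def)
      have xc: "x \<in> cube c (5 * rad TYPE('a) n)" using xp by (simp add: big_def p_def)
      have "norm (x0 - c) = norm ((x0 - x) - (c - x))" by simp
      also have "\<dots> \<le> norm (x0 - x) + norm (c - x)" by (rule norm_triangle_ineq4)
      also have "\<dots> \<le> r + 5 * rad TYPE('a) n"
        using norm_le_of_mem_cube[OF x] norm_le_of_mem_cube[OF xc] r rad_pos[where 'a='a, of n] by simp
      finally have "norm (x0 - c) \<le> 11 * \<rho> x0" using n(2) r by linarith
      then have "1 + norm (x0 - c) / \<rho> x0 \<le> 12" using pos[of x0] by (simp add: pos_divide_le_eq)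
      from lower_powr[OF this] have "rad TYPE('a) n \<le> M * \<rho> c" using n(2) r by (simp add: M_def)
      moreover have "\<eta> * \<rho> c \<le> 1 * \<rho> c" using eta pos[of c] by (intro mult_right_mono) auto
      then have "\<eta> * \<rho> c \<le> rad TYPE('a) n" using big by linarith
      ultimately have "avg G p \<le> ennreal B * pot s G x"
        using B(2)[OF G p _ _ xp] by (simp add: p_def)
      then show ?thesis using from_avg[of p] pk by (simp add: less_imp_le)
    next
      case True
      then have pg: "p \<in> good G k" using pk by (simp add: good_def)
      obtain M' where M': "\<forall>q\<in>good G k. c \<in> cell_of q \<longrightarrow> fst q \<le> M'"
        using good_levels[of "good G k" c] by (auto simp: good_def)
      have cp: "c \<in> cell_of p" by (simp add: p_def)
      obtain q where q: "q \<in> tops (good G k)" "cell_of p \<subseteq> cell_of q" "fst p \<le> fst q"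
        using exists_top[OF good_cells _ pg cp] M' by blast
      have gq: "q \<in> good G k" using q tops_subset by blast
      have lq: "loc q" and qk: "ennreal (base powi k) < avg G q" using gq by (auto simp: good_def)
      have cq: "(fst q, snd q) \<in> cells" using lq loc_cells by simp
      have xq: "x \<in> big q"
        unfolding big_def
      proof (rule mem_cube5[OF cq])
        show "c \<in> cell (fst q) (snd q)" using q cp by auto
        fix b :: 'a assume "b \<in> Basis"
        then have "\<bar>x \<bullet> b - c \<bullet> b\<bar> \<le> 2 * 2 powi n" by (intro c(3)) auto
        also have "\<dots> \<le> 2 * 2 powi (fst q)" using q by (simp add: p_def power_int_increasing)
        finally show "\<bar>x \<bullet> b - c \<bullet> b\<bar> \<le> 2 * 2 powi (fst q)" .
      qed
      show ?thesis
      proof (cases "loc (parent q)")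
        case True
        then have "(k, q) \<in> stops G" using q by (simp add: stops_def stopping_def)
        then show ?thesis using xq vk by blast
      next
        case False
        let ?r = "rad TYPE('a) (fst q)"
        have "\<rho> (snd (parent q)) < 2 * ?r" using False by (auto simp: loc_def parent_def rad_Suc)
        have lr: "?r \<le> \<rho> (snd q)" using lq by (simp add: loc_def)
        have "1 + norm (snd q - snd (parent q)) / \<rho> (snd q) \<le> 3"
          using norm_centre_parent_le[of q] cq lr pos[of "snd q"] by (simp add: pos_divide_le_eq)
        from lower_powr[OF this] have "\<rho> (snd q) \<le> C * 3 powr N * \<rho> (snd (parent q))" .
        also have "\<dots> \<le> C * 3 powr N * (2 * ?r)"
          using \<open>\<rho> (snd (parent q)) < 2 * ?r\<close> C by (intro mult_left_mono) auto
        finally have "\<eta> * \<rho> (snd q) \<le> ?r" using C by (simp add: \<eta>_def pos_divide_le_eq ac_simps)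
        moreover have "1 * \<rho> (snd q) \<le> M * \<rho> (snd q)" using M pos[of "snd q"] by (intro mult_right_mono) auto
        then have "?r \<le> M * \<rho> (snd q)" using lr by linarith
        ultimately have "avg G q \<le> ennreal B * pot s G x"
          using B(2)[OF G _ _ _ xq] cq by simp
        then show ?thesis using from_avg[of q] qk by (simp add: less_imp_le)
      qed
    qed
  qed
  moreover have "0 < cover_const * B" using cover_const_pos B by simp
  ultimately show ?thesis by blast
qed

end

theorem theorem1:
  fixes \<rho> u v :: "'a::euclidean_space \<Rightarrow> real"
  assumes "critical_radius \<rho>"
    and "u \<in> A_p 1 \<rho> (\<lambda>_. 1)"
    and "v \<in> A_infinity \<rho> u"
  shows "\<exists>\<sigma>\<ge>0. \<exists>C>0. \<forall>t>0. \<forall>f :: 'a \<Rightarrow> real.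
    f \<in> borel_measurable lebesgue \<and> bounded (range f) \<and> compact (closure {x. f x \<noteq> 0}) \<longrightarrow>
    weight_of (\<lambda>x. u x * v x)
        {x. maximal \<rho> \<sigma> (\<lambda>y. f y * v y) x / ennreal (v x) > ennreal t}
      \<le> ennreal (C / t) * (\<integral>\<^sup>+x. ennreal (\<bar>f x\<bar> * u x * v x) \<partial>lebesgue)"
proof -
  obtain C N :: real where CN: "1 \<le> C" "1 \<le> N" "\<And>x. 0 < \<rho> x"
    "\<And>x y. inverse C * \<rho> x * (1 + norm (x - y) / \<rho> x) powr (- N) \<le> \<rho> y"
    "\<And>x y. \<rho> y \<le> C * \<rho> x * (1 + norm (x - y) / \<rho> x) powr (N / (N + 1))"
    using assms(1) unfolding critical_radius_def by blast
  interpret critical \<rho> C N by unfold_locales (use CN in auto)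
  define U where "U = (\<lambda>y. ennreal (u y))"
  obtain \<theta> K where u: "weight u" and th: "0 \<le> \<theta>" "0 < K"
    and u_A1: "\<And>x r. 0 < r \<Longrightarrow> AE y in lebesgue. y \<in> cube x r \<longrightarrow>
      emeasure (density lebesgue U) (cube x r) \<le> ennreal (K * (1 + r / \<rho> x) powr \<theta> * r ^ DIM('a)) * U y"
    using A_one_pointwise[OF assms(2)] unfolding U_def by blast
  obtain K' th' ep where v: "weight v" and K': "0 < K'" "0 \<le> th'" "0 < ep"
    and lev: "\<And>x r. 0 < r \<Longrightarrow> weight_of (\<lambda>y. v y * u y) (cube x r) < \<infinity>"
      "\<And>x r lam. 0 < r \<Longrightarrow> 0 < lam \<Longrightarrow> weight_of u {y \<in> cube x r. v y \<le> lam * (enn2real (weight_of (\<lambda>y. v y * u y) (cube x r)) / enn2real (weight_of u (cube x r)))}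
        \<le> ennreal (K' * (1 + r / \<rho> x) powr th' * lam powr ep) * weight_of u (cube x r)"
    by (rule A_infinity_level_sets[OF u assms(3) pos]) (rule that)
  have um [measurable]: "u \<in> borel_measurable lebesgue" and vm [measurable]: "v \<in> borel_measurable lebesgue"
    using u v by (auto intro: weight_measurable)
  have Um [measurable]: "U \<in> borel_measurable lebesgue" unfolding U_def by measurable
  have u_eq: "weight_of u E = emeasure (density lebesgue U) E" if "E \<in> sets lebesgue" for E
    unfolding U_def by (rule weight_of_density[OF um that])
  have uv_eq: "weight_of (\<lambda>y. v y * u y) E = emeasure (density lebesgue (\<lambda>y. U y * ennreal (v y))) E" if "E \<in> sets lebesgue" for E
    unfolding U_def by (rule weight_of_prod[OF u v that])
  define k where "k = sqrt (real DIM('a)) / 2"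
  have rad_vol: "rad TYPE('a) n ^ DIM('a) = k ^ DIM('a) * vol TYPE('a) n" for n
    by (simp add: rad_def vol_def k_def power_mult_distrib power_divide)
  have k: "0 < k" by (simp add: k_def)
  have ratio: "(1 + 5 * rad TYPE('a) n / \<rho> c) powr t \<le> 6 powr t" if "rad TYPE('a) n \<le> \<rho> c" "0 \<le> t" for n c t
  proof (rule powr_mono2)
    have "rad TYPE('a) n / \<rho> c \<le> 1" using that(1) pos[of c] by (simp add: pos_divide_le_eq)
    then show "1 + 5 * rad TYPE('a) n / \<rho> c \<le> 6" by simp
    show "0 \<le> 1 + 5 * rad TYPE('a) n / \<rho> c" using pos[of c] by (intro add_nonneg_nonneg divide_nonneg_pos) auto
  qed (rule that(2))
  interpret local_critical \<rho> C N U v "K * 6 powr \<theta> * (5 * k) ^ DIM('a)" "K' * 6 powr th'" ep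
  proof unfold_locales
    show "0 < K * 6 powr \<theta> * (5 * k) ^ DIM('a)" "0 < K' * 6 powr th'" using th K' k by auto
    show "\<exists>M. \<forall>n c. (n, c) \<in> cells \<and> x \<in> cell n c \<and> rad TYPE('a) n \<le> \<rho> c \<longrightarrow> n \<le> M" for x
      by (rule local_levels_bounded)
    fix n c assume r: "rad TYPE('a) n \<le> \<rho> c"
    let ?r = "5 * rad TYPE('a) n"
    let ?Q = "cube c ?r"
    have r0: "0 < ?r" by simp
    show "AE y in lebesgue. y \<in> ?Q \<longrightarrow>
         emeasure (density lebesgue U) ?Q \<le> ennreal (K * 6 powr \<theta> * (5 * k) ^ DIM('a) * vol TYPE('a) n) * U y"
      using u_A1[OF r0, of c]
    proof eventually_elim
      case (elim y)
      have "K * (1 + ?r / \<rho> c) powr \<theta> * ?r ^ DIM('a) \<le> K * 6 powr \<theta> * ?r ^ DIM('a)"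
        using th r0 by (intro mult_right_mono mult_left_mono ratio r) auto
      also have "\<dots> = K * 6 powr \<theta> * (5 * k) ^ DIM('a) * vol TYPE('a) n"
        by (simp add: power_mult_distrib rad_vol)
      finally have "ennreal (K * (1 + ?r / \<rho> c) powr \<theta> * ?r ^ DIM('a)) * U y \<le> ennreal (K * 6 powr \<theta> * (5 * k) ^ DIM('a) * vol TYPE('a) n) * U y"
        by (intro mult_right_mono ennreal_leI) auto
      then show ?case using elim by (blast intro: order_trans)
    qed
    obtain m where "0 < m" "weight_of u ?Q = ennreal m" using weight_of_cube[OF u r0] .
    then show "emeasure (density lebesgue U) ?Q \<in> {0<..<\<infinity>}" by (simp add: u_eq)
    have "weight_of (\<lambda>y. v y * u y) ?Q \<noteq> 0"
      unfolding weight_of_def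
    proof (intro integral_cube_pos r0)
      show "AE y in lebesgue. 0 < ennreal (v y * u y)" using weight_pos[OF u] weight_pos[OF v] by eventually_elim simp
    qed measurable
    then show "emeasure (density lebesgue (\<lambda>y. U y * ennreal (v y))) ?Q \<in> {0<..<\<infinity>}"
      using lev(1)[OF r0, of c] by (simp add: uv_eq zero_less_iff_neq_zero)
    fix lam :: real assume lam: "0 < lam"
    have T: "{y \<in> ?Q. v y \<le> s} \<in> sets lebesgue" for s
      by (intro sublevel_measurable vm cube_measurable)
    have "K' * (1 + ?r / \<rho> c) powr th' * lam powr ep \<le> K' * 6 powr th' * lam powr ep"
      using K' by (intro mult_right_mono mult_left_mono ratio r) auto
    then have "ennreal (K' * (1 + ?r / \<rho> c) powr th' * lam powr ep) * weight_of u ?Q \<le> ennreal (K' * 6 powr th' * lam powr ep) * weight_of u ?Q"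
      by (rule mult_right_mono[OF ennreal_leI]) simp
    with lev(2)[OF r0 lam, of c]
    show "emeasure (density lebesgue U) {y \<in> ?Q. v y \<le> lam * (enn2real (emeasure (density lebesgue (\<lambda>y. U y * ennreal (v y))) ?Q) / enn2real (emeasure (density lebesgue U) ?Q))}
        \<le> ennreal (K' * 6 powr th' * lam powr ep) * emeasure (density lebesgue U) ?Q"
      by (simp add: u_eq[OF T] u_eq uv_eq)
  qed (use K' in auto)
  \<comment> \<open>The order of the potential is dictated by \<open>kern_adjoint_bound\<close> and determines the damping exponent \<open>decay s\<close>.\<close>
  define s where "s = real DIM('a) + \<theta> + 1"
  have s: "0 \<le> s" using th by (simp add: s_def)
  obtain Ka where Ka: "0 < Ka" "AE y in lebesgue. \<forall>x r. 0 < r \<longrightarrow> y \<in> cube x r \<longrightarrow>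
      emeasure (density lebesgue U) (cube x r) \<le> ennreal (Ka * (1 + r / \<rho> x) powr \<theta> * r ^ DIM('a)) * U y"
    using A1_uniform[OF th(2,1) _ u_A1] by auto
  obtain Kb where Kb: "0 < Kb" "AE y in lebesgue. (\<integral>\<^sup>+x. ennreal (kern s x y) * U x \<partial>lebesgue) \<le> ennreal Kb * U y"
    using kern_adjoint_bound[OF Um Ka(1) th(1) Ka(2) s_def] by blast
  obtain B1 where B1: "0 < B1" "\<And>G x0 r x. G \<in> borel_measurable lebesgue \<Longrightarrow> 0 < r \<Longrightarrow> 1 * \<rho> x0 \<le> r \<Longrightarrow> x \<in> cube x0 (5 * r) \<Longrightarrow>
    ennreal ((1 + r / \<rho> x0) powr (- decay s)) * ((\<integral>\<^sup>+y\<in>cube x0 r. G y \<partial>lebesgue) / emeasure lebesgue (cube x0 r))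
      \<le> ennreal B1 * pot s G x"
    using large_cube_le_pot[OF zero_less_one s] by blast
  obtain B2 where B2: "0 < B2" "\<And>G x x0 r. G \<in> borel_measurable lebesgue \<Longrightarrow> 0 < r \<Longrightarrow> r < \<rho> x0 \<Longrightarrow> x \<in> cube x0 r \<Longrightarrow> 0 < v x \<Longrightarrow>
     ennreal (v x) \<le> (\<integral>\<^sup>+y\<in>cube x0 r. G y \<partial>lebesgue) / emeasure lebesgue (cube x0 r) \<Longrightarrow>
     x \<in> (\<Union>(k, p)\<in>stops G. {y \<in> big p. v y \<le> cover_const * base powi k}) \<or> ennreal (v x) \<le> ennreal B2 * pot s G x"
    using small_cube_cases[OF s] by blast
  obtain C1 where C1: "0 < C1" "\<And>G. G \<in> borel_measurable lebesgue \<Longrightarrow>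
    emeasure nu (\<Union>(k, p)\<in>stops G. {y \<in> big p. v y \<le> cover_const * base powi k}) \<le> ennreal C1 * (\<integral>\<^sup>+y. G y * U y \<partial>lebesgue)"
    using local_estimate[OF cover_const_pos] by blast
  define B where "B = B1 + B2"
  have B: "0 < B" "B1 \<le> B" "B2 \<le> B" using B1 B2 by (auto simp: B_def)
  define Cf where "Cf = B * Kb + C1"
  have Cf: "0 < Cf" using B Kb C1 by (simp add: Cf_def add_pos_pos)
  have dec: "0 \<le> decay s" using s N by (simp add: decay_def)
  have main: "weight_of (\<lambda>x. u x * v x) {x. maximal \<rho> (decay s) (\<lambda>y. f y * v y) x / ennreal (v x) > ennreal t}
      \<le> ennreal (Cf / t) * (\<integral>\<^sup>+x. ennreal (\<bar>f x\<bar> * u x * v x) \<partial>lebesgue)"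
    if t: "0 < t" and fm [measurable]: "f \<in> borel_measurable lebesgue" for t and f :: "'a \<Rightarrow> real"
  proof -
    \<comment> \<open>Dividing by \<open>t\<close> here reduces everything to the level 1.\<close>
    define G where "G = (\<lambda>y. ennreal (1 / t) * ennreal \<bar>f y * v y\<bar>)"
    have Gm [measurable]: "G \<in> borel_measurable lebesgue" unfolding G_def by measurable
    let ?S = "{x. maximal \<rho> (decay s) (\<lambda>y. f y * v y) x / ennreal (v x) > ennreal t}"
    define P where "P = {x. ennreal (v x) \<le> ennreal B * pot s G x}"
    define W where "W = (\<Union>(k, p)\<in>stops G. {y \<in> big p. v y \<le> cover_const * base powi k})"
    have Wm [measurable]: "W \<in> sets lebesgue"
      unfolding W_def by (intro sets.countable_UN' countable_stops[OF order_refl]) (auto split: prod.split)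
    have cover: "x \<in> P \<or> x \<in> W" if x: "x \<in> ?S" and vx: "0 < v x" for x
    proof -
      have "ennreal t * ennreal (v x) < maximal \<rho> (decay s) (\<lambda>y. f y * v y) x"
      proof (rule ccontr)
        assume "\<not> ?thesis"
        then have "maximal \<rho> (decay s) (\<lambda>y. f y * v y) x / ennreal (v x) \<le> ennreal t * ennreal (v x) / ennreal (v x)"
          by (intro divide_right_mono_ennreal) simp
        also have "\<dots> = ennreal t" using vx by (simp add: ennreal_mult_divide_eq)
        finally show False using x by simp
      qed
      then obtain x0 r where r: "0 < r" "x \<in> cube x0 r"
        and lt: "ennreal t * ennreal (v x) < ennreal ((1 + r / \<rho> x0) powr (- decay s)) *
          ((\<integral>\<^sup>+y\<in>cube x0 r. ennreal \<bar>f y * v y\<bar> \<partial>lebesgue) / emeasure lebesgue (cube x0 r))"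
        unfolding maximal_def less_SUP_iff by auto
      have GI: "(\<integral>\<^sup>+y\<in>cube x0 r. G y \<partial>lebesgue) = ennreal (1 / t) * (\<integral>\<^sup>+y\<in>cube x0 r. ennreal \<bar>f y * v y\<bar> \<partial>lebesgue)"
        unfolding G_def by (simp add: nn_integral_cmult mult.assoc)
      have "ennreal (1 / t) * (ennreal t * ennreal (v x)) \<le> ennreal (1 / t) * (ennreal ((1 + r / \<rho> x0) powr (- decay s)) *
          ((\<integral>\<^sup>+y\<in>cube x0 r. ennreal \<bar>f y * v y\<bar> \<partial>lebesgue) / emeasure lebesgue (cube x0 r)))"
        using lt by (intro mult_left_mono) auto
      also have "\<dots> = ennreal ((1 + r / \<rho> x0) powr (- decay s)) * ((\<integral>\<^sup>+y\<in>cube x0 r. G y \<partial>lebesgue) / emeasure lebesgue (cube x0 r))"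
        unfolding GI by (simp only: ennreal_times_divide mult.left_commute)
      finally have le: "ennreal (v x) \<le> ennreal ((1 + r / \<rho> x0) powr (- decay s)) * ((\<integral>\<^sup>+y\<in>cube x0 r. G y \<partial>lebesgue) / emeasure lebesgue (cube x0 r))"
        using t by (simp only: ennreal_cancel_left)
      have toP: "x \<in> P" if "ennreal (v x) \<le> ennreal B' * pot s G x" "B' \<le> B" for B'
        unfolding P_def using that order_trans[OF that(1) mult_right_mono[OF ennreal_leI[OF that(2)], of "pot s G x"]] by simp
      show ?thesis
      proof (cases "\<rho> x0 \<le> r")
        case True
        have "x \<in> cube x0 (5 * r)" using r cube_mono[of r "5 * r" x0] by auto
        then have "ennreal (v x) \<le> ennreal B1 * pot s G x"
          using B1(2)[OF Gm r(1), of x0 x] True le by (auto intro: order_trans)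
        then show ?thesis using toP B by blast
      next
        case False
        have "(1 + r / \<rho> x0) powr (- decay s) \<le> 1 powr (- decay s)"
          using dec r pos[of x0] by (intro powr_mono2') auto
        then have "ennreal ((1 + r / \<rho> x0) powr (- decay s)) * ((\<integral>\<^sup>+y\<in>cube x0 r. G y \<partial>lebesgue) / emeasure lebesgue (cube x0 r))
           \<le> 1 * ((\<integral>\<^sup>+y\<in>cube x0 r. G y \<partial>lebesgue) / emeasure lebesgue (cube x0 r))"
          by (intro mult_right_mono) (auto simp: ennreal_le_1)
        then have "ennreal (v x) \<le> (\<integral>\<^sup>+y\<in>cube x0 r. G y \<partial>lebesgue) / emeasure lebesgue (cube x0 r)" using le by simp
        then show ?thesis
          using B2(2)[OF Gm r(1) _ r(2) vx] False toP B unfolding W_def by auto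
      qed
    qed
    have "weight_of (\<lambda>x. u x * v x) ?S \<le> (\<integral>\<^sup>+x. ennreal B * (pot s G x * U x) + U x * ennreal (v x) * indicator W x \<partial>lebesgue)"
      unfolding weight_of_def
    proof (intro nn_integral_mono_AE)
      show "AE x in lebesgue. ennreal (u x * v x) * indicator ?S x \<le> ennreal B * (pot s G x * U x) + U x * ennreal (v x) * indicator W x"
        using weight_pos[OF u] weight_pos[OF v]
      proof eventually_elim
        case (elim x)
        have uv: "ennreal (u x * v x) = U x * ennreal (v x)" using elim by (simp add: U_def ennreal_mult)
        show ?case
        proof (cases "x \<in> ?S")
          case True
          from cover[OF True elim(2)] show ?thesis
          proof
            assume "x \<in> P"
            then have "U x * ennreal (v x) \<le> U x * (ennreal B * pot s G x)" by (intro mult_left_mono) (auto simp: P_def)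
            also have "\<dots> \<le> ennreal B * (pot s G x * U x) + U x * ennreal (v x) * indicator W x" by (simp add: ac_simps)
            finally show ?thesis using True uv by simp
          next
            assume "x \<in> W"
            then show ?thesis using True uv by simp
          qed
        qed simp
      qed
    qed
    also have "\<dots> = ennreal B * (\<integral>\<^sup>+x. pot s G x * U x \<partial>lebesgue) + emeasure nu W"
      by (subst nn_integral_add) (auto simp: nn_integral_cmult emeasure_nu)
    also have "\<dots> \<le> ennreal B * (ennreal Kb * (\<integral>\<^sup>+y. G y * U y \<partial>lebesgue)) + ennreal C1 * (\<integral>\<^sup>+y. G y * U y \<partial>lebesgue)"
      unfolding W_def by (intro add_mono mult_left_mono pot_weighted_bound Kb(2) C1(2)) auto
    also have "\<dots> = ennreal Cf * (\<integral>\<^sup>+y. G y * U y \<partial>lebesgue)"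
      using B Kb C1 by (simp add: Cf_def ennreal_mult distrib_right mult.assoc)
    also have "(\<integral>\<^sup>+y. G y * U y \<partial>lebesgue) = (\<integral>\<^sup>+y. ennreal (1 / t) * ennreal (\<bar>f y\<bar> * u y * v y) \<partial>lebesgue)"
    proof (intro nn_integral_cong_AE)
      show "AE y in lebesgue. G y * U y = ennreal (1 / t) * ennreal (\<bar>f y\<bar> * u y * v y)"
        using weight_pos[OF u] weight_pos[OF v]
      proof eventually_elim
        case (elim y)
        have "ennreal \<bar>f y * v y\<bar> * ennreal (u y) = ennreal (\<bar>f y\<bar> * u y * v y)"
          using elim by (subst ennreal_mult[symmetric]) (auto simp: abs_mult ac_simps)
        then show ?case by (simp add: G_def U_def mult.assoc)
      qed
    qed
    also have "\<dots> = ennreal (1 / t) * (\<integral>\<^sup>+x. ennreal (\<bar>f x\<bar> * u x * v x) \<partial>lebesgue)"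
      by (intro nn_integral_cmult) measurable
    also have "ennreal Cf * (ennreal (1 / t) * (\<integral>\<^sup>+x. ennreal (\<bar>f x\<bar> * u x * v x) \<partial>lebesgue)) = ennreal (Cf / t) * (\<integral>\<^sup>+x. ennreal (\<bar>f x\<bar> * u x * v x) \<partial>lebesgue)"
      using Cf t by (simp add: mult.assoc[symmetric] ennreal_mult[symmetric])
    finally show ?thesis .
  qed
  show ?thesis
    by (rule exI[of _ "decay s"], intro conjI dec, rule exI[of _ Cf]) (use Cf main in blast)
qed

end
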